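(* Let $\Omega\subset\mathbb{R}^2$ be a bounded Lipschitz domain that is symmetric with respect to the $x_2$-axis, i.e., $\Omega=\Omega^+\cup L_0\cup\Omega^-$, where $\Omega^-$ is the reflection of $\Omega^+$ along the $x_2$-axis and $L_0$ is part of this axis. Let $r>0$ be such that $\overline{B_r^\pm}\subset\Omega$, where $B_r^\pm=B_r(\pm r,0)$, let $g=\chi_{B_r^+}-\chi_{B_r^-}$, let $\alpha>0$ with $\alpha r>2$, and let $u=(1-2/(\alpha r))\,g$ be the minimizer of $I(v)=|Dv|(\Omega)+\frac{\alpha}{2}\|g-v\|^2$ over $v\in BV(\Omega)\cap L^2(\Omega)$ subject to $v|_{\partial\Omega}=0$. Then any dual solution $z\in W^2(\mathrm{div};\Omega)$ satisfies $\mathrm{div}\,z=\alpha(u-g)$, i.e., $$\mathrm{div}\,z=-\frac{2}{r}\,g,$$ and $z\in\partial|Du|$, i.e., $$z=-\nu^+\ \text{ on }\partial B_r^+,\qquad z=+\nu^-\ \text{ on }\partial B_r^-,$$ where $\nu^\pm$ is the outer unit normal on $\partial B_r^\pm$. In particular, for every $\theta>1/2$, $z$ is not $\theta$-Hölder continuous at $x=0$.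
   Context: $\|\cdot\|$ is the norm of $L^2(\Omega)$ and $|Dv|(\Omega)$ is the total variation. $\Omega^\pm$ are the parts of $\Omega$ in $\{\pm x_1>0\}$. $W^2(\mathrm{div};\Omega)$ is the space of vector fields $z\in L^2(\Omega;\mathbb{R}^2)$ with weak divergence $\mathrm{div}\,z\in L^2(\Omega)$. A dual solution is a maximizer over $W^2(\mathrm{div};\Omega)$ of $$D(z)=-\frac{1}{2\alpha}\|\mathrm{div}\,z+\alpha g\|^2+\frac{\alpha}{2}\|g\|^2-I_{K_1(0)}(z),$$ where $I_{K_1(0)}(z)=0$ if $|z|\le 1$ a.e. in $\Omega$ and $+\infty$ otherwise (no boundary condition is imposed on $z$ because of the Dirichlet condition on $u$). The relation $z\in\partial|Du|$ means $|z|\le1$ a.e. and $-\int_\Omega u\,\mathrm{div}\,z\,dx=|Du|(\Omega)$. The identities $z=\mp\nu^\pm$ on $\partial B_r^\pm$ are understood in the sense of normal traces together with $|z|\le 1$, i.e. the normal trace of $z$ satisfies $z\cdot\nu^\pm=\mp1$ on $\partial B_r^\pm$; where $z$ has a continuous representative they hold pointwise. "Not $\theta$-Hölder continuous at $x=0$" means that there is no neighborhood of $0$ in which $z$ has a $\theta$-Hölder continuous representative. *)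

theory Defs
  imports "HOL-Analysis.Analysis"
begin

text \<open>Functions on \<open>\<Omega>\<close> are represented by total functions on \<open>\<real>\<^sup>2\<close>; only the values on \<open>\<Omega>\<close>
  matter, and elements of Lebesgue spaces are given by arbitrary representatives.\<close>

section \<open>Domains\<close>

definition lipschitz_boundary :: "(real^2) set \<Rightarrow> bool" where
  "lipschitz_boundary \<Omega> \<longleftrightarrow>
    (\<forall>p\<in>frontier \<Omega>. \<exists>\<rho>>0. \<exists>T :: real^2 \<Rightarrow> real^2. \<exists>\<gamma> :: real \<Rightarrow> real. \<exists>L.
        orthogonal_transformation T \<and> L-lipschitz_on UNIV \<gamma> \<and>
        \<Omega> \<inter> ball p \<rho> = {x \<in> ball p \<rho>. T x $ 2 > \<gamma> (T x $ 1)})"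

definition bounded_lipschitz_domain :: "(real^2) set \<Rightarrow> bool" where
  "bounded_lipschitz_domain \<Omega> \<longleftrightarrow>
    open \<Omega> \<and> connected \<Omega> \<and> \<Omega> \<noteq> {} \<and> bounded \<Omega> \<and> lipschitz_boundary \<Omega>"

definition right_part :: "(real^2) set \<Rightarrow> (real^2) set" where
  "right_part \<Omega> = {x \<in> \<Omega>. x $ 1 > 0}"

definition left_part :: "(real^2) set \<Rightarrow> (real^2) set" where
  "left_part \<Omega> = {x \<in> \<Omega>. x $ 1 < 0}"

definition reflect_x2_axis :: "real^2 \<Rightarrow> real^2" where
  "reflect_x2_axis x = vector [- (x $ 1), x $ 2]"

text \<open>The remaining part \<open>{x \<in> \<Omega>. x $ 1 = 0}\<close> is the set \<open>L\<^sub>0\<close>; it is contained in the axis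
  and so imposes no condition.\<close>

definition symmetric_x2_axis :: "(real^2) set \<Rightarrow> bool" where
  "symmetric_x2_axis \<Omega> \<longleftrightarrow> left_part \<Omega> = reflect_x2_axis ` right_part \<Omega>"

section \<open>Continuously differentiable functions\<close>

definition grad :: "(real^2 \<Rightarrow> real) \<Rightarrow> real^2 \<Rightarrow> real^2" where
  "grad \<phi> x = (\<chi> i. frechet_derivative \<phi> (at x) (axis i 1))"

definition C1 :: "(real^2 \<Rightarrow> real) \<Rightarrow> bool" where
  "C1 \<phi> \<longleftrightarrow> (\<forall>x. \<phi> differentiable (at x)) \<and> continuous_on UNIV (grad \<phi>)"

definition divergence :: "(real^2 \<Rightarrow> real^2) \<Rightarrow> real^2 \<Rightarrow> real" where
  "divergence \<phi> x = (\<Sum>i\<in>UNIV. grad (\<lambda>y. \<phi> y $ i) x $ i)"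

definition compactly_supported_in :: "(real^2) set \<Rightarrow> (real^2 \<Rightarrow> 'b::zero) \<Rightarrow> bool" where
  "compactly_supported_in \<Omega> \<phi> \<longleftrightarrow>
    compact (closure {x. \<phi> x \<noteq> 0}) \<and> closure {x. \<phi> x \<noteq> 0} \<subseteq> \<Omega>"

definition test_functions :: "(real^2) set \<Rightarrow> (real^2 \<Rightarrow> real) set" where
  "test_functions \<Omega> = {\<phi>. C1 \<phi> \<and> compactly_supported_in \<Omega> \<phi>}"

definition test_fields :: "(real^2) set \<Rightarrow> (real^2 \<Rightarrow> real^2) set" where
  "test_fields \<Omega> = {\<phi>. (\<forall>i. C1 (\<lambda>x. \<phi> x $ i)) \<and> compactly_supported_in \<Omega> \<phi>}"

section \<open>\<open>L\<^sup>2\<close> functions and the weak divergence\<close>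

definition L2 :: "(real^2) set \<Rightarrow> (real^2 \<Rightarrow> 'b::euclidean_space) set" where
  "L2 \<Omega> = {f. f \<in> borel_measurable (lebesgue_on \<Omega>) \<and>
              integrable (lebesgue_on \<Omega>) (\<lambda>x. (norm (f x))\<^sup>2)}"

definition L2norm :: "(real^2) set \<Rightarrow> (real^2 \<Rightarrow> 'b::euclidean_space) \<Rightarrow> real" where
  "L2norm \<Omega> f = sqrt (LINT x|lebesgue_on \<Omega>. (norm (f x))\<^sup>2)"

text \<open>Weak derivatives are tested with \<open>C\<^sup>1\<close> functions of compact support (as in Gilbarg and
  Trudinger); for locally integrable \<open>z\<close> and \<open>w\<close> this is equivalent to testing with smooth ones.\<close>

definition has_weak_divergence ::
    "(real^2) set \<Rightarrow> (real^2 \<Rightarrow> real^2) \<Rightarrow> (real^2 \<Rightarrow> real) \<Rightarrow> bool" where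
  "has_weak_divergence \<Omega> z w \<longleftrightarrow>
    (\<forall>\<phi>\<in>test_functions \<Omega>.
      (LINT x|lebesgue_on \<Omega>. z x \<bullet> grad \<phi> x) = - (LINT x|lebesgue_on \<Omega>. w x * \<phi> x))"

definition W2_div :: "(real^2) set \<Rightarrow> (real^2 \<Rightarrow> real^2) set" where
  "W2_div \<Omega> = {z \<in> L2 \<Omega>. \<exists>w\<in>L2 \<Omega>. has_weak_divergence \<Omega> z w}"

text \<open>A representative of the weak divergence, which is unique up to null sets.\<close>

definition weak_div :: "(real^2) set \<Rightarrow> (real^2 \<Rightarrow> real^2) \<Rightarrow> real^2 \<Rightarrow> real" where
  "weak_div \<Omega> z = (SOME w. w \<in> L2 \<Omega> \<and> has_weak_divergence \<Omega> z w)"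

section \<open>Functions of bounded variation\<close>

definition total_variation :: "(real^2) set \<Rightarrow> (real^2 \<Rightarrow> real) \<Rightarrow> ereal" where
  "total_variation \<Omega> v =
    (SUP \<phi>\<in>{\<phi> \<in> test_fields \<Omega>. \<forall>x. norm (\<phi> x) \<le> 1}.
       ereal (LINT x|lebesgue_on \<Omega>. v x * divergence \<phi> x))"

definition BV :: "(real^2) set \<Rightarrow> (real^2 \<Rightarrow> real) set" where
  "BV \<Omega> = {v. integrable (lebesgue_on \<Omega>) v \<and> total_variation \<Omega> v < \<infinity>}"

text \<open>One-dimensional Hausdorff (outer) measure.\<close>

definition hausdorff1 :: "(real^2) set \<Rightarrow> ennreal" where
  "hausdorff1 A =
    (SUP \<delta>\<in>{0::real<..}.
      INF C\<in>{C :: nat \<Rightarrow> (real^2) set.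
               A \<subseteq> (\<Union>i. C i) \<and> (\<forall>i. bounded (C i) \<and> diameter (C i) \<le> \<delta>)}.
        (\<Sum>i. ennreal (diameter (C i))))"

text \<open>The trace of a \<open>BV\<close> function on the boundary of a Lipschitz domain exists at almost every
  boundary point as a limit of means over \<open>\<Omega> \<inter> B\<^sub>\<rho>(x)\<close> in the following sense.\<close>

definition has_trace_at :: "(real^2) set \<Rightarrow> (real^2 \<Rightarrow> real) \<Rightarrow> real^2 \<Rightarrow> real \<Rightarrow> bool" where
  "has_trace_at \<Omega> v x t \<longleftrightarrow>
    ((\<lambda>\<rho>. (LINT y|lebesgue_on (\<Omega> \<inter> ball x \<rho>). \<bar>v y - t\<bar>) / measure lebesgue (\<Omega> \<inter> ball x \<rho>))
      \<longlongrightarrow> 0) (at_right 0)"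

definition zero_trace :: "(real^2) set \<Rightarrow> (real^2 \<Rightarrow> real) \<Rightarrow> bool" where
  "zero_trace \<Omega> v \<longleftrightarrow>
    (\<exists>N. hausdorff1 N = 0 \<and> (\<forall>x\<in>frontier \<Omega> - N. has_trace_at \<Omega> v x 0))"

section \<open>The primal and the dual problem\<close>

definition primal_admissible :: "(real^2) set \<Rightarrow> (real^2 \<Rightarrow> real) set" where
  "primal_admissible \<Omega> = {v \<in> BV \<Omega> \<inter> L2 \<Omega>. zero_trace \<Omega> v}"

definition primal_functional ::
    "(real^2) set \<Rightarrow> real \<Rightarrow> (real^2 \<Rightarrow> real) \<Rightarrow> (real^2 \<Rightarrow> real) \<Rightarrow> ereal" where
  "primal_functional \<Omega> \<alpha> g v =
    total_variation \<Omega> v + ereal (\<alpha> / 2 * (L2norm \<Omega> (\<lambda>x. g x - v x))\<^sup>2)"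

definition primal_solution ::
    "(real^2) set \<Rightarrow> real \<Rightarrow> (real^2 \<Rightarrow> real) \<Rightarrow> (real^2 \<Rightarrow> real) \<Rightarrow> bool" where
  "primal_solution \<Omega> \<alpha> g u \<longleftrightarrow>
    u \<in> primal_admissible \<Omega> \<and>
    (\<forall>v\<in>primal_admissible \<Omega>. primal_functional \<Omega> \<alpha> g u \<le> primal_functional \<Omega> \<alpha> g v)"

definition unit_ball_indicator :: "(real^2) set \<Rightarrow> (real^2 \<Rightarrow> real^2) \<Rightarrow> ereal" where
  "unit_ball_indicator \<Omega> z = (if AE x in lebesgue_on \<Omega>. norm (z x) \<le> 1 then 0 else \<infinity>)"

definition dual_functional ::
    "(real^2) set \<Rightarrow> real \<Rightarrow> (real^2 \<Rightarrow> real) \<Rightarrow> (real^2 \<Rightarrow> real^2) \<Rightarrow> ereal" where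
  "dual_functional \<Omega> \<alpha> g z =
    ereal (- (1 / (2 * \<alpha>)) * (L2norm \<Omega> (\<lambda>x. weak_div \<Omega> z x + \<alpha> * g x))\<^sup>2
           + \<alpha> / 2 * (L2norm \<Omega> g)\<^sup>2)
    - unit_ball_indicator \<Omega> z"

definition dual_solution ::
    "(real^2) set \<Rightarrow> real \<Rightarrow> (real^2 \<Rightarrow> real) \<Rightarrow> (real^2 \<Rightarrow> real^2) \<Rightarrow> bool" where
  "dual_solution \<Omega> \<alpha> g z \<longleftrightarrow>
    z \<in> W2_div \<Omega> \<and> (\<forall>y\<in>W2_div \<Omega>. dual_functional \<Omega> \<alpha> g y \<le> dual_functional \<Omega> \<alpha> g z)"

definition in_TV_subdifferential ::
    "(real^2) set \<Rightarrow> (real^2 \<Rightarrow> real^2) \<Rightarrow> (real^2 \<Rightarrow> real) \<Rightarrow> bool" where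
  "in_TV_subdifferential \<Omega> z u \<longleftrightarrow>
    (AE x in lebesgue_on \<Omega>. norm (z x) \<le> 1) \<and>
    ereal (- (LINT x|lebesgue_on \<Omega>. u x * weak_div \<Omega> z x)) = total_variation \<Omega> u"

section \<open>The two discs\<close>

text \<open>\<open>B\<^sub>r\<^sup>+\<close> is \<open>disc r r\<close> and \<open>B\<^sub>r\<^sup>-\<close> is \<open>disc (- r) r\<close>.\<close>

definition disc_center :: "real \<Rightarrow> real^2" where
  "disc_center s = vector [s, 0]"

abbreviation disc :: "real \<Rightarrow> real \<Rightarrow> (real^2) set" where
  "disc s r \<equiv> ball (disc_center s) r"

definition two_disc_data :: "real \<Rightarrow> real^2 \<Rightarrow> real" where
  "two_disc_data r x = indicator (disc r r) x - indicator (disc (- r) r) x"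

definition outer_normal :: "real^2 \<Rightarrow> real \<Rightarrow> real^2 \<Rightarrow> real^2" where
  "outer_normal c r x = (1 / r) *\<^sub>R (x - c)"

section \<open>Normal traces on circles\<close>

definition circle_integral :: "real^2 \<Rightarrow> real \<Rightarrow> (real^2 \<Rightarrow> real) \<Rightarrow> real" where
  "circle_integral c r f =
    integral {0..2*pi} (\<lambda>\<theta>. f (c + r *\<^sub>R vector [cos \<theta>, sin \<theta>]) * r)"

text \<open>The normal trace \<open>z \<cdot> \<nu>\<close> on the boundary of a disc \<open>B\<close> with closure in \<open>\<Omega>\<close>, in the weak
  sense of Green's formula.  As the weak divergence of \<open>z\<close> exists in all of \<open>\<Omega>\<close>, the trace
  from the exterior of \<open>B\<close> is the same.\<close>

definition has_normal_trace_on_circle ::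
    "(real^2) set \<Rightarrow> (real^2 \<Rightarrow> real^2) \<Rightarrow> real^2 \<Rightarrow> real \<Rightarrow> (real^2 \<Rightarrow> real) \<Rightarrow> bool" where
  "has_normal_trace_on_circle \<Omega> z c r t \<longleftrightarrow>
    (\<forall>\<phi>. C1 \<phi> \<longrightarrow>
      (LINT x|lebesgue_on (ball c r). weak_div \<Omega> z x * \<phi> x + z x \<bullet> grad \<phi> x)
        = circle_integral c r (\<lambda>x. t x * \<phi> x))"

section \<open>Continuous and Hoelder continuous representatives\<close>

definition continuous_representative_on ::
    "(real^2) set \<Rightarrow> (real^2 \<Rightarrow> real^2) \<Rightarrow> (real^2 \<Rightarrow> real^2) \<Rightarrow> bool" where
  "continuous_representative_on U z z' \<longleftrightarrow>
    continuous_on U z' \<and> (AE x in lebesgue_on U. z' x = z x)"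

definition hoelder_on :: "real \<Rightarrow> (real^2) set \<Rightarrow> (real^2 \<Rightarrow> real^2) \<Rightarrow> bool" where
  "hoelder_on \<theta> U f \<longleftrightarrow> (\<exists>C. \<forall>x\<in>U. \<forall>y\<in>U. dist (f x) (f y) \<le> C * dist x y powr \<theta>)"

definition hoelder_at :: "(real^2) set \<Rightarrow> real \<Rightarrow> (real^2 \<Rightarrow> real^2) \<Rightarrow> real^2 \<Rightarrow> bool" where
  "hoelder_at \<Omega> \<theta> z x0 \<longleftrightarrow>
    (\<exists>U z'. open U \<and> x0 \<in> U \<and> U \<subseteq> \<Omega> \<and> (AE x in lebesgue_on U. z' x = z x) \<and> hoelder_on \<theta> U z')"

end

theory Submission
  imports Defs
begin

text \<open>Write \<open>B\<^sup>\<plusminus>\<close> for the two discs, which touch at the origin, and \<open>G = \<integral>\<^sub>\<Omega> g\<^sup>2 = 2 \<pi> r\<^sup>2\<close>.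

A field with \<open>\<bar>z\<bar> \<le> 1\<close> carries at most the perimeter \<open>2 \<pi> r\<close> through each circle, so
\<open>\<integral>\<^sub>\<Omega> g div z \<ge> - 4 \<pi> r = - (2/r) G\<close> (\<open>integral_div_ge\<close>).  There is a field for which this bound is
attained with divergence \<open>- (2/r) g\<close>.  In the right half plane it is \<open>- (x - c)/r\<close> inside the disc
with centre \<open>c = (r, 0)\<close> and \<open>- r (x - c)/\<bar>x - c\<bar>\<^sup>2\<close> outside; in the left half plane it is the
negative mirror image.  The normal components from the two sides agree on the axis, so no divergence
arises there (\<open>optimal_field_divergence\<close>).

These two facts determine the divergence of every dual solution.  With \<open>w = div z\<close> and
\<open>w\<^sub>0 = - (2/r) g\<close> one has \<open>w\<^sub>0 + \<alpha> g = (\<alpha> - 2/r) g\<close>, hence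
\<open>\<parallel>w + \<alpha> g\<parallel>\<^sup>2 = \<parallel>w\<^sub>0 + \<alpha> g\<parallel>\<^sup>2 + 2 (\<alpha> - 2/r) \<integral> (w - w\<^sub>0) g + \<parallel>w - w\<^sub>0\<parallel>\<^sup>2\<close>.  The middle
term is nonnegative by the flux bound, because \<open>\<alpha> r > 2\<close>.  A maximizer of the dual functional makes the
left side at most \<open>\<parallel>w\<^sub>0 + \<alpha> g\<parallel>\<^sup>2\<close>, so \<open>w = w\<^sub>0\<close>.

The total variation of \<open>u = k\<^sub>0 g\<close>, where \<open>k\<^sub>0 = 1 - 2/(\<alpha> r)\<close>, follows from the minimality of \<open>u\<close>.
Since \<open>|D((1 + h) u)| \<le> (1 + h) |Du|\<close>, the primal functional at \<open>(1 + h) u\<close> is at most a quadratic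
polynomial in \<open>h\<close>, with equality at \<open>h = 0\<close>.  The linear term of this polynomial must vanish, which means
\<open>|Du|(\<Omega>) = \<alpha> (1 - k\<^sub>0) k\<^sub>0 \<parallel>g\<parallel>\<^sup>2\<close> (\<open>total_variation_of_minimizer\<close>).  This is \<open>- \<integral> u div z\<close>.

For the traces, the integral of \<open>div z\<close> over \<open>B\<^sup>+\<close> is \<open>- 2 \<pi> r\<close>, the extreme value.  In a thin layer inside the
circle the nonnegative quantity \<open>1 + z \<cdot> \<nu>\<close> therefore has mean tending to \<open>0\<close>.  Testing with \<open>\<phi>\<close>
shows that the normal trace is \<open>-1\<close>, and for a continuous representative that \<open>z \<cdot> \<nu> = -1\<close>
at each point of the circle where it is defined, which together with \<open>\<bar>z\<bar> \<le> 1\<close> forces \<open>z = - \<nu>\<close>.  The disc \<open>B\<^sup>-\<close> is the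
same statement for \<open>- z\<close>.

Finally, at height \<open>t\<close> the two circles are at distance about \<open>t\<^sup>2/r\<close>, while the prescribed values differ by
\<open>2 t/r\<close>.  This is incompatible with Hoelder continuity for exponents above \<open>1/2\<close>.\<close>

section \<open>Polar coordinates in the plane\<close>

lemma vector2_eq: "(vector [a, b] :: real^2) = a *\<^sub>R axis 1 1 + b *\<^sub>R axis 2 1"
  by (simp add: vec_eq_iff forall_2 axis_def)

lemma Basis_real2: "(Basis :: (real^2) set) = {axis 1 1, axis 2 1}" "axis 1 1 \<noteq> (axis 2 1 :: real^2)"
  by (auto simp: Basis_vec_def UNIV_2 axis_eq_axis)

text \<open>Fubini's theorem is stated for pairs, so the plane of vectors is identified with the product of two
lines as a measure space.\<close>

lemma lborel_vec2:
  "(lborel :: (real^2) measure) = distr (lborel :: (real \<times> real) measure) borel (\<lambda>p. vector [fst p, snd p])"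
proof (rule lborel_eqI)
  have cont: "continuous_on UNIV (\<lambda>p::real\<times>real. vector [fst p, snd p] :: real^2)"
    unfolding vector2_eq by (intro continuous_intros)
  then have m: "(\<lambda>p::real\<times>real. vector [fst p, snd p] :: real^2) \<in> borel_measurable lborel"
    by (simp add: borel_measurable_continuous_onI)
  fix l u :: "real^2" assume lu: "\<And>b. b \<in> Basis \<Longrightarrow> l \<bullet> b \<le> u \<bullet> b"
  have lu': "l $ i \<le> u $ i" for i
    using lu[of "axis i 1"] by (simp add: inner_axis)
  have "(\<lambda>p::real\<times>real. vector [fst p, snd p]) -` box l u = box (l$1, l$2) (u$1, u$2)"
    by (auto simp: mem_box_cart forall_2 mem_box Basis_prod_def)
  then have "emeasure (distr lborel borel (\<lambda>p::real\<times>real. vector [fst p, snd p])) (box l u)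
     = emeasure lborel (box (l$1, l$2) (u$1, u$2))"
    using m by (simp add: emeasure_distr)
  also have "\<dots> = (\<Prod>b\<in>Basis. ((u$1, u$2) - (l$1, l$2)) \<bullet> b)"
    by (rule emeasure_lborel_box) (use lu' in \<open>auto simp: Basis_prod_def\<close>)
  also have "(\<Prod>b\<in>Basis. ((u$1, u$2) - (l$1, l$2)) \<bullet> b) = (u$1 - l$1) * (u$2 - l$2)"
    by (simp add: Basis_prod_def)
  also have "\<dots> = (\<Prod>b\<in>Basis. (u - l) \<bullet> b)"
    using Basis_real2(2) by (simp add: Basis_real2(1) inner_axis)
  finally show "emeasure (distr lborel borel (\<lambda>p::real\<times>real. vector [fst p, snd p])) (box l u)
     = (\<Prod>b\<in>Basis. (u - l) \<bullet> b)" .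
qed simp

abbreviation polar :: "real^2 \<Rightarrow> real \<Rightarrow> real \<Rightarrow> real^2" where
  "polar c s \<theta> \<equiv> c + s *\<^sub>R vector [cos \<theta>, sin \<theta>]"

lemma norm_unit_vector2: "norm (vector [cos \<theta>, sin \<theta>] :: real^2) = 1"
  by (simp add: norm_eq_sqrt_inner inner_vec_def sum_2 flip: power2_eq_square)

lemma polar_inj:
  assumes "0 < s" "0 < s'" "0 < \<theta>" "\<theta> < 2*pi" "0 < \<theta>'" "\<theta>' < 2*pi"
    and eq: "polar c s \<theta> = polar c s' \<theta>'"
  shows "s = s' \<and> \<theta> = \<theta>'"
proof -
  have "norm (polar c s \<theta> - c) = norm (polar c s' \<theta>' - c)" using eq by simp
  then have "\<bar>s\<bar> * norm (vector [cos \<theta>, sin \<theta>] :: real^2) = \<bar>s'\<bar> * norm (vector [cos \<theta>', sin \<theta>'] :: real^2)"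
    by (metis add_diff_cancel_left' norm_scaleR)
  then have s: "s = s'" using assms by (simp only: norm_unit_vector2)
  then have "(vector [cos \<theta>, sin \<theta>] :: real^2) = vector [cos \<theta>', sin \<theta>']"
    using eq assms by simp
  then have "sin \<theta> = sin \<theta>'" "cos \<theta> = cos \<theta>'"
    by (auto simp: vec_eq_iff forall_2)
  then obtain n :: int where n: "\<theta> = \<theta>' + 2 * pi * of_int n"
    using sin_cos_eq_iff by blast
  then have "\<bar>2 * pi * of_int n\<bar> < 2 * pi * 1" using assms by auto
  then have "\<bar>of_int n :: real\<bar> < 1" by (simp add: abs_mult)
  then have "n = 0" by linarith
  with n have "\<theta> = \<theta>'" by simp
  with s show ?thesis by simp
qed

text \<open>The open parameter rectangle misses only the ray of angle \<open>0\<close> of the disc; removing the whole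
horizontal line through the centre makes the inclusion easy and costs only a null set.\<close>

lemma polar_image:
  assumes "0 < R"
  shows "(\<lambda>p::real^2. polar c (p$1) (p$2)) ` {p. 0 < p$1 \<and> p$1 < R \<and> 0 < p$2 \<and> p$2 < 2*pi}
     \<subseteq> ball c R"
    and "ball c R - {x. x$2 = c$2} \<subseteq>
       (\<lambda>p::real^2. polar c (p$1) (p$2)) ` {p. 0 < p$1 \<and> p$1 < R \<and> 0 < p$2 \<and> p$2 < 2*pi}"
proof -
  show "(\<lambda>p::real^2. polar c (p$1) (p$2)) ` {p. 0 < p$1 \<and> p$1 < R \<and> 0 < p$2 \<and> p$2 < 2*pi}
     \<subseteq> ball c R"
    by (auto simp: dist_norm norm_unit_vector2)
  show "ball c R - {x. x$2 = c$2} \<subseteq>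
       (\<lambda>p::real^2. polar c (p$1) (p$2)) ` {p. 0 < p$1 \<and> p$1 < R \<and> 0 < p$2 \<and> p$2 < 2*pi}"
  proof
    fix x assume x: "x \<in> ball c R - {x. x$2 = c$2}"
    define a where "a = x$1 - c$1" define b where "b = x$2 - c$2"
    define s where "s = norm (x - c)"
    have s2: "s^2 = a^2 + b^2"
      by (simp add: s_def a_def b_def power2_norm_eq_inner inner_vec_def sum_2 flip: power2_eq_square)
    have b: "b \<noteq> 0" using x by (auto simp: b_def)
    have s: "0 < s" using x by (auto simp: s_def)
    have "s < R" using x by (simp add: s_def dist_norm norm_minus_commute)
    have "(a/s)^2 + (b/s)^2 = (a^2 + b^2) / s^2" by (simp add: power_divide add_divide_distrib)
    then have "(a/s)^2 + (b/s)^2 = 1" using s by (simp flip: s2)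
    from sincos_total_2pi[OF this] obtain t where t: "0 \<le> t" "t < 2*pi" "a/s = cos t" "b/s = sin t" by metis
    have "t \<noteq> 0" using t(4) b s by auto
    moreover have "x = polar c s t"
    proof -
      have "s * cos t = a" "s * sin t = b" using t(3,4) s by (simp_all add: field_simps)
      then show ?thesis by (simp add: vec_eq_iff forall_2 a_def b_def)
    qed
    ultimately show "x \<in> (\<lambda>p::real^2. polar c (p$1) (p$2)) ` {p. 0 < p$1 \<and> p$1 < R \<and> 0 < p$2 \<and> p$2 < 2*pi}"
      using t s \<open>s < R\<close> by (intro image_eqI[of _ _ "vector [s, t]"]) auto
  qed
qed

lemma polar_has_derivative:
  fixes p :: "real^2"
  shows "((\<lambda>p::real^2. polar c (p$1) (p$2)) has_derivative
     (\<lambda>h. vector [cos (p$2) * h$1 - p$1 * sin (p$2) * h$2, sin (p$2) * h$1 + p$1 * cos (p$2) * h$2])) (at p within S)"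
proof -
  define e1 e2 :: "real^2" where e: "e1 = axis 1 1" "e2 = axis 2 1"
  have eq: "(vector [a, b] :: real^2) = a *\<^sub>R e1 + b *\<^sub>R e2" for a b :: real
    by (simp add: vec_eq_iff forall_2 axis_def e)
  have nth: "((\<lambda>p::real^2. p $ i) has_derivative (\<lambda>h. h $ i)) (at p within S)" for i
    by (rule bounded_linear_imp_has_derivative) (rule bounded_linear_vec_nth)
  have cs: "((\<lambda>p::real^2. cos (p $ 2)) has_derivative (\<lambda>h. - sin (p $ 2) * h $ 2)) (at p within S)"
    "((\<lambda>p::real^2. sin (p $ 2)) has_derivative (\<lambda>h. cos (p $ 2) * h $ 2)) (at p within S)"
    by (rule has_derivative_eq_rhs, rule has_derivative_cos has_derivative_sin, rule nth, simp add: fun_eq_iff)+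
  have "((\<lambda>p::real^2. c + p$1 *\<^sub>R (cos (p$2) *\<^sub>R e1 + sin (p$2) *\<^sub>R e2)) has_derivative
     (\<lambda>h. 0 + (p$1 *\<^sub>R ((- sin (p $ 2) * h $ 2) *\<^sub>R e1 + (cos (p $ 2) * h $ 2) *\<^sub>R e2)
         + h$1 *\<^sub>R (cos (p$2) *\<^sub>R e1 + sin (p$2) *\<^sub>R e2)))) (at p within S)"
    by (intro has_derivative_add has_derivative_const has_derivative_scaleR[OF nth] has_derivative_scaleR_left cs)
  also have "(\<lambda>h::real^2. 0 + (p$1 *\<^sub>R ((- sin (p $ 2) * h $ 2) *\<^sub>R e1 + (cos (p $ 2) * h $ 2) *\<^sub>R e2)
         + h$1 *\<^sub>R (cos (p$2) *\<^sub>R e1 + sin (p$2) *\<^sub>R e2))) =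
     (\<lambda>h. vector [cos (p$2) * h$1 - p$1 * sin (p$2) * h$2, sin (p$2) * h$1 + p$1 * cos (p$2) * h$2])"
    by (rule ext) (simp add: vec_eq_iff forall_2 axis_def e)
  finally show ?thesis unfolding eq[symmetric] .
qed

lemma polar_det:
  fixes p :: "real^2"
  shows "det (matrix (\<lambda>h::real^2. vector [cos (p$2) * h$1 - p$1 * sin (p$2) * h$2, sin (p$2) * h$1 + p$1 * cos (p$2) * h$2]::real^2)) = p$1"
proof -
  have "p$1 * (cos (p$2) * cos (p$2)) + p$1 * (sin (p$2) * sin (p$2)) = p$1"
    by (simp only: distrib_left[symmetric] sin_cos_squared_add3 mult_1_right)
  then show ?thesis
    by (simp add: det_2 matrix_def axis_def mult_ac)
qed

text \<open>The change of variables formula for real-valued functions, obtained by identifying the reals with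
one-dimensional vectors.\<close>

lemma has_absolute_integral_change_of_variables_real:
  fixes f :: "real^'m::{finite,wellorder} \<Rightarrow> real" and g :: "real^'m::_ \<Rightarrow> real^'m::_"
  assumes S: "S \<in> sets lebesgue"
    and der_g: "\<And>x. x \<in> S \<Longrightarrow> (g has_derivative g' x) (at x within S)"
    and inj: "inj_on g S"
  shows "(\<lambda>x. \<bar>det (matrix (g' x))\<bar> * f(g x)) absolutely_integrable_on S \<and>
           integral S (\<lambda>x. \<bar>det (matrix (g' x))\<bar> * f(g x)) = b
     \<longleftrightarrow> f absolutely_integrable_on (g ` S) \<and> integral (g ` S) f = b"
proof -
  have "(\<lambda>x. \<bar>det (matrix (g' x))\<bar> *\<^sub>R vec (f(g x)) :: real ^ 1) absolutely_integrable_on S \<and>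
           integral S (\<lambda>x. \<bar>det (matrix (g' x))\<bar> *\<^sub>R vec (f(g x))) = (vec b :: real ^ 1)
         \<longleftrightarrow> (\<lambda>x. vec (f x) :: real ^ 1) absolutely_integrable_on (g ` S) \<and>
           integral (g ` S) (\<lambda>x. vec (f x)) = (vec b :: real ^ 1)"
    using assms by (rule has_absolute_integral_change_of_variables)
  then show ?thesis
    by (simp add: absolutely_integrable_on_1_iff integral_on_1_eq)
qed

text \<open>Integration in polar coordinates in the form used below: it suffices to know the weighted integral
along each ray, as a gauge integral.  Integrability of \<open>J\<close> comes out of Fubini's theorem.\<close>

lemma integral_ball_by_rays:
  fixes f :: "real^2 \<Rightarrow> real"
  assumes f[measurable]: "f \<in> borel_measurable borel" and bdd: "\<And>x. x \<in> ball c R \<Longrightarrow> \<bar>f x\<bar> \<le> M" and R: "0 < R"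
    and ray: "\<And>\<theta>. ((\<lambda>s. s * f (polar c s \<theta>)) has_integral J \<theta>) {0..R}"
  shows "(LINT x|lebesgue_on (ball c R). f x) = integral {0..2*pi} J"
proof -
  define g :: "real^2 \<Rightarrow> real^2" where "g = (\<lambda>p. polar c (p$1) (p$2))"
  define S where "S = {p::real^2. 0 < p$1 \<and> p$1 < R \<and> 0 < p$2 \<and> p$2 < 2*pi}"
  define g' where "g' = (\<lambda>(p::real^2) (h::real^2). vector [cos (p$2) * h$1 - p$1 * sin (p$2) * h$2, sin (p$2) * h$1 + p$1 * cos (p$2) * h$2] :: real^2)"
  have S_box: "S = box (vector [0, 0]) (vector [R, 2*pi])"
    by (auto simp: S_def mem_box_cart forall_2)
  have S: "S \<in> sets borel" by (simp add: S_box)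
  have int_f: "set_integrable lborel (ball c R) f"
    unfolding set_integrable_def
    by (rule integrableI_bounded_set_indicator[where B=M]) (use bdd emeasure_bounded_finite[of "ball c R"] in auto)
  have abs_f: "f absolutely_integrable_on ball c R"
    using int_f unfolding set_integrable_def by (subst integrable_completion) auto
  have N: "negligible {x::real^2. x$2 = c$2}"
  proof -
    have "negligible {x::real^2. axis 2 1 \<bullet> x = c$2}" by (rule negligible_hyperplane) simp
    then show ?thesis by (simp add: inner_axis')
  qed
  have "f absolutely_integrable_on ball c R \<longleftrightarrow> f absolutely_integrable_on g ` S"
    by (rule absolutely_integrable_spike_set_eq; rule negligible_subset[OF N];
        use polar_image[OF R, of c] in \<open>auto simp: g_def S_def\<close>)
  then have abs_fS: "f absolutely_integrable_on g ` S" using abs_f by simp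
  have int_eq: "integral (g ` S) f = integral (ball c R) f"
    by (rule integral_spike_set; rule negligible_subset[OF N];
        use polar_image[OF R, of c] in \<open>auto simp: g_def S_def\<close>)
  have inj: "inj_on g S"
  proof (rule inj_onI)
    fix p q assume "p \<in> S" "q \<in> S" "g p = g q"
    then have "p$1 = q$1 \<and> p$2 = q$2"
      unfolding S_def g_def mem_Collect_eq by (intro polar_inj) blast+
    then show "p = q" by (simp add: vec_eq_iff forall_2)
  qed
  have cov: "(\<lambda>p::real^2. p$1 * f (g p)) absolutely_integrable_on S \<and>
      integral S (\<lambda>p::real^2. p$1 * f (g p)) = integral (ball c R) f"
  proof -
    have "(\<lambda>p::real^2. \<bar>det (matrix (g' p))\<bar> * f (g p)) absolutely_integrable_on S \<and>
      integral S (\<lambda>p::real^2. \<bar>det (matrix (g' p))\<bar> * f (g p)) = integral (ball c R) f"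
      using abs_fS int_eq S inj polar_has_derivative
      by (subst has_absolute_integral_change_of_variables_real) (auto simp: g_def g'_def)
    moreover have "\<bar>det (matrix (g' p))\<bar> = p$1" if "p \<in> S" for p :: "real^2"
      using that unfolding g'_def polar_det by (simp add: S_def)
    ultimately show ?thesis
      by (simp cong: set_integrable_cong Henstock_Kurzweil_Integration.integral_cong)
  qed
  have g_meas[measurable]: "g \<in> borel_measurable borel"
  proof (rule borel_measurable_continuous_onI)
    show "continuous_on UNIV g"
      using polar_has_derivative unfolding g_def by (rule has_derivative_continuous_on)
  qed
  define k where "k = (\<lambda>p::real^2. indicator S p * (p$1 * f (g p)))"
  have nth[measurable]: "(\<lambda>p::real^2. p $ i) \<in> borel_measurable borel" for i
    by (intro borel_measurable_continuous_onI continuous_intros)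
  have k[measurable]: "k \<in> borel_measurable borel" using S unfolding k_def by measurable
  have vec[measurable]: "(\<lambda>q::real\<times>real. vector [fst q, snd q] :: real^2) \<in> borel_measurable borel"
    unfolding vector2_eq by (intro borel_measurable_continuous_onI continuous_intros)
  have int_k: "integrable lborel k"
    using cov k by (simp add: k_def set_integrable_def integrable_completion)
  have int_k2: "integrable (lborel \<Otimes>\<^sub>M lborel) (\<lambda>(s,\<theta>). k (vector [s, \<theta>]))"
  proof -
    have "integrable lborel (\<lambda>q::real\<times>real. k (vector [fst q, snd q]))"
      using int_k by (subst (asm) lborel_vec2, subst (asm) integrable_distr_eq) auto
    then show ?thesis by (simp add: lborel_prod case_prod_unfold)
  qed
  have inner: "(LINT s|lborel. k (vector [s, \<theta>])) = indicat_real {0<..<2*pi} \<theta> *\<^sub>R J \<theta>" for \<theta>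
  proof -
    have m: "(\<lambda>s. s * f (polar c s \<theta>)) \<in> borel_measurable borel"
    proof -
      have "(\<lambda>s. polar c s \<theta>) \<in> borel_measurable borel"
        by (intro borel_measurable_continuous_onI continuous_intros)
      then show ?thesis by measurable
    qed
    have "set_integrable lborel {0<..<R} (\<lambda>s. s * f (polar c s \<theta>))"
      unfolding set_integrable_def
    proof (rule integrableI_bounded_set_indicator[where B="R*M"])
      have "norm (s * f (polar c s \<theta>)) \<le> R * M" if "s \<in> {0<..<R}" for s
      proof -
        have "polar c s \<theta> \<in> ball c R" using that by (simp add: dist_norm norm_unit_vector2)
        from bdd[OF this] that show ?thesis by (auto simp: abs_mult intro!: mult_mono)
      qed
      then show "AE s in lborel. s \<in> {0<..<R} \<longrightarrow> norm (s * f (polar c s \<theta>)) \<le> R * M" by simp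
    qed (use m R in auto)
    then have "(LINT s:{0<..<R}|lborel. s * f (polar c s \<theta>)) = integral {0<..<R} (\<lambda>s. s * f (polar c s \<theta>))"
      by (rule set_borel_integral_eq_integral)
    also have "\<dots> = J \<theta>"
      using ray[of \<theta>] by (metis box_real(1) cbox_interval has_integral_open_interval integral_unique)
    finally have J: "(LINT s:{0<..<R}|lborel. s * f (polar c s \<theta>)) = J \<theta>" .
    have "k (vector [s, \<theta>]) = indicat_real {0<..<2*pi} \<theta> *\<^sub>R (indicator {0<..<R} s *\<^sub>R (s * f (polar c s \<theta>)))" for s
      by (auto simp: k_def S_def g_def indicator_def)
    then show ?thesis
      using J by (simp add: set_lebesgue_integral_def)
  qed
  have int_J: "set_integrable lborel {0<..<2*pi} J"
    using lborel_pair.integrable_snd[OF int_k2] by (simp add: inner set_integrable_def)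
  have "(LINT x|lebesgue_on (ball c R). f x) = (LINT x:ball c R|lebesgue. f x)"
    by (simp add: integral_restrict_space set_lebesgue_integral_def)
  also have "\<dots> = integral (ball c R) f"
    using abs_f by (rule set_lebesgue_integral_eq_integral(2))
  also have "\<dots> = integral S (\<lambda>p::real^2. p$1 * f (g p))" using cov by simp
  also have "\<dots> = (LINT p:S|lebesgue. (p::real^2)$1 * f (g p))"
    using cov by (intro set_lebesgue_integral_eq_integral(2)[symmetric]) simp
  also have "\<dots> = integral\<^sup>L lebesgue k" by (simp add: k_def set_lebesgue_integral_def)
  also have "\<dots> = integral\<^sup>L lborel k" by (simp add: integral_completion)
  also have "\<dots> = (LINT q|(lborel \<Otimes>\<^sub>M lborel). k (vector [fst q, snd q]))"
    by (subst lborel_vec2, subst integral_distr) (auto simp: lborel_prod)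
  also have "\<dots> = (LINT \<theta>|lborel. LINT s|lborel. k (vector [s, \<theta>]))"
  proof -
    from lborel_pair.integral_snd[OF int_k2] show ?thesis by (simp add: case_prod_unfold)
  qed
  also have "\<dots> = (LINT \<theta>:{0<..<2*pi}|lborel. J \<theta>)"
    unfolding set_lebesgue_integral_def
    by (simp add: inner)
  also have "\<dots> = integral {0<..<2*pi} J"
    using int_J by (rule set_borel_integral_eq_integral)
  also have "\<dots> = integral {0..2*pi} J" by (metis box_real integral_open_interval)
  finally show ?thesis .
qed

section \<open>Calculus of continuously differentiable functions\<close>

lemma C1_has_derivative:
  assumes "C1 \<phi>"
  shows "(\<phi> has_derivative (\<lambda>h. grad \<phi> x \<bullet> h)) (at x)"
proof -
  have d: "(\<phi> has_derivative frechet_derivative \<phi> (at x)) (at x)"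
    using assms by (simp add: C1_def flip: frechet_derivative_works)
  then have lin: "linear (frechet_derivative \<phi> (at x))" by (rule has_derivative_linear)
  have "frechet_derivative \<phi> (at x) h = grad \<phi> x \<bullet> h" for h
  proof -
    have "frechet_derivative \<phi> (at x) (\<Sum>i\<in>UNIV. h $ i *\<^sub>R axis i 1)
        = (\<Sum>i\<in>UNIV. h $ i *\<^sub>R frechet_derivative \<phi> (at x) (axis i 1))"
      by (simp only: linear_sum[OF lin] linear_scale[OF lin])
    moreover have "(\<Sum>i\<in>UNIV. h $ i *\<^sub>R axis i 1) = h"
      using basis_expansion[of h] by (simp only: scalar_mult_eq_scaleR)
    ultimately show ?thesis by (simp add: grad_def inner_vec_def mult.commute)
  qed
  then have "frechet_derivative \<phi> (at x) = (\<lambda>h. grad \<phi> x \<bullet> h)" by (rule ext)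
  then show ?thesis using d by simp
qed

lemma grad_eqI:
  assumes "(\<phi> has_derivative (\<lambda>h. G \<bullet> h)) (at x)"
  shows "grad \<phi> x = G"
  by (simp add: grad_def vec_eq_iff inner_axis frechet_derivative_at[OF assms, symmetric])

lemma C1_I:
  assumes "\<And>x. (\<phi> has_derivative (\<lambda>h. G x \<bullet> h)) (at x)" "continuous_on UNIV G"
  shows "C1 \<phi>" "grad \<phi> = G"
proof -
  show "grad \<phi> = G" using grad_eqI[OF assms(1)] by blast
  then show "C1 \<phi>" using assms by (auto simp: C1_def differentiable_def)
qed

lemma C1_continuous: "C1 \<phi> \<Longrightarrow> continuous_on S \<phi>"
  by (meson C1_def continuous_at_imp_continuous_on differentiable_imp_continuous_within)

lemma C1_continuous_grad: "C1 \<phi> \<Longrightarrow> continuous_on S (grad \<phi>)"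
  by (meson C1_def continuous_on_subset subset_UNIV)

lemma C1_const: "C1 (\<lambda>x. a)" "grad (\<lambda>x. a) = (\<lambda>x. 0)"
proof -
  have "((\<lambda>x. a) has_derivative (\<lambda>h. 0 \<bullet> h)) (at x)" for x :: "real^2" by simp
  then show "C1 (\<lambda>x. a)" "grad (\<lambda>x. a) = (\<lambda>x. 0)" by (rule C1_I, simp)+
qed

lemma C1_diff:
  assumes "C1 \<phi>" "C1 \<psi>"
  shows "C1 (\<lambda>x. \<phi> x - \<psi> x)" "grad (\<lambda>x. \<phi> x - \<psi> x) = (\<lambda>x. grad \<phi> x - grad \<psi> x)"
proof -
  have "((\<lambda>x. \<phi> x - \<psi> x) has_derivative (\<lambda>h. (grad \<phi> x - grad \<psi> x) \<bullet> h)) (at x)" for x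
    using has_derivative_diff[OF assms[THEN C1_has_derivative]] by (simp add: inner_diff_left)
  moreover have "continuous_on UNIV (\<lambda>x. grad \<phi> x - grad \<psi> x)"
    by (intro continuous_intros C1_continuous_grad assms)
  ultimately show "C1 (\<lambda>x. \<phi> x - \<psi> x)" "grad (\<lambda>x. \<phi> x - \<psi> x) = (\<lambda>x. grad \<phi> x - grad \<psi> x)"
    by (rule C1_I)+
qed

lemma C1_mult:
  assumes "C1 \<phi>" "C1 \<psi>"
  shows "C1 (\<lambda>x. \<phi> x * \<psi> x)" "grad (\<lambda>x. \<phi> x * \<psi> x) = (\<lambda>x. \<phi> x *\<^sub>R grad \<psi> x + \<psi> x *\<^sub>R grad \<phi> x)"
proof -
  have "((\<lambda>x. \<phi> x * \<psi> x) has_derivative (\<lambda>h. (\<phi> x *\<^sub>R grad \<psi> x + \<psi> x *\<^sub>R grad \<phi> x) \<bullet> h)) (at x)" for x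
    by (rule has_derivative_eq_rhs[OF has_derivative_mult[OF assms[THEN C1_has_derivative]]])
       (simp add: fun_eq_iff inner_add_left)
  moreover have "continuous_on UNIV (\<lambda>x. \<phi> x *\<^sub>R grad \<psi> x + \<psi> x *\<^sub>R grad \<phi> x)"
    by (intro continuous_intros C1_continuous C1_continuous_grad assms)
  ultimately show "C1 (\<lambda>x. \<phi> x * \<psi> x)" "grad (\<lambda>x. \<phi> x * \<psi> x) = (\<lambda>x. \<phi> x *\<^sub>R grad \<psi> x + \<psi> x *\<^sub>R grad \<phi> x)"
    by (rule C1_I)+
qed

lemma C1_compose:
  assumes "\<And>t. (k has_real_derivative k' t) (at t)" "continuous_on UNIV k'" "C1 \<phi>"
  shows "C1 (\<lambda>x. k (\<phi> x))" "grad (\<lambda>x. k (\<phi> x)) = (\<lambda>x. k' (\<phi> x) *\<^sub>R grad \<phi> x)"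
proof -
  have "((\<lambda>x. k (\<phi> x)) has_derivative (\<lambda>h. (k' (\<phi> x) *\<^sub>R grad \<phi> x) \<bullet> h)) (at x)" for x
    by (rule has_derivative_eq_rhs[OF has_derivative_compose[OF C1_has_derivative[OF assms(3)]
            assms(1)[of "\<phi> x", unfolded has_field_derivative_def]]])
       (simp add: fun_eq_iff)
  moreover have "continuous_on UNIV (\<lambda>x. k' (\<phi> x) *\<^sub>R grad \<phi> x)"
    by (intro continuous_intros C1_continuous C1_continuous_grad assms continuous_on_compose2[OF assms(2)]) auto
  ultimately show "C1 (\<lambda>x. k (\<phi> x))" "grad (\<lambda>x. k (\<phi> x)) = (\<lambda>x. k' (\<phi> x) *\<^sub>R grad \<phi> x)"
    by (rule C1_I)+
qed

lemma C1_sqdist: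
  "C1 (\<lambda>x. (norm (x - c))\<^sup>2)" "grad (\<lambda>x. (norm (x - c))\<^sup>2) = (\<lambda>x. 2 *\<^sub>R (x - c))"
proof -
  have "((\<lambda>x. (norm (x - c))\<^sup>2) has_derivative (\<lambda>h. (2 *\<^sub>R (x - c)) \<bullet> h)) (at x)" for x :: "real^2"
    unfolding power2_norm_eq_inner
    by (rule derivative_eq_intros refl)+ (simp add: fun_eq_iff inner_commute)
  moreover have "continuous_on UNIV (\<lambda>x::real^2. 2 *\<^sub>R (x - c))" by (intro continuous_intros)
  ultimately show "C1 (\<lambda>x. (norm (x - c))\<^sup>2)" "grad (\<lambda>x. (norm (x - c))\<^sup>2) = (\<lambda>x. 2 *\<^sub>R (x - c))"
    by (rule C1_I)+
qed

lemma C1_coordinate: "C1 (\<lambda>x. x $ i)"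
proof -
  have "((\<lambda>x. x $ i) has_derivative (\<lambda>h. axis i 1 \<bullet> h)) (at x)" for x :: "real^2"
    by (simp add: inner_axis' bounded_linear_imp_has_derivative bounded_linear_vec_nth)
  then show ?thesis by (rule C1_I) (rule continuous_on_const)
qed

section \<open>Smooth cutoffs of a disc\<close>

text \<open>The squared positive part is the simplest \<open>C\<^sup>1\<close> function that vanishes on a half line; all cutoffs
and bumps below are built from it.\<close>

lemma DERIV_pos_part_squared:
  "((\<lambda>x::real. (max 0 x)\<^sup>2) has_real_derivative 2 * max 0 t) (at t)"
proof (cases "t = 0")
  case True
  have "((\<lambda>h::real. (max 0 h)\<^sup>2 / h) \<longlongrightarrow> 0) (at 0)"
  proof (rule Lim_null_comparison)
    show "\<forall>\<^sub>F h in at 0. norm ((max 0 h)\<^sup>2 / h) \<le> \<bar>h\<bar>"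
      by (rule always_eventually) (auto simp: max_def power2_eq_square)
    show "((\<lambda>h::real. \<bar>h\<bar>) \<longlongrightarrow> 0) (at 0)"
      using tendsto_rabs[OF tendsto_ident_at[of "0::real" UNIV]] by simp
  qed
  then show ?thesis using True by (simp add: DERIV_def)
next
  case False
  show ?thesis
  proof (cases "t > 0")
    case True
    have "((\<lambda>x::real. x\<^sup>2) has_real_derivative 2 * max 0 t) (at t)"
      using True by (auto intro!: derivative_eq_intros)
    then show ?thesis
      by (rule has_field_derivative_transform_within_open[where S="{0<..}"]) (use True in auto)
  next
    case neg: False
    have "((\<lambda>x::real. 0) has_real_derivative 2 * max 0 t) (at t)"
      using neg by simp
    then show ?thesis
      by (rule has_field_derivative_transform_within_open[where S="{..<0}"]) (use neg False in auto)
  qed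
qed

text \<open>The quadratic spline that rises from \<open>0\<close> at \<open>0\<close> to \<open>1\<close> at \<open>1\<close>, with its knot at \<open>1/2\<close>.\<close>

definition smooth_step :: "real \<Rightarrow> real" where
  "smooth_step s = 2 * (max 0 s)\<^sup>2 - 4 * (max 0 (s - 1/2))\<^sup>2 + 2 * (max 0 (s - 1))\<^sup>2"

definition smooth_step_deriv :: "real \<Rightarrow> real" where
  "smooth_step_deriv s = 4 * max 0 s - 8 * max 0 (s - 1/2) + 4 * max 0 (s - 1)"

lemma DERIV_smooth_step: "(smooth_step has_real_derivative smooth_step_deriv t) (at t)"
proof -
  have sh: "((\<lambda>x::real. (max 0 (x - a))\<^sup>2) has_real_derivative 2 * max 0 (t - a)) (at t)" for a
    using DERIV_shift[of "\<lambda>x. (max 0 x)\<^sup>2" "2 * max 0 (t - a)" t "- a"] DERIV_pos_part_squared[of "t - a"]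
    by simp
  have "((\<lambda>s. 2 * (max 0 s)\<^sup>2 - 4 * (max 0 (s - 1/2))\<^sup>2 + 2 * (max 0 (s - 1))\<^sup>2) has_real_derivative
       2 * (2 * max 0 t) - 4 * (2 * max 0 (t - 1/2)) + 2 * (2 * max 0 (t - 1))) (at t)"
    by (intro DERIV_add DERIV_diff DERIV_cmult sh DERIV_pos_part_squared)
  then show ?thesis by (simp add: smooth_step_def[abs_def] smooth_step_deriv_def)
qed

lemma continuous_smooth_step_deriv: "continuous_on S smooth_step_deriv"
  unfolding smooth_step_deriv_def[abs_def] by (intro continuous_intros)

lemma smooth_step_nonpos: "s \<le> 0 \<Longrightarrow> smooth_step s = 0"
  by (simp add: smooth_step_def)

lemma smooth_step_ge_1: "1 \<le> s \<Longrightarrow> smooth_step s = 1"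
  by (simp add: smooth_step_def power2_eq_square algebra_simps)

lemma smooth_step_deriv_nonneg: "0 \<le> smooth_step_deriv s"
  by (auto simp: smooth_step_deriv_def max_def)

lemma smooth_step_deriv_outside: "s \<le> 0 \<or> 1 \<le> s \<Longrightarrow> smooth_step_deriv s = 0"
  by (auto simp: smooth_step_deriv_def max_def)

lemma smooth_step_mono: "s \<le> t \<Longrightarrow> smooth_step s \<le> smooth_step t"
  by (rule DERIV_nonneg_imp_nondecreasing) (use DERIV_smooth_step smooth_step_deriv_nonneg in blast)+

lemma smooth_step_bounds: "0 \<le> smooth_step s" "smooth_step s \<le> 1"
  using smooth_step_mono[of "min s 0" s] smooth_step_mono[of s "max s 1"]
  by (simp_all add: smooth_step_nonpos smooth_step_ge_1)

lemma smooth_step_scaled_tendsto: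
  "(\<lambda>n. smooth_step (real n * s)) \<longlonglongrightarrow> (if 0 < s then 1 else 0)"
proof (cases "0 < s")
  case True
  then obtain N :: nat where N: "1 < real N * s" using reals_Archimedean3 by blast
  have "smooth_step (real n * s) = 1" if "N \<le> n" for n
  proof -
    have "real N * s \<le> real n * s" using that True by (intro mult_right_mono) auto
    then show ?thesis using N by (intro smooth_step_ge_1) linarith
  qed
  then have "\<forall>\<^sub>F n in sequentially. smooth_step (real n * s) = 1"
    unfolding eventually_sequentially by blast
  then show ?thesis using True by (simp add: tendsto_eventually)
next
  case False
  then have "smooth_step (real n * s) = 0" for n
    by (intro smooth_step_nonpos) (simp add: mult_nonneg_nonpos)
  then show ?thesis using False by simp
qed

text \<open>The argument is the squared norm, so that there is no singularity at the centre.\<close>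

definition ball_cutoff :: "real^2 \<Rightarrow> real \<Rightarrow> nat \<Rightarrow> real^2 \<Rightarrow> real" where
  "ball_cutoff c r n x = smooth_step (real n * (r\<^sup>2 - (norm (x - c))\<^sup>2))"

text \<open>The gradient of the cutoff is \<open>- boundary_layer \<cdot> (x - c)\<close>.  The layer concentrates on the circle as
\<open>n\<close> grows, and it plays the role of the arc length measure.\<close>

definition boundary_layer :: "real^2 \<Rightarrow> real \<Rightarrow> nat \<Rightarrow> real^2 \<Rightarrow> real" where
  "boundary_layer c r n x = 2 * real n * smooth_step_deriv (real n * (r\<^sup>2 - (norm (x - c))\<^sup>2))"

lemma C1_ball_cutoff:
  "C1 (ball_cutoff c r n)" "grad (ball_cutoff c r n) = (\<lambda>x. - boundary_layer c r n x *\<^sub>R (x - c))"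
proof -
  have d: "((\<lambda>t. smooth_step (real n * (r\<^sup>2 - t))) has_real_derivative
       - real n * smooth_step_deriv (real n * (r\<^sup>2 - t))) (at t)" for t
    by (rule DERIV_cong[OF DERIV_chain2[OF DERIV_smooth_step]]) (auto intro!: derivative_eq_intros)
  have c: "continuous_on UNIV (\<lambda>t. - real n * smooth_step_deriv (real n * (r\<^sup>2 - t)))"
    by (intro continuous_intros continuous_on_compose2[OF continuous_smooth_step_deriv[of UNIV]]) auto
  show "C1 (ball_cutoff c r n)"
    unfolding ball_cutoff_def[abs_def] by (rule C1_compose(1)[OF d c C1_sqdist(1)])
  show "grad (ball_cutoff c r n) = (\<lambda>x. - boundary_layer c r n x *\<^sub>R (x - c))"
    unfolding ball_cutoff_def[abs_def] C1_compose(2)[OF d c C1_sqdist(1)] C1_sqdist(2)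
    by (simp add: boundary_layer_def fun_eq_iff mult_ac)
qed

lemma ball_cutoff_bounds: "0 \<le> ball_cutoff c r n x" "ball_cutoff c r n x \<le> 1"
  by (simp_all add: ball_cutoff_def smooth_step_bounds)

lemma ball_cutoff_outside:
  assumes "0 < r" "x \<notin> ball c r" shows "ball_cutoff c r n x = 0"
proof -
  have "r\<^sup>2 \<le> (norm (x - c))\<^sup>2"
    using assms by (intro power_mono) (auto simp: dist_norm norm_minus_commute)
  then show ?thesis unfolding ball_cutoff_def
    by (intro smooth_step_nonpos) (simp add: mult_nonneg_nonpos)
qed

lemma ball_cutoff_tendsto:
  assumes "0 < r" shows "(\<lambda>n. ball_cutoff c r n x) \<longlonglongrightarrow> indicator (ball c r) x"
proof -
  have "0 < r\<^sup>2 - (norm (x - c))\<^sup>2 \<longleftrightarrow> x \<in> ball c r"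
    using assms power2_less_imp_less[of "norm (x - c)" r] power_strict_mono[of "norm (x - c)" r 2]
    by (auto simp: dist_norm norm_minus_commute)
  then show ?thesis
    using smooth_step_scaled_tendsto[of "r\<^sup>2 - (norm (x - c))\<^sup>2"]
    by (cases "x \<in> ball c r") (simp_all add: ball_cutoff_def)
qed

lemma boundary_layer_nonneg: "0 \<le> boundary_layer c r n x"
  by (simp add: boundary_layer_def smooth_step_deriv_nonneg)

lemma continuous_boundary_layer: "continuous_on S (boundary_layer c r n)"
  unfolding boundary_layer_def[abs_def]
  by (intro continuous_intros continuous_on_compose2[OF continuous_smooth_step_deriv[of UNIV]]) auto

text \<open>The lower bound on the norm is the reason for using a spline that is constant beyond \<open>1\<close>.\<close>

lemma boundary_layer_support:
  assumes "boundary_layer c r n x \<noteq> 0" "0 < r"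
  shows "0 < n" "(norm (x - c))\<^sup>2 < r\<^sup>2" "r\<^sup>2 - 1 / real n < (norm (x - c))\<^sup>2" "x \<in> ball c r"
proof -
  let ?t = "r\<^sup>2 - (norm (x - c))\<^sup>2"
  show n: "0 < n" using assms by (auto simp: boundary_layer_def)
  have "\<not> (real n * ?t \<le> 0 \<or> 1 \<le> real n * ?t)"
    using assms smooth_step_deriv_outside[of "real n * ?t"] by (auto simp: boundary_layer_def)
  then have t: "0 < real n * ?t" "real n * ?t < 1" by auto
  show 1: "(norm (x - c))\<^sup>2 < r\<^sup>2" using t(1) n by (simp add: zero_less_mult_iff)
  show "r\<^sup>2 - 1 / real n < (norm (x - c))\<^sup>2" using t(2) n by (simp add: field_simps)
  show "x \<in> ball c r" using 1 assms(2)
    by (simp add: dist_norm norm_minus_commute power2_less_imp_less)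
qed

section \<open>Integration over bounded sets\<close>

lemma measurable_on_subset:
  "f \<in> borel_measurable (lebesgue_on T) \<Longrightarrow> S \<subseteq> T \<Longrightarrow> f \<in> borel_measurable (lebesgue_on S)"
  by (rule measurable_restrict_mono)

lemma integrable_on_subset:
  fixes f :: "real^2 \<Rightarrow> 'b::euclidean_space"
  assumes "integrable (lebesgue_on T) f" "S \<subseteq> T" "S \<in> sets lebesgue" "T \<in> sets lebesgue"
  shows "integrable (lebesgue_on S) f"
  using assms set_integrable_subset[of lebesgue T f S]
  by (simp add: integrable_restrict_space set_integrable_def)

lemma integral_on_subset:
  fixes f :: "real^2 \<Rightarrow> 'b::euclidean_space"
  assumes "S \<subseteq> T" "S \<in> sets lebesgue" "T \<in> sets lebesgue" "\<And>x. x \<in> T - S \<Longrightarrow> f x = 0"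
  shows "integral\<^sup>L (lebesgue_on T) f = integral\<^sup>L (lebesgue_on S) f"
  using assms
  by (auto simp: integral_restrict_space indicator_def intro!: Bochner_Integration.integral_cong)

lemma AE_on_subset:
  assumes "AE x in lebesgue_on T. P x" "S \<subseteq> T" "S \<in> sets lebesgue" "T \<in> sets lebesgue"
  shows "AE x in lebesgue_on S. P x"
  using assms by (auto simp: AE_restrict_space_iff elim!: eventually_mono)

lemma finite_measure_on_bounded:
  fixes S :: "(real^2) set"
  assumes "bounded S" "S \<in> sets lebesgue"
  shows "finite_measure (lebesgue_on S)"
  using assms by (intro finite_measure_lebesgue_on bounded_set_imp_lmeasurable)

lemma continuous_measurable_on:
  fixes f :: "real^2 \<Rightarrow> 'b::euclidean_space"
  assumes "continuous_on UNIV f" shows "f \<in> borel_measurable (lebesgue_on S)"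
  using assms
  by (intro measurable_restrict_space1 measurable_completion) (simp add: borel_measurable_continuous_onI)

lemma continuous_bounded_on_bounded:
  fixes f :: "real^2 \<Rightarrow> 'b::euclidean_space"
  assumes "continuous_on UNIV f" "bounded S"
  obtains M where "0 < M" "\<And>x. x \<in> S \<Longrightarrow> norm (f x) \<le> M"
proof -
  have "compact (f ` closure S)"
    using assms by (intro compact_continuous_image continuous_on_subset[OF assms(1)]) auto
  then obtain M where "0 < M" "\<forall>y\<in>f ` closure S. norm y \<le> M"
    using compact_imp_bounded bounded_pos by metis
  then show ?thesis using that closure_subset[of S] by blast
qed

lemma integrable_bounded_on:
  fixes f :: "real^2 \<Rightarrow> 'b::euclidean_space"
  assumes "f \<in> borel_measurable (lebesgue_on S)" "bounded S" "S \<in> sets lebesgue"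
    and "AE x in lebesgue_on S. norm (f x) \<le> M"
  shows "integrable (lebesgue_on S) f"
proof -
  interpret finite_measure "lebesgue_on S" by (rule finite_measure_on_bounded) fact+
  show ?thesis using assms by (rule_tac integrable_const_bound)
qed

lemma integrable_continuous_on:
  fixes f :: "real^2 \<Rightarrow> 'b::euclidean_space"
  assumes "continuous_on UNIV f" "bounded S" "S \<in> sets lebesgue"
  shows "integrable (lebesgue_on S) f"
proof -
  obtain M where "\<And>x. x \<in> S \<Longrightarrow> norm (f x) \<le> M"
    using continuous_bounded_on_bounded[OF assms(1,2)] by metis
  then show ?thesis
    by (intro integrable_bounded_on[where M=M] continuous_measurable_on assms AE_I2) auto
qed

lemma integrable_mult_continuous:
  fixes f \<phi> :: "real^2 \<Rightarrow> real"
  assumes f: "integrable (lebesgue_on S) f" and \<phi>: "continuous_on UNIV \<phi>" and S: "bounded S"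
  shows "integrable (lebesgue_on S) (\<lambda>x. f x * \<phi> x)"
proof -
  obtain M where M: "0 < M" "\<And>x. x \<in> S \<Longrightarrow> norm (\<phi> x) \<le> M"
    using continuous_bounded_on_bounded[OF \<phi> S] by metis
  show ?thesis
  proof (rule Bochner_Integration.integrable_bound)
    show "integrable (lebesgue_on S) (\<lambda>x. M * f x)" using f by simp
    show "(\<lambda>x. f x * \<phi> x) \<in> borel_measurable (lebesgue_on S)"
      using f continuous_measurable_on[OF \<phi>] by auto
    show "AE x in lebesgue_on S. norm (f x * \<phi> x) \<le> norm (M * f x)"
      using M by (intro AE_I2) (simp add: abs_mult mult.commute[of M] mult_left_mono)
  qed
qed

text \<open>A violation of the bound would be an open set, and nonempty open sets are not negligible.\<close>

lemma continuous_AE_bound: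
  fixes f :: "real^2 \<Rightarrow> 'b::euclidean_space"
  assumes U: "open U" and cont: "continuous_on U f" and AE: "AE x in lebesgue_on U. norm (f x) \<le> M" and x: "x \<in> U"
  shows "norm (f x) \<le> M"
proof (rule ccontr)
  assume x_gt: "\<not> norm (f x) \<le> M"
  define V where "V = {y \<in> U. M < norm (f y)}"
  have "open V"
    using continuous_open_preimage[OF continuous_on_norm[OF cont] U open_greaterThan[of M]]
    by (simp add: V_def vimage_def Int_def)
  moreover have "x \<in> V" using x x_gt by (simp add: V_def)
  moreover have "negligible V"
  proof -
    have "AE y in lebesgue. y \<in> U \<longrightarrow> norm (f y) \<le> M"
      using AE U by (simp add: AE_restrict_space_iff)
    then have "AE y in lebesgue. y \<notin> V" by eventually_elim (auto simp: V_def)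
    then show ?thesis
      using \<open>open V\<close> by (simp add: negligible_iff_null_sets AE_iff_null_sets)
  qed
  ultimately show False using open_not_negligible by blast
qed

lemma integral_lebesgue_on_eq_lborel:
  fixes f :: "real^2 \<Rightarrow> real"
  assumes "f \<in> borel_measurable borel" "S \<in> sets borel" "\<And>x. x \<notin> S \<Longrightarrow> f x = 0"
  shows "(LINT x|lebesgue_on S. f x) = (LINT x|lborel. f x)"
proof -
  have "(\<lambda>x. indicator S x *\<^sub>R f x) = f" using assms(3) by (auto simp: indicator_def fun_eq_iff)
  moreover have "S \<inter> space lebesgue \<in> sets lebesgue" using assms(2) by simp
  ultimately have "(LINT x|lebesgue_on S. f x) = (LINT x|lebesgue. f x)"
    using integral_restrict_space[of S lebesgue f] by simp
  then show ?thesis using assms(1) by (simp add: integral_completion)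
qed

lemma integrable_bounded_support:
  fixes f :: "real^2 \<Rightarrow> real"
  assumes "f \<in> borel_measurable borel" "\<And>x. \<bar>f x\<bar> \<le> K" "\<And>x. x \<notin> ball 0 a \<Longrightarrow> f x = 0"
  shows "integrable lborel f"
  by (rule integrableI_bounded_set[where A="ball 0 a" and B=K])
     (use assms emeasure_bounded_finite[of "ball 0 a"] in auto)

section \<open>Green's formula on a disc for radial fields\<close>

text \<open>Along a ray, \<open>s (s \<partial>\<^sub>s \<phi> + 2 \<phi>)\<close> is the derivative of \<open>s\<^sup>2 \<phi>\<close>.  This is Gauss' theorem for the fields
\<open>\<phi> (x - c)\<close>, with whose flux that of general fields is compared below.\<close>

lemma green_radial:
  assumes \<phi>: "C1 \<phi>" and R: "0 < R"
  shows "(LINT x|lebesgue_on (ball c R). (x - c) \<bullet> grad \<phi> x + 2 * \<phi> x) = R * circle_integral c R \<phi>"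
proof -
  let ?f = "\<lambda>x. (x - c) \<bullet> grad \<phi> x + 2 * \<phi> x"
  have cont: "continuous_on UNIV ?f"
    by (intro continuous_intros C1_continuous C1_continuous_grad \<phi>)
  obtain M where M: "\<And>x. x \<in> ball c R \<Longrightarrow> norm (?f x) \<le> M"
    using continuous_bounded_on_bounded[OF cont bounded_ball] by metis
  have "(LINT x|lebesgue_on (ball c R). ?f x) = integral {0..2*pi} (\<lambda>\<theta>. R\<^sup>2 * \<phi> (polar c R \<theta>))"
  proof (rule integral_ball_by_rays)
    show "?f \<in> borel_measurable borel" using cont by (rule borel_measurable_continuous_onI)
    show "\<bar>?f x\<bar> \<le> M" if "x \<in> ball c R" for x using M[OF that] by simp
    fix \<theta> :: real
    let ?e = "vector [cos \<theta>, sin \<theta>] :: real^2"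
    have d: "((\<lambda>s. s\<^sup>2 * \<phi> (polar c s \<theta>)) has_vector_derivative s * ?f (polar c s \<theta>)) (at s within {0..R})" for s
    proof -
      have "((\<lambda>s. polar c s \<theta>) has_derivative (\<lambda>h. h *\<^sub>R ?e)) (at s within {0..R})"
        by (auto intro!: derivative_eq_intros)
      from has_derivative_compose[OF this C1_has_derivative[OF \<phi>]]
      have "((\<lambda>s. \<phi> (polar c s \<theta>)) has_real_derivative (grad \<phi> (polar c s \<theta>) \<bullet> ?e)) (at s within {0..R})"
        by (simp add: has_field_derivative_def mult_commute_abs)
      then have "((\<lambda>s. s\<^sup>2 * \<phi> (polar c s \<theta>)) has_real_derivative
           2 * s * \<phi> (polar c s \<theta>) + s\<^sup>2 * (grad \<phi> (polar c s \<theta>) \<bullet> ?e)) (at s within {0..R})"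
        by (auto intro!: derivative_eq_intros)
      moreover have "2 * s * \<phi> (polar c s \<theta>) + s\<^sup>2 * (grad \<phi> (polar c s \<theta>) \<bullet> ?e) = s * ?f (polar c s \<theta>)"
        by (simp add: algebra_simps power2_eq_square inner_commute)
      ultimately show ?thesis by (simp add: has_real_derivative_iff_has_vector_derivative)
    qed
    have "((\<lambda>s. s * ?f (polar c s \<theta>)) has_integral R\<^sup>2 * \<phi> (polar c R \<theta>) - 0\<^sup>2 * \<phi> (polar c 0 \<theta>)) {0..R}"
      using R d by (intro fundamental_theorem_of_calculus) auto
    then show "((\<lambda>s. s * ?f (polar c s \<theta>)) has_integral R\<^sup>2 * \<phi> (polar c R \<theta>)) {0..R}" by simp
  qed fact
  also have "\<dots> = R * circle_integral c R \<phi>"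
    by (simp add: circle_integral_def power2_eq_square mult_ac flip: integral_mult_right)
  finally show ?thesis .
qed

definition layer_integral :: "real^2 \<Rightarrow> real \<Rightarrow> nat \<Rightarrow> (real^2 \<Rightarrow> real) \<Rightarrow> real" where
  "layer_integral c r n f = (LINT x|lebesgue_on (ball c r). boundary_layer c r n x * f x)"

lemma cutoff_dominated_convergence:
  assumes f: "integrable (lebesgue_on (ball c r)) f" and r: "0 < r"
  shows "(\<lambda>n. LINT x|lebesgue_on (ball c r). ball_cutoff c r n x * f x)
     \<longlonglongrightarrow> (LINT x|lebesgue_on (ball c r). f x)"
proof (rule integral_dominated_convergence[where w="\<lambda>x. norm (f x)"])
  show "f \<in> borel_measurable (lebesgue_on (ball c r))" using f by simp
  then show "(\<lambda>x. ball_cutoff c r n x * f x) \<in> borel_measurable (lebesgue_on (ball c r))" for n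
    using continuous_measurable_on[OF C1_continuous[OF C1_ball_cutoff(1)]] by measurable
  show "integrable (lebesgue_on (ball c r)) (\<lambda>x. norm (f x))" using f by simp
  show "AE x in lebesgue_on (ball c r). (\<lambda>n. ball_cutoff c r n x * f x) \<longlonglongrightarrow> f x"
  proof (rule AE_I2)
    fix x assume "x \<in> space (lebesgue_on (ball c r))"
    then have "indicat_real (ball c r) x = 1" by simp
    then have "(\<lambda>n. ball_cutoff c r n x) \<longlonglongrightarrow> 1" using ball_cutoff_tendsto[OF r, of c x] by simp
    from tendsto_mult_right[OF this, of "f x"]
    show "(\<lambda>n. ball_cutoff c r n x * f x) \<longlonglongrightarrow> f x" by simp
  qed
  show "AE x in lebesgue_on (ball c r). norm (ball_cutoff c r n x * f x) \<le> norm (f x)" for n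
    by (intro AE_I2) (simp add: abs_mult ball_cutoff_bounds mult_left_le_one_le)
qed

text \<open>Green's formula for \<open>\<phi>\<close> times the cutoff, which vanishes on the circle.\<close>

lemma layer_integral_sqdist:
  assumes \<phi>: "C1 \<phi>" and r: "0 < r"
  shows "(LINT x|lebesgue_on (ball c r). ball_cutoff c r n x * ((x - c) \<bullet> grad \<phi> x + 2 * \<phi> x))
     = layer_integral c r n (\<lambda>x. (norm (x - c))\<^sup>2 * \<phi> x)"
proof -
  let ?h = "ball_cutoff c r n" and ?\<mu> = "boundary_layer c r n"
  have C: "C1 (\<lambda>x. \<phi> x * ?h x)" using \<phi> C1_ball_cutoff(1) by (rule C1_mult)
  have "circle_integral c r (\<lambda>x. \<phi> x * ?h x) = 0"
  proof -
    have "?h (polar c r \<theta>) = 0" for \<theta>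
      using r by (intro ball_cutoff_outside) (auto simp: dist_norm norm_unit_vector2)
    then show ?thesis by (simp add: circle_integral_def)
  qed
  then have "0 = (LINT x|lebesgue_on (ball c r). (x - c) \<bullet> grad (\<lambda>x. \<phi> x * ?h x) x + 2 * (\<phi> x * ?h x))"
    using green_radial[OF C r, of c] by simp
  also have "\<dots> = (LINT x|lebesgue_on (ball c r). ?h x * ((x - c) \<bullet> grad \<phi> x + 2 * \<phi> x)
       - ?\<mu> x * ((norm (x - c))\<^sup>2 * \<phi> x))"
    unfolding C1_mult(2)[OF \<phi> C1_ball_cutoff(1)] C1_ball_cutoff(2)
    by (intro Bochner_Integration.integral_cong refl)
       (simp add: inner_add_right power2_norm_eq_inner algebra_simps)
  also have "\<dots> = (LINT x|lebesgue_on (ball c r). ?h x * ((x - c) \<bullet> grad \<phi> x + 2 * \<phi> x))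
       - (LINT x|lebesgue_on (ball c r). ?\<mu> x * ((norm (x - c))\<^sup>2 * \<phi> x))"
    by (intro Bochner_Integration.integral_diff integrable_continuous_on continuous_intros
        continuous_boundary_layer C1_continuous C1_continuous_grad \<phi> C1_ball_cutoff) auto
  finally show ?thesis by (simp add: layer_integral_def)
qed

text \<open>The layer, weighted with the squared radius, converges to the arc length measure times \<open>r\<close>.\<close>

lemma layer_integral_sqdist_tendsto:
  assumes \<phi>: "C1 \<phi>" and r: "0 < r"
  shows "(\<lambda>n. layer_integral c r n (\<lambda>x. (norm (x - c))\<^sup>2 * \<phi> x)) \<longlonglongrightarrow> r * circle_integral c r \<phi>"
  unfolding layer_integral_sqdist[OF assms, symmetric] green_radial[OF assms, symmetric]
  by (intro cutoff_dominated_convergence integrable_continuous_on continuous_intros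
        C1_continuous C1_continuous_grad \<phi> r) auto

lemma circle_integral_const: "circle_integral c r (\<lambda>x. a) = 2 * pi * r * a"
  by (simp add: circle_integral_def)

text \<open>Green's formula for the constant \<open>1\<close> relates area and perimeter.\<close>

lemma measure_disc:
  fixes c :: "real^2"
  assumes "0 < r"
  shows "measure lebesgue (ball c r) = pi * r\<^sup>2"
proof -
  have "2 * measure lebesgue (ball c r) = 2 * pi * r * r"
    using green_radial[OF C1_const(1)[of 1] assms, of c]
    by (simp add: C1_const(2) circle_integral_const measure_restrict_space mult_ac)
  then show ?thesis by (simp add: power2_eq_square)
qed

section \<open>Fields of length at most one on a disc\<close>

text \<open>The situation in which the flux through the boundary circle is bounded by its length.  The representative
\<open>w\<close> of the weak divergence is arbitrary, so that the results apply to \<open>- z\<close> and \<open>- w\<close> as well.\<close>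

locale disc_field =
  fixes \<Omega> :: "(real^2) set" and z :: "real^2 \<Rightarrow> real^2" and w :: "real^2 \<Rightarrow> real"
    and c :: "real^2" and r :: real
  assumes \<Omega>: "\<Omega> \<in> sets lebesgue" and disc: "cball c r \<subseteq> \<Omega>" and r: "0 < r"
    and z_meas: "z \<in> borel_measurable (lebesgue_on \<Omega>)"
    and z_le_1: "AE x in lebesgue_on \<Omega>. norm (z x) \<le> 1"
    and w_int: "integrable (lebesgue_on \<Omega>) w"
    and weak_div_w: "has_weak_divergence \<Omega> z w"
begin

abbreviation "B \<equiv> ball c r"

lemma B_subset: "B \<subseteq> \<Omega>" using disc ball_subset_cball by blast

lemma z_meas_B: "z \<in> borel_measurable (lebesgue_on B)"
  using z_meas B_subset by (rule measurable_on_subset)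

lemma z_le_1_B: "AE x in lebesgue_on B. norm (z x) \<le> 1"
  using AE_on_subset[OF z_le_1 B_subset] \<Omega> by simp

lemma w_int_B: "integrable (lebesgue_on B) w"
  using w_int B_subset \<Omega> by (intro integrable_on_subset[OF w_int]) auto

lemma integrable_inner_B:
  assumes V: "continuous_on UNIV V"
  shows "integrable (lebesgue_on B) (\<lambda>x. z x \<bullet> V x)"
proof -
  obtain M where M: "\<And>x. x \<in> B \<Longrightarrow> norm (V x) \<le> M"
    using continuous_bounded_on_bounded[OF V bounded_ball] by metis
  show ?thesis
  proof (rule integrable_bounded_on)
    show "(\<lambda>x. z x \<bullet> V x) \<in> borel_measurable (lebesgue_on B)"
      using z_meas_B continuous_measurable_on[OF V] by (rule borel_measurable_inner)
    show "AE x in lebesgue_on B. norm (z x \<bullet> V x) \<le> M"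
      using z_le_1_B AE_space
    proof eventually_elim
      case (elim x)
      have "\<bar>z x \<bullet> V x\<bar> \<le> norm (z x) * norm (V x)" by (rule Cauchy_Schwarz_ineq2)
      also have "\<dots> \<le> 1 * M" using elim M[of x] by (intro mult_mono) auto
      finally show ?case by simp
    qed
  qed auto
qed

text \<open>The weak divergence tested with \<open>\<phi>\<close> times the cutoff: the boundary layer sees the radial component
of the field.\<close>

lemma flux_cutoff:
  assumes \<phi>: "C1 \<phi>"
  shows "layer_integral c r n (\<lambda>x. \<phi> x * (z x \<bullet> (x - c)))
    = (LINT x|lebesgue_on B. ball_cutoff c r n x * (w x * \<phi> x + z x \<bullet> grad \<phi> x))"
proof -
  let ?h = "ball_cutoff c r n" and ?\<mu> = "boundary_layer c r n"
  let ?\<psi> = "\<lambda>x. \<phi> x * ?h x"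
  have supp: "{x. ?\<psi> x \<noteq> 0} \<subseteq> B"
    using ball_cutoff_outside[OF r, of _ c n] by force
  have "closure {x. ?\<psi> x \<noteq> 0} \<subseteq> cball c r" using closure_mono[OF supp] r by simp
  then have "?\<psi> \<in> test_functions \<Omega>"
    using C1_mult(1)[OF \<phi> C1_ball_cutoff(1)] disc bounded_subset[OF bounded_ball supp]
    by (auto simp: test_functions_def compactly_supported_in_def)
  with weak_div_w have "(LINT x|lebesgue_on \<Omega>. z x \<bullet> grad ?\<psi> x) = - (LINT x|lebesgue_on \<Omega>. w x * ?\<psi> x)"
    by (simp add: has_weak_divergence_def)
  moreover have "(LINT x|lebesgue_on \<Omega>. w x * ?\<psi> x) = (LINT x|lebesgue_on B. w x * ?\<psi> x)"
    using B_subset \<Omega> supp by (intro integral_on_subset) auto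
  moreover have g: "grad ?\<psi> = (\<lambda>x. - (\<phi> x * ?\<mu> x) *\<^sub>R (x - c) + ?h x *\<^sub>R grad \<phi> x)"
    unfolding C1_mult(2)[OF \<phi> C1_ball_cutoff(1)] C1_ball_cutoff(2) by simp
  moreover have "(LINT x|lebesgue_on \<Omega>. z x \<bullet> grad ?\<psi> x) = (LINT x|lebesgue_on B. z x \<bullet> grad ?\<psi> x)"
  proof (rule integral_on_subset[OF B_subset _ \<Omega>])
    fix x assume "x \<in> \<Omega> - B"
    then have "?h x = 0" "?\<mu> x = 0"
      using ball_cutoff_outside[OF r] boundary_layer_support(4)[OF _ r] by blast+
    then show "z x \<bullet> grad ?\<psi> x = 0" by (simp add: g)
  qed simp
  moreover have "(LINT x|lebesgue_on B. z x \<bullet> grad ?\<psi> x) =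
     (LINT x|lebesgue_on B. z x \<bullet> (?h x *\<^sub>R grad \<phi> x)) - layer_integral c r n (\<lambda>x. \<phi> x * (z x \<bullet> (x - c)))"
  proof -
    have "(LINT x|lebesgue_on B. z x \<bullet> grad ?\<psi> x) =
     (LINT x|lebesgue_on B. z x \<bullet> (?h x *\<^sub>R grad \<phi> x) - z x \<bullet> ((\<phi> x * ?\<mu> x) *\<^sub>R (x - c)))"
      unfolding g by (simp add: inner_diff_right)
    also have "\<dots> = (LINT x|lebesgue_on B. z x \<bullet> (?h x *\<^sub>R grad \<phi> x)) -
        (LINT x|lebesgue_on B. z x \<bullet> ((\<phi> x * ?\<mu> x) *\<^sub>R (x - c)))"
      by (intro Bochner_Integration.integral_diff integrable_inner_B continuous_intros
          continuous_boundary_layer C1_continuous C1_continuous_grad \<phi> C1_ball_cutoff)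
    finally show ?thesis by (simp add: layer_integral_def mult_ac)
  qed
  moreover have "(LINT x|lebesgue_on B. w x * ?\<psi> x) + (LINT x|lebesgue_on B. z x \<bullet> (?h x *\<^sub>R grad \<phi> x))
    = (LINT x|lebesgue_on B. ?h x * (w x * \<phi> x + z x \<bullet> grad \<phi> x))"
  proof -
    have "integrable (lebesgue_on B) (\<lambda>x. w x * ?\<psi> x)"
      by (intro integrable_mult_continuous w_int_B bounded_ball continuous_intros C1_continuous \<phi> C1_ball_cutoff)
    moreover have "integrable (lebesgue_on B) (\<lambda>x. z x \<bullet> (?h x *\<^sub>R grad \<phi> x))"
      by (intro integrable_inner_B continuous_intros C1_continuous C1_continuous_grad \<phi> C1_ball_cutoff)
    ultimately have "(LINT x|lebesgue_on B. w x * ?\<psi> x) + (LINT x|lebesgue_on B. z x \<bullet> (?h x *\<^sub>R grad \<phi> x))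
      = (LINT x|lebesgue_on B. w x * ?\<psi> x + z x \<bullet> (?h x *\<^sub>R grad \<phi> x))"
      by (rule Bochner_Integration.integral_add[symmetric])
    then show ?thesis by (simp add: algebra_simps)
  qed
  ultimately show ?thesis by linarith
qed

lemma flux_tendsto:
  assumes \<phi>: "C1 \<phi>"
  shows "(\<lambda>n. layer_integral c r n (\<lambda>x. \<phi> x * (z x \<bullet> (x - c))))
    \<longlonglongrightarrow> (LINT x|lebesgue_on B. w x * \<phi> x + z x \<bullet> grad \<phi> x)"
  unfolding flux_cutoff[OF \<phi>]
  by (intro cutoff_dominated_convergence r Bochner_Integration.integrable_add integrable_inner_B
      integrable_mult_continuous w_int_B C1_continuous C1_continuous_grad \<phi>) auto

text \<open>The inner radius of the layer of index \<open>n\<close>, once \<open>n\<close> is so large that the radicand is positive.\<close>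

definition inner_radius :: "nat \<Rightarrow> real" where
  "inner_radius n = sqrt (r\<^sup>2 - 1 / real n)"

lemma inner_radius_tendsto: "inner_radius \<longlonglongrightarrow> r"
proof -
  have "(\<lambda>n. sqrt (r\<^sup>2 - 1 / real n)) \<longlonglongrightarrow> sqrt (r\<^sup>2 - 0)"
    by (intro tendsto_intros lim_1_over_n)
  then show ?thesis using r by (simp add: inner_radius_def[abs_def])
qed

lemma inner_radius_pos: "\<forall>\<^sub>F n in sequentially. 0 < inner_radius n"
  using order_tendstoD(1)[OF inner_radius_tendsto r] .

text \<open>Up to the factor \<open>r\<close>, a version of \<open>1 + z \<cdot> \<nu>\<close> that is nonnegative on the layer and whose first summand is
a multiple of \<open>\<bar>x - c\<bar>\<^sup>2\<close>.  For this power of the distance the limit of the layer integrals is known;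
the inner radius in the denominator makes the summand dominate \<open>\<bar>x - c\<bar>\<close>.\<close>

definition excess :: "nat \<Rightarrow> real^2 \<Rightarrow> real" where
  "excess n x = (norm (x - c))\<^sup>2 / inner_radius n + z x \<bullet> (x - c)"

lemma norm_le_in_layer:
  assumes "boundary_layer c r n x \<noteq> 0" "0 < inner_radius n"
  shows "norm (x - c) \<le> (norm (x - c))\<^sup>2 / inner_radius n"
proof -
  have "inner_radius n \<le> norm (x - c)"
    using boundary_layer_support(3)[OF assms(1) r] unfolding inner_radius_def
    by (intro real_le_lsqrt) auto
  then have "inner_radius n * norm (x - c) \<le> norm (x - c) * norm (x - c)" by (intro mult_right_mono) auto
  then show ?thesis using assms(2) by (simp add: field_simps power2_eq_square)
qed

lemma excess_nonneg:
  assumes "norm (z x) \<le> 1" "0 < inner_radius n"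
  shows "0 \<le> boundary_layer c r n x * excess n x"
proof (cases "boundary_layer c r n x = 0")
  case False
  have "\<bar>z x \<bullet> (x - c)\<bar> \<le> norm (z x) * norm (x - c)" by (rule Cauchy_Schwarz_ineq2)
  also have "\<dots> \<le> norm (x - c)" using assms by (simp add: mult_left_le_one_le)
  also have "\<dots> \<le> (norm (x - c))\<^sup>2 / inner_radius n" using norm_le_in_layer[OF False assms(2)] .
  finally show ?thesis by (simp add: excess_def boundary_layer_nonneg)
qed simp

lemma integrable_excess:
  assumes "continuous_on UNIV \<phi>"
  shows "integrable (lebesgue_on B) (\<lambda>x. boundary_layer c r n x * (\<phi> x * excess n x))"
proof -
  have "integrable (lebesgue_on B) (\<lambda>x. z x \<bullet> ((boundary_layer c r n x * \<phi> x) *\<^sub>R (x - c)))"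
    by (intro integrable_inner_B continuous_intros continuous_boundary_layer assms)
  moreover have "integrable (lebesgue_on B) (\<lambda>x. boundary_layer c r n x * \<phi> x * ((norm (x - c))\<^sup>2 * (1 / inner_radius n)))"
    by (intro integrable_continuous_on continuous_intros continuous_boundary_layer assms) auto
  ultimately have "integrable (lebesgue_on B) (\<lambda>x. z x \<bullet> ((boundary_layer c r n x * \<phi> x) *\<^sub>R (x - c)) +
     boundary_layer c r n x * \<phi> x * ((norm (x - c))\<^sup>2 * (1 / inner_radius n)))"
    by (rule Bochner_Integration.integrable_add)
  then show ?thesis by (rule Bochner_Integration.integrable_cong[THEN iffD1, rotated -1]) (simp_all add: excess_def algebra_simps)
qed

text \<open>The first summand contributes the circle integral, the second one the flux of \<open>z\<close>.\<close>

lemma excess_tendsto: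
  assumes \<phi>: "C1 \<phi>"
  shows "(\<lambda>n. layer_integral c r n (\<lambda>x. \<phi> x * excess n x))
    \<longlonglongrightarrow> circle_integral c r \<phi> + (LINT x|lebesgue_on B. w x * \<phi> x + z x \<bullet> grad \<phi> x)"
proof -
  have eq: "layer_integral c r n (\<lambda>x. \<phi> x * excess n x) =
     layer_integral c r n (\<lambda>x. (norm (x - c))\<^sup>2 * \<phi> x) / inner_radius n
     + layer_integral c r n (\<lambda>x. \<phi> x * (z x \<bullet> (x - c)))" for n
  proof -
    have 1: "integrable (lebesgue_on B) (\<lambda>x. z x \<bullet> ((boundary_layer c r n x * \<phi> x) *\<^sub>R (x - c)))"
      by (intro integrable_inner_B continuous_intros continuous_boundary_layer C1_continuous \<phi>)
    have 2: "integrable (lebesgue_on B) (\<lambda>x. boundary_layer c r n x * ((norm (x - c))\<^sup>2 * \<phi> x) * (1 / inner_radius n))"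
      by (intro integrable_continuous_on continuous_intros continuous_boundary_layer C1_continuous \<phi>) auto
    have "layer_integral c r n (\<lambda>x. \<phi> x * excess n x) =
      (LINT x|lebesgue_on B. boundary_layer c r n x * ((norm (x - c))\<^sup>2 * \<phi> x) * (1 / inner_radius n)
         + z x \<bullet> ((boundary_layer c r n x * \<phi> x) *\<^sub>R (x - c)))"
      unfolding layer_integral_def
      by (intro Bochner_Integration.integral_cong refl) (simp add: excess_def algebra_simps)
    also have "\<dots> = (LINT x|lebesgue_on B. boundary_layer c r n x * ((norm (x - c))\<^sup>2 * \<phi> x) * (1 / inner_radius n))
         + (LINT x|lebesgue_on B. z x \<bullet> ((boundary_layer c r n x * \<phi> x) *\<^sub>R (x - c)))"
      using 2 1 by (rule Bochner_Integration.integral_add)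
    finally show ?thesis by (simp add: layer_integral_def mult.assoc)
  qed
  have "(\<lambda>n. layer_integral c r n (\<lambda>x. (norm (x - c))\<^sup>2 * \<phi> x) / inner_radius n
     + layer_integral c r n (\<lambda>x. \<phi> x * (z x \<bullet> (x - c))))
    \<longlonglongrightarrow> r * circle_integral c r \<phi> / r + (LINT x|lebesgue_on B. w x * \<phi> x + z x \<bullet> grad \<phi> x)"
    using r by (intro tendsto_add tendsto_divide layer_integral_sqdist_tendsto flux_tendsto \<phi>
        inner_radius_tendsto) auto
  then show ?thesis using r by (simp add: eq)
qed

lemma excess_total_tendsto:
  "(\<lambda>n. layer_integral c r n (\<lambda>x. excess n x)) \<longlonglongrightarrow> 2 * pi * r + (LINT x|lebesgue_on B. w x)"
  using excess_tendsto[OF C1_const(1)[of 1]] by (simp add: C1_const(2) circle_integral_const)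

text \<open>The total excess is nonnegative, so its limit is nonnegative as well: no field of length at most one
takes more than the perimeter into a disc.\<close>

lemma integral_div_ge: "- (2 * pi * r) \<le> (LINT x|lebesgue_on B. w x)"
proof -
  have "\<forall>\<^sub>F n in sequentially. 0 \<le> layer_integral c r n (\<lambda>x. excess n x)"
    using inner_radius_pos
  proof eventually_elim
    case (elim n)
    show ?case unfolding layer_integral_def
      by (rule integral_nonneg_AE) (use z_le_1_B excess_nonneg[OF _ elim] in \<open>auto elim: eventually_mono\<close>)
  qed
  then have "0 \<le> 2 * pi * r + (LINT x|lebesgue_on B. w x)"
    by (intro tendsto_lowerbound[OF excess_total_tendsto]) auto
  then show ?thesis by simp
qed

end

text \<open>Equality in the preceding bound: the inward flux is as large as the perimeter.\<close>

locale extremal_disc_field = disc_field +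
  assumes extremal: "(LINT x|lebesgue_on (ball c r). w x) = - (2 * pi * r)"
begin

text \<open>For an extremal field the total excess tends to \<open>0\<close>; being nonnegative, it dominates the
excess weighted with a bounded function.\<close>

lemma excess_tendsto_0:
  assumes \<phi>: "continuous_on UNIV \<phi>"
  shows "(\<lambda>n. layer_integral c r n (\<lambda>x. \<phi> x * excess n x)) \<longlonglongrightarrow> 0"
proof -
  obtain M where M: "0 < M" "\<And>x. x \<in> B \<Longrightarrow> norm (\<phi> x) \<le> M"
    using continuous_bounded_on_bounded[OF \<phi> bounded_ball] by metis
  have "(\<lambda>n. layer_integral c r n (\<lambda>x. excess n x)) \<longlonglongrightarrow> 0"
    using excess_total_tendsto extremal by simp
  then have "(\<lambda>n. M * layer_integral c r n (\<lambda>x. excess n x)) \<longlonglongrightarrow> 0"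
    by (rule tendsto_mult_right_zero)
  moreover have "\<forall>\<^sub>F n in sequentially. norm (layer_integral c r n (\<lambda>x. \<phi> x * excess n x))
      \<le> M * layer_integral c r n (\<lambda>x. excess n x)"
    using inner_radius_pos
  proof eventually_elim
    case (elim n)
    have "norm (LINT x|lebesgue_on B. boundary_layer c r n x * (\<phi> x * excess n x))
      \<le> (LINT x|lebesgue_on B. norm (boundary_layer c r n x * (\<phi> x * excess n x)))"
      by (rule integral_norm_bound)
    also have "\<dots> \<le> (LINT x|lebesgue_on B. M * (boundary_layer c r n x * (1 * excess n x)))"
    proof (rule integral_mono_AE)
      show "AE x in lebesgue_on B. norm (boundary_layer c r n x * (\<phi> x * excess n x))
          \<le> M * (boundary_layer c r n x * (1 * excess n x))"
        using z_le_1_B AE_space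
      proof eventually_elim
        case (elim x)
        have "norm (boundary_layer c r n x * (\<phi> x * excess n x)) = \<bar>\<phi> x\<bar> * \<bar>boundary_layer c r n x * excess n x\<bar>"
          by (simp add: abs_mult)
        also have "\<dots> \<le> M * (boundary_layer c r n x * excess n x)"
          using excess_nonneg[OF elim(1) \<open>0 < inner_radius n\<close>] M(2)[of x] elim(2)
          by (auto intro!: mult_mono)
        finally show ?case by simp
      qed
    qed (intro integrable_norm integrable_mult_right integrable_excess \<phi> continuous_on_const)+
    finally show ?case by (simp add: layer_integral_def)
  qed
  ultimately show ?thesis by (rule Lim_null_comparison[rotated])
qed

text \<open>The two limits of the weighted excess, with and without use of extremality, must agree.\<close>

lemma normal_trace:
  assumes \<phi>: "C1 \<phi>"
  shows "(LINT x|lebesgue_on B. w x * \<phi> x + z x \<bullet> grad \<phi> x) = - circle_integral c r \<phi>"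
  using LIMSEQ_unique[OF excess_tendsto[OF \<phi>] excess_tendsto_0[OF C1_continuous[OF \<phi>]]] by simp

text \<open>If \<open>z' \<cdot> \<nu> > -1\<close> at \<open>p\<close>, the excess is bounded from below by a positive constant near \<open>p\<close>, and a bump
at \<open>p\<close> detects it in the limit.  So \<open>z' \<cdot> \<nu> \<le> -1\<close>, and the only vector of length at most one with
this property is \<open>- \<nu>\<close>.\<close>

lemma trace_of_continuous_representative:
  assumes U: "open U" "U \<subseteq> \<Omega>" and cont: "continuous_on U z'"
    and AE: "AE x in lebesgue_on U. z' x = z x" and p: "p \<in> U" "p \<in> sphere c r"
  shows "z' p = - ((1 / r) *\<^sub>R (p - c))"
proof -
  have U_leb: "U \<in> sets lebesgue" using U by simp
  have "AE x in lebesgue_on U. norm (z' x) \<le> 1"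
    using AE AE_on_subset[OF z_le_1 U(2) U_leb \<Omega>] by eventually_elim simp
  then have z'_le: "norm (z' x) \<le> 1" if "x \<in> U" for x
    using continuous_AE_bound[OF U(1) cont _ that] by blast
  have np: "norm (p - c) = r" using p by (simp add: dist_norm norm_minus_commute)
  have "r + z' p \<bullet> (p - c) \<le> 0"
  proof (rule ccontr)
    assume "\<not> r + z' p \<bullet> (p - c) \<le> 0"
    \<comment> \<open>half of the value at \<open>p\<close> is still a lower bound nearby\<close>
    define \<delta> where "\<delta> = (r + z' p \<bullet> (p - c)) / 2"
    then have \<delta>: "0 < \<delta>" "\<delta> < norm (p - c) + z' p \<bullet> (p - c)"
      using \<open>\<not> _\<close> by (auto simp: np)
    have "continuous_on U (\<lambda>x. norm (x - c) + z' x \<bullet> (x - c))" by (intro continuous_intros cont)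
    then have "isCont (\<lambda>x. norm (x - c) + z' x \<bullet> (x - c)) p"
      using U(1) p(1) by (simp add: continuous_on_eq_continuous_at)
    then have "\<forall>\<^sub>F x in at p. \<delta> < norm (x - c) + z' x \<bullet> (x - c)"
      using \<delta>(2) by (auto simp: isCont_def dest: order_tendstoD(1))
    then have "\<forall>\<^sub>F x in nhds p. \<delta> < norm (x - c) + z' x \<bullet> (x - c)"
      using \<delta>(2) by (auto simp: eventually_nhds_conv_at)
    moreover have "\<forall>\<^sub>F x in nhds p. x \<in> U" using U p by (simp add: eventually_nhds_in_open)
    ultimately have "\<forall>\<^sub>F x in nhds p. x \<in> U \<and> \<delta> < norm (x - c) + z' x \<bullet> (x - c)"
      by eventually_elim simp
    then obtain \<rho> where \<rho>: "0 < \<rho>"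
      and near: "\<forall>x. dist x p < \<rho> \<longrightarrow> x \<in> U \<and> \<delta> < norm (x - c) + z' x \<bullet> (x - c)"
      unfolding eventually_nhds_metric by (elim exE conjE)
    \<comment> \<open>a \<open>C\<^sup>1\<close> bump whose support is the ball where the lower bound holds\<close>
    define \<phi> where "\<phi> = (\<lambda>x::real^2. (max 0 (\<rho>\<^sup>2 - (norm (x - p))\<^sup>2))\<^sup>2)"
    have \<phi>: "C1 \<phi>"
    proof -
      define k where "k t = (max 0 (\<rho>\<^sup>2 - t))\<^sup>2" for t :: real
      have "(k has_real_derivative (2 * max 0 (\<rho>\<^sup>2 - t)) * (- 1)) (at t)" for t
      proof -
        have "((\<lambda>t. \<rho>\<^sup>2 - t) has_real_derivative - 1) (at t)" by (auto intro!: derivative_eq_intros)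
        from DERIV_chain2[OF DERIV_pos_part_squared this] show ?thesis unfolding k_def .
      qed
      moreover have "continuous_on UNIV (\<lambda>t. (2 * max 0 (\<rho>\<^sup>2 - t)) * (- 1))" by (intro continuous_intros)
      ultimately have "C1 (\<lambda>x. k ((norm (x - p))\<^sup>2))" using C1_sqdist(1) by (rule C1_compose(1))
      then show ?thesis by (simp add: \<phi>_def k_def)
    qed
    have \<phi>_nonneg: "0 \<le> \<phi> x" for x by (simp add: \<phi>_def)
    have \<phi>_supp: "dist x p < \<rho>" if "\<phi> x \<noteq> 0" for x
    proof -
      have "(norm (x - p))\<^sup>2 < \<rho>\<^sup>2" using that by (auto simp: \<phi>_def max_def split: if_splits)
      then show ?thesis using \<rho> by (simp add: dist_norm power2_less_imp_less)
    qed
    have "\<forall>\<^sub>F n in sequentially. \<delta> / r\<^sup>2 * layer_integral c r n (\<lambda>x. (norm (x - c))\<^sup>2 * \<phi> x)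
       \<le> layer_integral c r n (\<lambda>x. \<phi> x * excess n x)"
      using inner_radius_pos
    proof eventually_elim
      case (elim n)
      have "(LINT x|lebesgue_on B. \<delta> / r\<^sup>2 * (boundary_layer c r n x * ((norm (x - c))\<^sup>2 * \<phi> x)))
         \<le> (LINT x|lebesgue_on B. boundary_layer c r n x * (\<phi> x * excess n x))"
      proof (rule integral_mono_AE)
        show "integrable (lebesgue_on B) (\<lambda>x. \<delta> / r\<^sup>2 * (boundary_layer c r n x * ((norm (x - c))\<^sup>2 * \<phi> x)))"
          by (intro integrable_continuous_on continuous_intros continuous_boundary_layer C1_continuous \<phi>) auto
        show "integrable (lebesgue_on B) (\<lambda>x. boundary_layer c r n x * (\<phi> x * excess n x))"
          by (intro integrable_excess C1_continuous \<phi>)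
        have "AE x in lebesgue_on \<Omega>. x \<in> U \<longrightarrow> z' x = z x"
          using AE U(2) U_leb \<Omega> by (auto simp: AE_restrict_space_iff elim!: eventually_mono)
        then have "AE x in lebesgue_on B. x \<in> U \<longrightarrow> z' x = z x"
          using AE_on_subset[OF _ B_subset _ \<Omega>] by simp
        then show "AE x in lebesgue_on B. \<delta> / r\<^sup>2 * (boundary_layer c r n x * ((norm (x - c))\<^sup>2 * \<phi> x))
            \<le> boundary_layer c r n x * (\<phi> x * excess n x)"
        proof eventually_elim
          case (elim x)
          show ?case
          proof (cases "boundary_layer c r n x = 0 \<or> \<phi> x = 0")
            case False
            then have x: "x \<in> U" "\<delta> < norm (x - c) + z' x \<bullet> (x - c)" using near \<phi>_supp[of x] by blast+
            have "(norm (x - c))\<^sup>2 \<le> r\<^sup>2" using boundary_layer_support(2)[of c r n x] False r by (metis less_imp_le)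
            then have "\<delta> / r\<^sup>2 * (norm (x - c))\<^sup>2 \<le> \<delta>" using \<delta> r by (simp add: field_simps)
            also have "\<delta> \<le> excess n x"
              using x elim norm_le_in_layer[of n x] False \<open>0 < inner_radius n\<close> by (simp add: excess_def)
            finally have "(boundary_layer c r n x * \<phi> x) * (\<delta> / r\<^sup>2 * (norm (x - c))\<^sup>2)
               \<le> (boundary_layer c r n x * \<phi> x) * excess n x"
              by (intro mult_left_mono mult_nonneg_nonneg boundary_layer_nonneg \<phi>_nonneg)
            then show ?thesis by (simp add: mult_ac)
          qed auto
        qed
      qed
      then show ?case by (simp add: layer_integral_def)
    qed
    then have "\<delta> / r\<^sup>2 * (r * circle_integral c r \<phi>) \<le> 0"
      by (intro tendsto_le[OF _ excess_tendsto_0[OF C1_continuous[OF \<phi>]]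
          tendsto_mult_left[OF layer_integral_sqdist_tendsto[OF \<phi> r]]]) auto
    moreover have "0 < circle_integral c r \<phi>"
    proof -
      have "((p - c)$1 / r)\<^sup>2 + ((p - c)$2 / r)\<^sup>2 = 1"
      proof -
        have "((p - c)$1)\<^sup>2 + ((p - c)$2)\<^sup>2 = r\<^sup>2"
          unfolding np[symmetric] power2_norm_eq_inner by (simp add: inner_vec_def sum_2 power2_eq_square)
        then show ?thesis using r by (simp add: power_divide flip: add_divide_distrib)
      qed
      then obtain t where t: "0 \<le> t" "t \<le> 2*pi" "(p - c)$1 / r = cos t" "(p - c)$2 / r = sin t"
        using sincos_total_2pi_le by metis
      have "p = polar c r t"
      proof -
        have "r * cos t = p$1 - c$1" "r * sin t = p$2 - c$2" using t(3,4) r by (simp_all add: field_simps)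
        then show ?thesis by (simp add: vec_eq_iff forall_2)
      qed
      then have ne: "\<phi> (polar c r t) * r \<noteq> 0" using r \<rho> by (simp add: \<phi>_def)
      let ?F = "\<lambda>\<theta>. \<phi> (polar c r \<theta>) * r"
      have cont: "continuous_on {0..2*pi} ?F"
      proof -
        have "continuous_on {0..2*pi} (\<lambda>\<theta>. polar c r \<theta>)"
          unfolding vector2_eq by (intro continuous_intros)
        from continuous_on_compose2[OF C1_continuous[OF \<phi>, of UNIV] this]
        have "continuous_on {0..2*pi} (\<lambda>\<theta>. \<phi> (polar c r \<theta>))" by simp
        then show ?thesis by (intro continuous_on_mult continuous_on_const)
      qed
      have nonneg: "0 \<le> ?F \<theta>" for \<theta> using \<phi>_nonneg r by simp
      have "0 \<le> circle_integral c r \<phi>"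
        unfolding circle_integral_def by (rule integral_nonneg[OF integrable_continuous_real[OF cont] nonneg])
      moreover have "circle_integral c r \<phi> \<noteq> 0"
        unfolding circle_integral_def using integral_eq_0_iff[OF cont _ nonneg] t(1,2) ne by auto
      ultimately show ?thesis by simp
    qed
    ultimately show False using \<delta>(1) r
      by (smt (verit) divide_pos_pos mult_pos_pos zero_less_power)
  qed
  moreover have "(norm (z' p + (1 / r) *\<^sub>R (p - c)))\<^sup>2 = (norm (z' p))\<^sup>2 + 2 / r * (z' p \<bullet> (p - c)) + 1"
  proof -
    have "(norm (a + b))\<^sup>2 = (norm a)\<^sup>2 + 2 * (a \<bullet> b) + (norm b)\<^sup>2" for a b :: "real^2"
      by (simp add: power2_norm_eq_inner inner_add inner_commute)
    moreover have "norm ((1 / r) *\<^sub>R (p - c)) = 1" using r np by simp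
    ultimately show ?thesis by (simp only: inner_scaleR_right power_one)
  qed
  moreover have "(norm (z' p))\<^sup>2 \<le> 1" using z'_le[OF p(1)] by (simp add: power_le_one)
  moreover have "2 / r * (r + z' p \<bullet> (p - c)) = 2 + 2 / r * (z' p \<bullet> (p - c))" using r by (simp add: field_simps)
  ultimately have "(norm (z' p + (1 / r) *\<^sub>R (p - c)))\<^sup>2 \<le> 0"
    using r by (smt (verit) divide_pos_pos mult_nonneg_nonpos)
  then have "z' p + (1 / r) *\<^sub>R (p - c) = 0" by simp
  then show ?thesis by (simp add: eq_neg_iff_add_eq_0)
qed

end

section \<open>The fundamental lemma of the calculus of variations\<close>

definition box_cutoff :: "real^2 \<Rightarrow> real^2 \<Rightarrow> nat \<Rightarrow> real^2 \<Rightarrow> real" where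
  "box_cutoff a b n x =
     smooth_step (real n * (x $ 1 - a $ 1)) * smooth_step (real n * (b $ 1 - x $ 1)) *
     (smooth_step (real n * (x $ 2 - a $ 2)) * smooth_step (real n * (b $ 2 - x $ 2)))"

lemma C1_box_cutoff: "C1 (box_cutoff a b n)"
proof -
  have *: "C1 (\<lambda>x::real^2. smooth_step (p * x $ i + q))" for p q :: real and i
  proof -
    define k where "k t = smooth_step (p * t + q)" for t :: real
    have "(k has_real_derivative smooth_step_deriv (p * t + q) * p) (at t)" for t
    proof -
      have "((\<lambda>t. p * t + q) has_real_derivative p) (at t)" by (auto intro!: derivative_eq_intros)
      from DERIV_chain2[OF DERIV_smooth_step this] show ?thesis unfolding k_def .
    qed
    moreover have "continuous_on UNIV (\<lambda>t. smooth_step_deriv (p * t + q) * p)"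
      by (intro continuous_intros continuous_on_compose2[OF continuous_smooth_step_deriv[of UNIV]]) auto
    ultimately have "C1 (\<lambda>x::real^2. k (x $ i))" using C1_coordinate by (rule C1_compose(1))
    then show ?thesis by (simp add: k_def)
  qed
  have "box_cutoff a b n = (\<lambda>x.
     smooth_step (real n * x $ 1 + (- real n * a $ 1)) * smooth_step (- real n * x $ 1 + real n * b $ 1) *
     (smooth_step (real n * x $ 2 + (- real n * a $ 2)) * smooth_step (- real n * x $ 2 + real n * b $ 2)))"
    by (simp add: box_cutoff_def fun_eq_iff right_diff_distrib)
  then show ?thesis by (simp only:) (intro C1_mult *)
qed

lemma box_cutoff_outside: "x \<notin> box a b \<Longrightarrow> box_cutoff a b n x = 0"
  by (auto simp: box_cutoff_def mem_box_cart forall_2 not_less intro!: smooth_step_nonpos mult_nonneg_nonpos)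

lemma box_cutoff_bounds: "0 \<le> box_cutoff a b n x" "box_cutoff a b n x \<le> 1"
  unfolding box_cutoff_def by (intro mult_nonneg_nonneg smooth_step_bounds mult_le_one)+

lemma box_cutoff_tendsto: "(\<lambda>n. box_cutoff a b n x) \<longlonglongrightarrow> indicator (box a b) x"
proof -
  have "(\<lambda>n. box_cutoff a b n x) \<longlonglongrightarrow>
     (if 0 < x $ 1 - a $ 1 then 1 else 0) * (if 0 < b $ 1 - x $ 1 then 1 else 0) *
     ((if 0 < x $ 2 - a $ 2 then 1 else 0) * (if 0 < b $ 2 - x $ 2 then 1 else 0))"
    unfolding box_cutoff_def by (intro tendsto_mult smooth_step_scaled_tendsto)
  also have "(if 0 < x $ 1 - a $ 1 then 1 else 0) * (if 0 < b $ 1 - x $ 1 then 1 else 0) *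
     ((if 0 < x $ 2 - a $ 2 then 1 else 0) * (if 0 < b $ 2 - x $ 2 then 1 else 0)) = indicat_real (box a b) x"
    by (auto simp: indicator_def mem_box_cart forall_2)
  finally show ?thesis .
qed

lemma integral_box_0_if_orthogonal:
  assumes "open \<Omega>" and v: "integrable (lebesgue_on \<Omega>) v"
    and orth: "\<And>\<phi>. \<phi> \<in> test_functions \<Omega> \<Longrightarrow> (LINT x|lebesgue_on \<Omega>. v x * \<phi> x) = 0"
    and ab: "cbox a b \<subseteq> \<Omega>"
  shows "(LINT x|lebesgue_on \<Omega>. v x * indicator (box a b) x) = 0"
proof -
  have "box_cutoff a b n \<in> test_functions \<Omega>" for n
  proof -
    have supp: "{x. box_cutoff a b n x \<noteq> 0} \<subseteq> box a b" using box_cutoff_outside by blast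
    have "closure {x. box_cutoff a b n x \<noteq> 0} \<subseteq> cbox a b"
      using supp box_subset_cbox closed_cbox by (meson closure_minimal subset_trans)
    then show ?thesis
      using C1_box_cutoff ab bounded_subset[OF bounded_box supp]
      by (auto simp: test_functions_def compactly_supported_in_def)
  qed
  then have "(LINT x|lebesgue_on \<Omega>. v x * box_cutoff a b n x) = 0" for n by (rule orth)
  moreover have "(\<lambda>n. LINT x|lebesgue_on \<Omega>. v x * box_cutoff a b n x)
     \<longlonglongrightarrow> (LINT x|lebesgue_on \<Omega>. v x * indicator (box a b) x)"
  proof (rule integral_dominated_convergence[where w="\<lambda>x. norm (v x)"])
    have "indicat_real (box a b) \<in> borel_measurable (lebesgue_on \<Omega>)"
      by (intro measurable_restrict_space1 measurable_completion) auto
    then show "(\<lambda>x. v x * indicat_real (box a b) x) \<in> borel_measurable (lebesgue_on \<Omega>)"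
      using v by (intro borel_measurable_times) auto
    show "(\<lambda>x. v x * box_cutoff a b n x) \<in> borel_measurable (lebesgue_on \<Omega>)" for n
      using v continuous_measurable_on[OF C1_continuous[OF C1_box_cutoff]] by (intro borel_measurable_times) auto
    show "integrable (lebesgue_on \<Omega>) (\<lambda>x. norm (v x))" using v by simp
    show "AE x in lebesgue_on \<Omega>. (\<lambda>n. v x * box_cutoff a b n x) \<longlonglongrightarrow> v x * indicator (box a b) x"
      by (intro AE_I2 tendsto_intros box_cutoff_tendsto)
    show "AE x in lebesgue_on \<Omega>. norm (v x * box_cutoff a b n x) \<le> norm (v x)" for n
      by (intro AE_I2) (simp add: abs_mult box_cutoff_bounds mult_right_le_one_le)
  qed
  ultimately show ?thesis using LIMSEQ_unique[OF _ tendsto_const] by simp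
qed

text \<open>Open boxes are stable under intersections and generate the Borel sets, so the vanishing of the
integral passes from boxes to all Borel sets.  The hypothesis on the total integral takes care of complements.\<close>

lemma AE_0_if_box_integrals_0:
  fixes f :: "real^2 \<Rightarrow> real"
  assumes f: "integrable lebesgue f" and box: "\<And>a b. (LINT x|lebesgue. indicator (box a b) x * f x) = 0"
    and total: "integral\<^sup>L lebesgue f = 0"
  shows "AE x in lebesgue. f x = 0"
proof -
  obtain f' where f'[measurable]: "f' \<in> borel_measurable lborel" and ff': "AE x in lborel. f x = f' x"
    using completion_ex_borel_measurable_real[of f lborel] f by auto
  have ff'_leb: "AE x in lebesgue. f x = f' x" using ff' by (rule AE_completion)
  have int_leb: "integrable lebesgue f'"
    using f ff'_leb f' by (subst integrable_cong_AE[symmetric]) (auto intro: measurable_completion)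
  then have int: "integrable lborel f'" using f' by (simp add: integrable_completion)
  have set_int: "set_integrable lborel A f'" if "A \<in> sets borel" for A
    using that int unfolding set_integrable_def by (intro integrable_mult_indicator) auto
  have set_eq: "(LINT x:A|lborel. f' x) = (LINT x|lebesgue. indicator A x * f x)" if "A \<in> sets borel" for A
  proof -
    have "(LINT x:A|lborel. f' x) = (LINT x|lebesgue. indicator A x * f' x)"
      using that f' by (simp add: set_lebesgue_integral_def integral_completion)
    also have "\<dots> = (LINT x|lebesgue. indicator A x * f x)"
    proof (rule integral_cong_AE)
      have "indicat_real A \<in> borel_measurable lebesgue"
        using that by (intro measurable_completion) auto
      then show "(\<lambda>x. indicat_real A x * f' x) \<in> borel_measurable lebesgue"
        "(\<lambda>x. indicat_real A x * f x) \<in> borel_measurable lebesgue"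
        using f int_leb by (auto intro!: borel_measurable_times)
      show "AE x in lebesgue. indicat_real A x * f' x = indicat_real A x * f x"
        using ff'_leb by eventually_elim simp
    qed
    finally show ?thesis .
  qed
  have zero: "(LINT x:A|lborel. f' x) = 0" if "A \<in> sets borel" for A
  proof -
    let ?G = "range (\<lambda>(a, b). box a b :: (real^2) set)"
    have borel: "sigma_sets UNIV ?G = sets (borel :: (real^2) measure)" by (simp add: borel_eq_box)
    have "Int_stable ?G" by (auto simp: Int_stable_def box_Int_box)
    moreover have "?G \<subseteq> Pow UNIV" by auto
    moreover have "A \<in> sigma_sets UNIV ?G" using that by (simp add: borel)
    ultimately show ?thesis
    proof (induction rule: sigma_sets_induct_disjoint)
      case (basic A)
      then show ?case using box by (auto simp: set_eq)
    next
      case empty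
      show ?case by (simp add: set_lebesgue_integral_def)
    next
      case (compl A)
      then have A: "A \<in> sets borel" by (simp add: borel)
      have "(LINT x:UNIV|lborel. f' x) = (LINT x:A|lborel. f' x) + (LINT x:UNIV - A|lborel. f' x)"
        using set_integral_Un[of A "UNIV - A" lborel f'] set_int[of A] set_int[of "UNIV - A"] A by auto
      moreover have "(LINT x:UNIV|lborel. f' x) = 0" using total by (simp add: set_eq)
      ultimately show ?case using compl by simp
    next
      case (union A)
      then have A: "A i \<in> sets borel" for i using borel by auto
      have "(LINT x:(\<Union>i. A i)|lborel. f' x) = (\<Sum>i. LINT x:A i|lborel. f' x)"
      proof (rule lebesgue_integral_countable_add)
        show "A i \<inter> A j = {}" if "i \<noteq> j" for i j using union(1) that by (auto simp: disjoint_family_on_def)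
        show "set_integrable lborel (\<Union>i. A i) f'" using A by (intro set_int) auto
      qed (use A in auto)
      then show ?case using union by simp
    qed
  qed
  have "AE x in lborel. f' x = 0"
    by (rule density_unique_real[OF int]) (use zero in auto)
  then have "AE x in lebesgue. f' x = 0" by (rule AE_completion)
  with ff'_leb show ?thesis by eventually_elim simp
qed

text \<open>The indicators of boxes inside \<open>\<Omega>\<close> are limits of test functions, and \<open>\<Omega>\<close> is a
countable union of closed boxes.\<close>

lemma AE_0_if_orthogonal_to_test_functions:
  assumes \<Omega>: "open \<Omega>" and v: "integrable (lebesgue_on \<Omega>) v"
    and orth: "\<And>\<phi>. \<phi> \<in> test_functions \<Omega> \<Longrightarrow> (LINT x|lebesgue_on \<Omega>. v x * \<phi> x) = 0"
  shows "AE x in lebesgue_on \<Omega>. v x = 0"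
proof -
  have box: "AE x in lebesgue. x \<in> box a b \<longrightarrow> v x = 0" if ab: "cbox a b \<subseteq> \<Omega>" for a b
  proof -
    have sub: "box a b \<subseteq> \<Omega>" using ab box_subset_cbox by blast
    let ?f = "\<lambda>x. indicator (box a b) x * v x"
    have int: "integrable lebesgue ?f"
      using integrable_on_subset[OF v sub] \<Omega> by (simp add: integrable_restrict_space)
    have "(LINT x|lebesgue. indicator (box a' b') x * ?f x) = 0" for a' b'
    proof -
      obtain a'' b'' where eq: "box a' b' \<inter> box a b = box a'' b''" and "cbox a'' b'' \<subseteq> cbox a b"
      proof (rule that)
        show "box a' b' \<inter> box a b = box (\<Sum>i\<in>Basis. max (a' \<bullet> i) (a \<bullet> i) *\<^sub>R i) (\<Sum>i\<in>Basis. min (b' \<bullet> i) (b \<bullet> i) *\<^sub>R i)"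
          by (rule box_Int_box)
      qed (auto simp: mem_box)
      then have "(LINT x|lebesgue_on \<Omega>. v x * indicator (box a'' b'') x) = 0"
        using integral_box_0_if_orthogonal[OF \<Omega> v orth] ab by blast
      moreover have "(\<lambda>x. indicator \<Omega> x *\<^sub>R (v x * indicator (box a'' b'') x)) = (\<lambda>x. indicator (box a' b') x * ?f x)"
        using sub unfolding eq[symmetric] by (auto simp: indicator_def fun_eq_iff)
      moreover have "\<Omega> \<inter> space lebesgue \<in> sets lebesgue" using \<Omega> by simp
      ultimately show ?thesis by (metis (no_types) integral_restrict_space)
    qed
    moreover have "integral\<^sup>L lebesgue ?f = 0"
    proof -
      have eq: "(\<lambda>x. indicator \<Omega> x *\<^sub>R (v x * indicator (box a b) x)) = ?f"
        using sub by (auto simp: indicator_def fun_eq_iff)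
      have "\<Omega> \<inter> space lebesgue \<in> sets lebesgue" using \<Omega> by simp
      from integral_restrict_space[OF this, of "\<lambda>x. v x * indicator (box a b) x", unfolded eq]
      show ?thesis using integral_box_0_if_orthogonal[OF \<Omega> v orth ab] by simp
    qed
    ultimately have "AE x in lebesgue. ?f x = 0" by (intro AE_0_if_box_integrals_0 int)
    then show ?thesis by eventually_elim (auto simp: indicator_def)
  qed
  obtain \<D> where \<D>: "countable \<D>" "\<D> \<subseteq> Pow \<Omega>" "\<And>X. X \<in> \<D> \<Longrightarrow> \<exists>a b. X = cbox a b" "\<Union>\<D> = \<Omega>"
    using open_countable_Union_open_cbox[OF \<Omega>] by metis
  have "AE x in lebesgue. \<forall>X\<in>\<D>. x \<in> X \<longrightarrow> v x = 0"
  proof (subst AE_ball_countable[OF \<D>(1)], rule ballI)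
    fix X assume X: "X \<in> \<D>"
    then obtain a b where ab: "X = cbox a b" using \<D>(3) by blast
    have "AE x in lebesgue. x \<notin> cbox a b - box a b"
      by (rule AE_not_in) (use negligible_frontier_interval[of a b] in \<open>simp only: negligible_iff_null_sets\<close>)
    moreover have "AE x in lebesgue. x \<in> box a b \<longrightarrow> v x = 0" using box X \<D>(2) ab by blast
    ultimately show "AE x in lebesgue. x \<in> X \<longrightarrow> v x = 0"
      by eventually_elim (auto simp: ab)
  qed
  then have "AE x in lebesgue. x \<in> \<Omega> \<longrightarrow> v x = 0" by eventually_elim (use \<D>(4) in blast)
  then show ?thesis using \<Omega> by (simp add: AE_restrict_space_iff)
qed

section \<open>Square integrable functions and uniqueness of the weak divergence\<close>

lemma L2_I_bounded:
  fixes f :: "real^2 \<Rightarrow> 'b::euclidean_space"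
  assumes "f \<in> borel_measurable (lebesgue_on \<Omega>)" "bounded \<Omega>" "\<Omega> \<in> sets lebesgue" "\<And>x. norm (f x) \<le> K"
  shows "f \<in> L2 \<Omega>"
proof -
  have "integrable (lebesgue_on \<Omega>) (\<lambda>x. (norm (f x))\<^sup>2)"
  proof (rule integrable_bounded_on)
    show "(\<lambda>x. (norm (f x))\<^sup>2) \<in> borel_measurable (lebesgue_on \<Omega>)" using assms(1) by measurable
    show "AE x in lebesgue_on \<Omega>. norm ((norm (f x))\<^sup>2) \<le> K\<^sup>2"
      using assms(4) by (intro AE_I2) (simp add: power_mono)
  qed fact+
  then show ?thesis using assms(1) by (simp add: L2_def)
qed

lemma L2_integrable_product:
  fixes f g :: "real^2 \<Rightarrow> real"
  assumes "f \<in> L2 \<Omega>" "g \<in> L2 \<Omega>"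
  shows "integrable (lebesgue_on \<Omega>) (\<lambda>x. f x * g x)"
proof (rule Bochner_Integration.integrable_bound)
  show "integrable (lebesgue_on \<Omega>) (\<lambda>x. (norm (f x))\<^sup>2 + (norm (g x))\<^sup>2)"
    using assms by (intro Bochner_Integration.integrable_add) (auto simp: L2_def)
  show "(\<lambda>x. f x * g x) \<in> borel_measurable (lebesgue_on \<Omega>)"
    using assms by (intro borel_measurable_times) (auto simp: L2_def)
  have "\<bar>a * b\<bar> \<le> a\<^sup>2 + b\<^sup>2" for a b :: real
  proof -
    have "2 * (\<bar>a\<bar> * \<bar>b\<bar>) \<le> a\<^sup>2 + b\<^sup>2" using sum_squares_bound[of "\<bar>a\<bar>" "\<bar>b\<bar>"] by simp
    moreover have "0 \<le> \<bar>a\<bar> * \<bar>b\<bar>" by simp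
    ultimately show ?thesis unfolding abs_mult by linarith
  qed
  then show "AE x in lebesgue_on \<Omega>. norm (f x * g x) \<le> norm ((norm (f x))\<^sup>2 + (norm (g x))\<^sup>2)"
    by (intro AE_I2) simp
qed

lemma L2_integrable:
  fixes f :: "real^2 \<Rightarrow> real"
  assumes "f \<in> L2 \<Omega>" "bounded \<Omega>" "\<Omega> \<in> sets lebesgue"
  shows "integrable (lebesgue_on \<Omega>) f"
  using L2_integrable_product[OF assms(1) L2_I_bounded[of "\<lambda>x. 1" \<Omega> 1]] assms by simp

lemma L2norm_square:
  fixes f :: "real^2 \<Rightarrow> real"
  shows "(L2norm \<Omega> f)\<^sup>2 = (LINT x|lebesgue_on \<Omega>. f x * f x)"
  by (simp add: L2norm_def power2_eq_square flip: power2_eq_square)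

lemma weak_div_spec:
  assumes "z \<in> W2_div \<Omega>"
  shows "weak_div \<Omega> z \<in> L2 \<Omega>" "has_weak_divergence \<Omega> z (weak_div \<Omega> z)"
  using someI_ex[of "\<lambda>w. w \<in> L2 \<Omega> \<and> has_weak_divergence \<Omega> z w"] assms
  by (auto simp: W2_div_def weak_div_def)

lemma weak_div_unique:
  assumes \<Omega>: "open \<Omega>" "bounded \<Omega>" and w: "w \<in> L2 \<Omega>" "has_weak_divergence \<Omega> z w"
    and w': "w' \<in> L2 \<Omega>" "has_weak_divergence \<Omega> z w'"
  shows "AE x in lebesgue_on \<Omega>. w x = w' x"
proof -
  have leb: "\<Omega> \<in> sets lebesgue" using \<Omega> by simp
  note int = L2_integrable[OF w(1) \<Omega>(2) leb] L2_integrable[OF w'(1) \<Omega>(2) leb]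
  have "AE x in lebesgue_on \<Omega>. w x - w' x = 0"
  proof (rule AE_0_if_orthogonal_to_test_functions[OF \<Omega>(1)])
    show "integrable (lebesgue_on \<Omega>) (\<lambda>x. w x - w' x)" using int by (rule Bochner_Integration.integrable_diff)
    fix \<phi> assume \<phi>: "\<phi> \<in> test_functions \<Omega>"
    then have cont: "continuous_on UNIV \<phi>" by (simp add: test_functions_def C1_continuous)
    have "(LINT x|lebesgue_on \<Omega>. (w x - w' x) * \<phi> x) =
      (LINT x|lebesgue_on \<Omega>. w x * \<phi> x) - (LINT x|lebesgue_on \<Omega>. w' x * \<phi> x)"
      unfolding left_diff_distrib
      by (intro Bochner_Integration.integral_diff integrable_mult_continuous int cont \<Omega>)
    also have "\<dots> = 0" using w(2) w'(2) \<phi> unfolding has_weak_divergence_def by force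
    finally show "(LINT x|lebesgue_on \<Omega>. (w x - w' x) * \<phi> x) = 0" .
  qed
  then show ?thesis by eventually_elim simp
qed

lemma has_weak_divergence_uminus:
  "has_weak_divergence \<Omega> z w \<Longrightarrow> has_weak_divergence \<Omega> (\<lambda>x. - z x) (\<lambda>x. - w x)"
  by (simp add: has_weak_divergence_def)

section \<open>Reflection along the axis and a dual field of optimal divergence\<close>

lemma reflect_components [simp]: "reflect_x2_axis x $ 1 = - (x $ 1)" "reflect_x2_axis x $ 2 = x $ 2"
  by (simp_all add: reflect_x2_axis_def)

lemma reflect_reflect [simp]: "reflect_x2_axis (reflect_x2_axis x) = x"
  by (simp add: vec_eq_iff forall_2)

lemma reflect_inner [simp]: "reflect_x2_axis x \<bullet> reflect_x2_axis y = x \<bullet> y"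
  by (simp add: inner_vec_def sum_2)

lemma reflect_inner_right: "x \<bullet> reflect_x2_axis y = reflect_x2_axis x \<bullet> y"
  by (simp add: inner_vec_def sum_2)

lemma reflect_norm [simp]: "norm (reflect_x2_axis x) = norm x"
  by (simp add: norm_eq_sqrt_inner)

lemma reflect_linear: "linear reflect_x2_axis"
  by (rule linearI) (simp_all add: vec_eq_iff forall_2)

lemma reflect_continuous: "continuous_on S reflect_x2_axis"
  using reflect_linear linear_continuous_on linear_conv_bounded_linear by blast

lemma reflect_disc: "reflect_x2_axis x \<in> disc s r \<longleftrightarrow> x \<in> disc (- s) r"
proof -
  have "norm (disc_center s - reflect_x2_axis x) = norm (reflect_x2_axis (disc_center (- s) - x))"
    by (rule arg_cong[of _ _ norm]) (simp add: vec_eq_iff forall_2 disc_center_def)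
  then show ?thesis by (simp add: dist_norm)
qed

lemma reflect_lborel: "distr lborel borel reflect_x2_axis = lborel"
proof (rule lborel_eqI[symmetric])
  have m: "reflect_x2_axis \<in> borel_measurable lborel"
    using reflect_continuous[of UNIV] by (simp add: borel_measurable_continuous_onI)
  fix l u :: "real^2" assume lu: "\<And>b. b \<in> Basis \<Longrightarrow> l \<bullet> b \<le> u \<bullet> b"
  have lu': "l $ i \<le> u $ i" for i
    using lu[of "axis i 1"] by (simp add: inner_axis)
  have "reflect_x2_axis -` box l u = box (vector [- (u$1), l$2]) (vector [- (l$1), u$2])"
    by (auto simp: mem_box_cart forall_2)
  then have "emeasure (distr lborel borel reflect_x2_axis) (box l u)
     = emeasure lborel (box (vector [- (u$1), l$2]) (vector [- (l$1), u$2]) :: (real^2) set)"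
    using m by (simp add: emeasure_distr)
  also have "\<dots> = (\<Prod>b\<in>Basis. (vector [- (l$1), u$2] - vector [- (u$1), l$2] :: real^2) \<bullet> b)"
    by (rule emeasure_lborel_box) (use lu' in \<open>auto simp: Basis_real2 inner_axis\<close>)
  also have "(\<Prod>b\<in>Basis. (vector [- (l$1), u$2] - vector [- (u$1), l$2] :: real^2) \<bullet> b) = (\<Prod>b\<in>Basis. (u - l) \<bullet> b)"
    using Basis_real2(2) by (simp add: Basis_real2(1) inner_axis)
  finally show "emeasure (distr lborel borel reflect_x2_axis) (box l u) = (\<Prod>b\<in>Basis. (u - l) \<bullet> b)" .
qed simp

lemma integral_reflect:
  fixes f :: "real^2 \<Rightarrow> real"
  assumes "f \<in> borel_measurable borel"
  shows "(LINT x|lborel. f (reflect_x2_axis x)) = (LINT x|lborel. f x)"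
proof -
  have "reflect_x2_axis \<in> lborel \<rightarrow>\<^sub>M borel"
    using reflect_continuous[of UNIV] by (simp add: borel_measurable_continuous_onI)
  from integral_distr[OF this assms] show ?thesis by (simp add: reflect_lborel)
qed

lemma C1_reflect:
  assumes "C1 \<phi>"
  shows "C1 (\<lambda>x. \<phi> (reflect_x2_axis x))"
    "grad (\<lambda>x. \<phi> (reflect_x2_axis x)) = (\<lambda>x. reflect_x2_axis (grad \<phi> (reflect_x2_axis x)))"
proof -
  have "(reflect_x2_axis has_derivative reflect_x2_axis) (at x)" for x
    using reflect_linear by (simp add: linear_imp_has_derivative)
  from has_derivative_compose[OF this C1_has_derivative[OF assms]]
  have "((\<lambda>x. \<phi> (reflect_x2_axis x)) has_derivative
     (\<lambda>h. reflect_x2_axis (grad \<phi> (reflect_x2_axis x)) \<bullet> h)) (at x)" for x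
    by (simp add: reflect_inner_right)
  moreover have "continuous_on UNIV (\<lambda>x. reflect_x2_axis (grad \<phi> (reflect_x2_axis x)))"
    by (intro continuous_on_compose2[OF reflect_continuous[of UNIV]]
        continuous_on_compose2[OF C1_continuous_grad[OF assms, of UNIV]] reflect_continuous) auto
  ultimately show "C1 (\<lambda>x. \<phi> (reflect_x2_axis x))"
    "grad (\<lambda>x. \<phi> (reflect_x2_axis x)) = (\<lambda>x. reflect_x2_axis (grad \<phi> (reflect_x2_axis x)))"
    by (rule C1_I)+
qed

lemma grad_eq_0_outside_support:
  assumes "x \<notin> closure {x. \<phi> x \<noteq> 0}" shows "grad \<phi> x = 0"
proof (rule grad_eqI)
  have "((\<lambda>x. 0) has_derivative (\<lambda>h. 0 \<bullet> h)) (at x)" by simp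
  then show "(\<phi> has_derivative (\<lambda>h. 0 \<bullet> h)) (at x)"
    by (rule has_derivative_transform_within_open[where s="- closure {x. \<phi> x \<noteq> 0}"])
       (use assms closure_subset[of "{x. \<phi> x \<noteq> 0}"] in auto)
qed

text \<open>The maximum merges the two formulas: \<open>- (x - c)/r\<close> inside the disc and \<open>- r (x - c)/\<bar>x - c\<bar>\<^sup>2\<close>
outside.  The latter is free of divergence, being a multiple of the gradient of \<open>ln \<bar>x - c\<bar>\<close>.\<close>

definition radial_field :: "real \<Rightarrow> real^2 \<Rightarrow> real^2" where
  "radial_field r x = - (r / (max r (norm (x - disc_center r)))\<^sup>2) *\<^sub>R (x - disc_center r)"

text \<open>The value \<open>0\<close> on the axis makes the field antisymmetric under reflection everywhere.\<close>

definition optimal_field :: "real \<Rightarrow> real^2 \<Rightarrow> real^2" where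
  "optimal_field r x =
     (if x $ 1 > 0 then radial_field r x
      else if x $ 1 < 0 then - reflect_x2_axis (radial_field r (reflect_x2_axis x)) else 0)"

lemma radial_field_norm: "0 < r \<Longrightarrow> norm (radial_field r x) \<le> 1"
proof -
  assume r: "0 < r"
  let ?m = "max r (norm (x - disc_center r))"
  have "r * norm (x - disc_center r) \<le> ?m * ?m" using r by (intro mult_mono) auto
  moreover have "0 < ?m" using r by simp
  ultimately show ?thesis using r
    by (simp add: radial_field_def power2_eq_square del: max_less_iff_conj less_max_iff_disj)
qed

lemma radial_field_continuous: "0 < r \<Longrightarrow> continuous_on S (radial_field r)"
  unfolding radial_field_def[abs_def] by (intro continuous_intros) (auto simp: max_def)

lemma optimal_field_norm: "0 < r \<Longrightarrow> norm (optimal_field r x) \<le> 1"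
  by (simp add: optimal_field_def radial_field_norm)

lemma optimal_field_measurable: "0 < r \<Longrightarrow> optimal_field r \<in> borel_measurable borel"
proof -
  assume r: "0 < r"
  have 1: "radial_field r \<in> borel_measurable borel"
    using radial_field_continuous[OF r] by (rule borel_measurable_continuous_onI)
  have 2: "(\<lambda>x. - reflect_x2_axis (radial_field r (reflect_x2_axis x))) \<in> borel_measurable borel"
    by (intro borel_measurable_continuous_onI continuous_intros
        continuous_on_compose2[OF reflect_continuous[of UNIV]]
        continuous_on_compose2[OF radial_field_continuous[OF r, of UNIV]] reflect_continuous) auto
  have [measurable]: "(\<lambda>p::real^2. p $ i) \<in> borel_measurable borel" for i
    by (intro borel_measurable_continuous_onI continuous_intros)
  show ?thesis unfolding optimal_field_def[abs_def] using 1 2 by measurable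
qed

text \<open>The divergence of the radial field in the right half plane, tested with a function that vanishes on the
axis and therefore produces no boundary term there.  Along a ray the integrand is the derivative of
\<open>\<sigma> \<zeta>\<close>, where \<open>\<sigma>(s) = - min(s, r)\<^sup>2/r\<close>, cut off where the ray leaves the half plane.  The product is
continuous; it fails to be differentiable at most where the ray meets the circle and the axis.\<close>

lemma radial_field_green:
  fixes r :: real
  defines "c \<equiv> disc_center r"
  assumes \<zeta>: "C1 \<zeta>" and axis: "\<And>x. x $ 1 = 0 \<Longrightarrow> \<zeta> x = 0"
    and supp: "\<And>x. x \<notin> ball c R \<Longrightarrow> \<zeta> x = 0" and r: "0 < r" "0 < R"
  shows "(LINT x|lebesgue_on (ball c R). indicator {x. 0 < x $ 1} x *
      (radial_field r x \<bullet> grad \<zeta> x - 2 / r * indicator (ball c r) x * \<zeta> x)) = 0"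
proof -
  let ?f = "\<lambda>x. indicator {x. 0 < x $ 1} x *
      (radial_field r x \<bullet> grad \<zeta> x - 2 / r * indicator (ball c r) x * \<zeta> x)"
  obtain M1 where M1: "0 < M1" "\<And>x. x \<in> ball c R \<Longrightarrow> norm (\<zeta> x) \<le> M1"
    using continuous_bounded_on_bounded[OF C1_continuous[OF \<zeta>] bounded_ball] by metis
  obtain M2 where M2: "0 < M2" "\<And>x. x \<in> ball c R \<Longrightarrow> norm (grad \<zeta> x) \<le> M2"
    using continuous_bounded_on_bounded[OF C1_continuous_grad[OF \<zeta>] bounded_ball] by metis
  have "(LINT x|lebesgue_on (ball c R). ?f x) = integral {0..2*pi} (\<lambda>\<theta>. 0)"
  proof (rule integral_ball_by_rays)
    have [measurable]: "radial_field r \<in> borel_measurable borel"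
       "grad \<zeta> \<in> borel_measurable borel" "(\<lambda>x::real^2. x $ 1) \<in> borel_measurable borel"
      by (intro borel_measurable_continuous_onI radial_field_continuous C1_continuous C1_continuous_grad
          \<zeta> r continuous_intros)+
    have \<zeta>_borel: "\<zeta> \<in> borel_measurable borel"
      by (intro borel_measurable_continuous_onI C1_continuous \<zeta>)
    have "indicat_real (ball c r) \<in> borel_measurable borel" by (rule borel_measurable_indicator) simp
    with \<zeta>_borel have "(\<lambda>x. 2 / r * indicator (ball c r) x * \<zeta> x) \<in> borel_measurable borel"
      by (intro borel_measurable_times borel_measurable_const)
    then show "?f \<in> borel_measurable borel" by measurable
    show "\<bar>?f x\<bar> \<le> M2 + 2 / r * M1" if "x \<in> ball c R" for x
    proof -
      have "\<bar>radial_field r x \<bullet> grad \<zeta> x\<bar> \<le> norm (radial_field r x) * norm (grad \<zeta> x)"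
        by (rule Cauchy_Schwarz_ineq2)
      also have "\<dots> \<le> 1 * M2" using radial_field_norm[OF r(1)] M2(2)[OF that] by (intro mult_mono) auto
      finally have "\<bar>radial_field r x \<bullet> grad \<zeta> x\<bar> \<le> M2" by simp
      moreover have "\<bar>2 / r * indicator (ball c r) x * \<zeta> x\<bar> \<le> 2 / r * M1"
        using M1(2)[OF that] M1(1) r by (auto simp: abs_mult indicator_def divide_right_mono)
      ultimately have "\<bar>radial_field r x \<bullet> grad \<zeta> x - 2 / r * indicator (ball c r) x * \<zeta> x\<bar> \<le> M2 + 2 / r * M1"
        by linarith
      moreover have "0 \<le> M2 + 2 / r * M1" using M1(1) M2(1) r by simp
      ultimately show ?thesis by (cases "0 < x $ 1") simp_all
    qed
    fix \<theta> :: real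
    let ?e = "vector [cos \<theta>, sin \<theta>] :: real^2"
    define \<sigma> where "\<sigma> s = - (min s r)\<^sup>2 / r" for s
    define m where "m s = (if r + s * cos \<theta> \<le> 0 then 0 else \<zeta> (polar c s \<theta>))" for s
    have x1: "polar c s \<theta> $ 1 = r + s * cos \<theta>" for s by (simp add: c_def disc_center_def)
    have pol: "continuous_on UNIV (\<lambda>s. polar c s \<theta>)" by (intro continuous_intros)
    have cont: "continuous_on {0..R} (\<lambda>s. \<sigma> s * m s)"
      unfolding \<sigma>_def m_def
      by (intro continuous_on_mult continuous_on_cases_le continuous_on_const continuous_intros
           continuous_on_compose2[OF C1_continuous[OF \<zeta>, of UNIV]] continuous_on_subset[OF pol])
         (use r axis x1 in auto)
    have deriv: "((\<lambda>s. \<sigma> s * m s) has_vector_derivative s * ?f (polar c s \<theta>)) (at s)"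
      if s: "s \<in> {0<..<R} - {r, - r / cos \<theta>}" for s
    proof (cases "r + s * cos \<theta> < 0")
      case True
      have "open {s. r + s * cos \<theta> < 0}" by (intro open_Collect_less continuous_intros)
      then have "((\<lambda>s. \<sigma> s * m s) has_vector_derivative 0) (at s)"
        by (rule has_vector_derivative_transform_within_open[OF has_vector_derivative_const[of 0]])
           (use True in \<open>auto simp: m_def\<close>)
      moreover have "indicat_real {x. 0 < x $ 1} (polar c s \<theta>) = 0"
        by (rule indicator_simps(2), simp only: mem_Collect_eq x1) (use True in simp)
      ultimately show ?thesis by simp
    next
      case False
      have "r + s * cos \<theta> \<noteq> 0"
      proof
        assume 0: "r + s * cos \<theta> = 0"
        then have "cos \<theta> \<noteq> 0" using r by auto
        then have "s = - r / cos \<theta>" using 0 by (simp add: field_simps)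
        then show False using s by simp
      qed
      then have pos: "0 < r + s * cos \<theta>" using False by simp
      then have ind: "indicat_real {x. 0 < x $ 1} (polar c s \<theta>) = 1"
        by (intro indicator_simps(1)) (simp only: mem_Collect_eq x1)
      have op: "open {s. 0 < r + s * cos \<theta>}" by (intro open_Collect_less continuous_intros)
      have "((\<lambda>s. polar c s \<theta>) has_derivative (\<lambda>h. h *\<^sub>R ?e)) (at s)"
        by (auto intro!: derivative_eq_intros)
      from has_derivative_compose[OF this C1_has_derivative[OF \<zeta>]]
      have d\<zeta>: "((\<lambda>s. \<zeta> (polar c s \<theta>)) has_real_derivative (grad \<zeta> (polar c s \<theta>) \<bullet> ?e)) (at s)"
        by (simp add: has_field_derivative_def mult_commute_abs)
      have ns: "norm (polar c s \<theta> - c) = s" using s by (simp add: norm_unit_vector2)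
      show ?thesis
      proof (cases "s < r")
        case True
        have "((\<lambda>s. - s\<^sup>2 / r * \<zeta> (polar c s \<theta>)) has_real_derivative
            - s\<^sup>2 / r * (grad \<zeta> (polar c s \<theta>) \<bullet> ?e) + - (2 * s) / r * \<zeta> (polar c s \<theta>)) (at s)"
          by (rule DERIV_cong[OF DERIV_mult[OF _ d\<zeta>]]) (use r in \<open>auto intro!: derivative_eq_intros\<close>)
        then have d: "((\<lambda>s. \<sigma> s * m s) has_real_derivative
            - s\<^sup>2 / r * (grad \<zeta> (polar c s \<theta>) \<bullet> ?e) + - (2 * s) / r * \<zeta> (polar c s \<theta>)) (at s)"
          by (rule has_field_derivative_transform_within_open[where S="{s. 0 < r + s * cos \<theta>} \<inter> {..<r}"])
             (use op pos True in \<open>auto simp: \<sigma>_def m_def\<close>)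
        have "radial_field r (polar c s \<theta>) = - (s / r) *\<^sub>R ?e"
          using ns True r unfolding radial_field_def c_def[symmetric] by (simp add: power2_eq_square max_def)
        moreover have "polar c s \<theta> \<in> ball c r" using ns True by (simp add: dist_norm norm_minus_commute)
        ultimately have "- s\<^sup>2 / r * (grad \<zeta> (polar c s \<theta>) \<bullet> ?e) + - (2 * s) / r * \<zeta> (polar c s \<theta>) = s * ?f (polar c s \<theta>)"
          by (simp add: ind algebra_simps power2_eq_square inner_commute)
        with d show ?thesis by (simp only: has_real_derivative_iff_has_vector_derivative)
      next
        case False
        then have sr: "r < s" using s by simp
        have "((\<lambda>s. - r * \<zeta> (polar c s \<theta>)) has_real_derivative - r * (grad \<zeta> (polar c s \<theta>) \<bullet> ?e)) (at s)"
          by (rule DERIV_cmult[OF d\<zeta>])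
        then have "((\<lambda>s. \<sigma> s * m s) has_real_derivative - r * (grad \<zeta> (polar c s \<theta>) \<bullet> ?e)) (at s)"
          by (rule has_field_derivative_transform_within_open[where S="{s. 0 < r + s * cos \<theta>} \<inter> {r<..}"])
             (use op pos sr r in \<open>auto simp: \<sigma>_def m_def power2_eq_square\<close>)
        moreover have "radial_field r (polar c s \<theta>) = - (r / s) *\<^sub>R ?e"
          using ns sr r unfolding radial_field_def c_def[symmetric] by (simp add: power2_eq_square max_def)
        moreover have "polar c s \<theta> \<notin> ball c r" using ns sr by (simp add: dist_norm norm_minus_commute)
        ultimately show ?thesis using pos s
          by (simp add: ind has_real_derivative_iff_has_vector_derivative inner_commute)
      qed
    qed
    have "((\<lambda>s. s * ?f (polar c s \<theta>)) has_integral \<sigma> R * m R - \<sigma> 0 * m 0) {0..R}"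
      by (rule fundamental_theorem_of_calculus_interior_strong[where S="{r, - r / cos \<theta>}"])
         (use r cont deriv in auto)
    moreover have "m R = 0"
      using supp[of "polar c R \<theta>"] r by (simp add: m_def dist_norm norm_unit_vector2)
    moreover have "\<sigma> 0 = 0" using r by (simp add: \<sigma>_def)
    ultimately show "((\<lambda>s. s * ?f (polar c s \<theta>)) has_integral 0) {0..R}" by simp
  qed fact
  then show ?thesis by simp
qed

lemma borel_measurable_half_plane: "indicat_real {x::real^2. 0 < x $ 1} \<in> borel_measurable borel"
  by (intro borel_measurable_indicator borel_open open_Collect_less continuous_intros)

lemma disc_subset_half_plane: "x \<in> disc r r \<Longrightarrow> 0 < x $ 1"
proof -
  assume "x \<in> disc r r"
  then have "norm (disc_center r - x) < r" by (simp add: dist_norm)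
  moreover have "\<bar>(disc_center r - x) $ 1\<bar> \<le> norm (disc_center r - x)" by (rule component_le_norm_cart)
  ultimately show ?thesis by (simp add: disc_center_def)
qed

lemma integrable_disc:
  assumes "C1 f" shows "integrable lborel (\<lambda>x. indicator (disc s r) x * f x)"
proof -
  have "integrable lborel (\<lambda>x. indicator (cball (disc_center s) r) x *\<^sub>R f x)"
    by (intro borel_integrable_compact C1_continuous assms) simp
  from integrable_mult_indicator[OF _ this, of "disc s r"]
  have "integrable lborel (\<lambda>x. indicator (disc s r) x *\<^sub>R indicator (cball (disc_center s) r) x *\<^sub>R f x)" by simp
  moreover have "(\<lambda>x. indicator (disc s r) x *\<^sub>R indicator (cball (disc_center s) r) x *\<^sub>R f x) = (\<lambda>x. indicator (disc s r) x * f x)"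
    by (auto simp: indicator_def fun_eq_iff)
  ultimately show ?thesis by (simp only:)
qed

text \<open>Reflecting the left half plane onto the right one turns the test function \<open>\<phi>\<close> into the difference \<open>\<zeta>\<close> of
\<open>\<phi>\<close> and its mirror image, because the field is antisymmetric.  This difference vanishes on the axis, which
is how the two normal components cancel.\<close>

lemma optimal_field_divergence:
  assumes \<Omega>: "open \<Omega>" and r: "0 < r"
  shows "has_weak_divergence \<Omega> (optimal_field r) (\<lambda>x. - (2 / r) * two_disc_data r x)"
  unfolding has_weak_divergence_def
proof
  fix \<phi> assume "\<phi> \<in> test_functions \<Omega>"
  then have \<phi>: "C1 \<phi>" and K: "compact (closure {x. \<phi> x \<noteq> 0})" "closure {x. \<phi> x \<noteq> 0} \<subseteq> \<Omega>"
    by (auto simp: test_functions_def compactly_supported_in_def)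
  let ?M = reflect_x2_axis and ?c = "disc_center r" and ?V = "radial_field r"
  let ?H = "indicat_real {x::real^2. 0 < x $ 1}"
  define \<psi> where "\<psi> x = \<phi> (?M x)" for x
  define \<zeta> where "\<zeta> x = \<phi> x - \<psi> x" for x
  have \<psi>: "C1 \<psi>" "grad \<psi> = (\<lambda>x. ?M (grad \<phi> (?M x)))"
    using C1_reflect[OF \<phi>] unfolding \<psi>_def[abs_def] by auto
  have \<zeta>: "C1 \<zeta>" "grad \<zeta> = (\<lambda>x. grad \<phi> x - grad \<psi> x)"
    using C1_diff[OF \<phi> \<psi>(1)] unfolding \<zeta>_def[abs_def] by auto
  have off: "\<phi> x = 0 \<and> grad \<phi> x = 0" if "x \<notin> closure {x. \<phi> x \<noteq> 0}" for x
    using that closure_subset[of "{x. \<phi> x \<noteq> 0}"] grad_eq_0_outside_support by auto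
  have off_\<Omega>: "\<phi> x = 0 \<and> grad \<phi> x = 0" if "x \<notin> \<Omega>" for x
  proof (rule off)
    show "x \<notin> closure {x. \<phi> x \<noteq> 0}" using that K(2) by (rule contra_subsetD[rotated])
  qed
  obtain a where a: "0 < a" "\<forall>x\<in>closure {x. \<phi> x \<noteq> 0}. norm x < a"
    using compact_imp_bounded[OF K(1)] unfolding bounded_pos_less by (elim exE conjE)
  have out: "\<phi> x = 0 \<and> grad \<phi> x = 0 \<and> \<psi> x = 0 \<and> grad \<psi> x = 0" if "x \<notin> ball 0 a" for x
  proof -
    have "\<not> norm x < a" "\<not> norm (?M x) < a" using that by simp_all
    then have "x \<notin> closure {x. \<phi> x \<noteq> 0}" "?M x \<notin> closure {x. \<phi> x \<noteq> 0}" using a(2) by blast+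
    then have "\<phi> x = 0 \<and> grad \<phi> x = 0" "\<phi> (?M x) = 0 \<and> grad \<phi> (?M x) = 0" using off by blast+
    then show ?thesis by (simp add: \<psi>(2) \<psi>_def linear_0[OF reflect_linear])
  qed
  have cont_borel: "f \<in> borel_measurable borel" if "continuous_on UNIV f" for f :: "real^2 \<Rightarrow> 'b::euclidean_space"
    using that by (rule borel_measurable_continuous_onI)
  have M_borel: "?M \<in> borel_measurable borel" by (rule cont_borel[OF reflect_continuous])
  have flux_int: "(\<lambda>x. ?H x * (?V x \<bullet> grad f x)) \<in> borel_measurable borel"
     "integrable lborel (\<lambda>x. ?H x * (?V x \<bullet> grad f x))"
    if f: "C1 f" and f_out: "\<And>x. x \<notin> ball 0 a \<Longrightarrow> grad f x = 0" for f
  proof -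
    show m: "(\<lambda>x. ?H x * (?V x \<bullet> grad f x)) \<in> borel_measurable borel"
      by (intro borel_measurable_times borel_measurable_half_plane borel_measurable_inner cont_borel
          radial_field_continuous r C1_continuous_grad f)
    obtain K where K: "0 < K" "\<And>x. x \<in> ball 0 a \<Longrightarrow> norm (grad f x) \<le> K"
      using continuous_bounded_on_bounded[OF C1_continuous_grad[OF f] bounded_ball] by metis
    show "integrable lborel (\<lambda>x. ?H x * (?V x \<bullet> grad f x))"
    proof (rule integrable_bounded_support[OF m])
      fix x
      show "x \<notin> ball 0 a \<Longrightarrow> ?H x * (?V x \<bullet> grad f x) = 0" using f_out[of x] by simp
      have "\<bar>?V x \<bullet> grad f x\<bar> \<le> norm (?V x) * norm (grad f x)" by (rule Cauchy_Schwarz_ineq2)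
      also have "\<dots> \<le> 1 * K" using radial_field_norm[OF r] K f_out[of x] by (intro mult_mono) (cases "x \<in> ball 0 a"; auto)+
      finally show "\<bar>?H x * (?V x \<bullet> grad f x)\<bar> \<le> K" using K(1) by (simp add: abs_mult indicator_def)
    qed
  qed
  have \<phi>_out: "grad \<phi> x = 0" and \<psi>_out: "grad \<psi> x = 0" if "x \<notin> ball 0 a" for x
    using out[OF that] by simp_all
  note P = flux_int[OF \<phi> \<phi>_out] and Q = flux_int[OF \<psi>(1) \<psi>_out]
  have split: "optimal_field r x \<bullet> grad \<phi> x = ?H x * (?V x \<bullet> grad \<phi> x) - ?H (?M x) * (?V (?M x) \<bullet> grad \<psi> (?M x))" for x
    by (auto simp: optimal_field_def \<psi> indicator_def reflect_inner_right)
  have "(LINT x|lebesgue_on \<Omega>. optimal_field r x \<bullet> grad \<phi> x) = (LINT x|lborel. optimal_field r x \<bullet> grad \<phi> x)"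
  proof (rule integral_lebesgue_on_eq_lborel)
    show "(\<lambda>x. optimal_field r x \<bullet> grad \<phi> x) \<in> borel_measurable borel"
      by (intro borel_measurable_inner optimal_field_measurable r cont_borel C1_continuous_grad \<phi>)
    show "\<And>x. x \<notin> \<Omega> \<Longrightarrow> optimal_field r x \<bullet> grad \<phi> x = 0" using off_\<Omega> by simp
  qed (use \<Omega> in simp)
  also have "\<dots> = (LINT x|lborel. ?H x * (?V x \<bullet> grad \<phi> x)) - (LINT x|lborel. ?H (?M x) * (?V (?M x) \<bullet> grad \<psi> (?M x)))"
    unfolding split
  proof (rule Bochner_Integration.integral_diff[OF P(2)])
    have "integrable (distr lborel borel ?M) (\<lambda>x. ?H x * (?V x \<bullet> grad \<psi> x))"
      using Q(2) by (simp add: reflect_lborel)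
    then show "integrable lborel (\<lambda>x. ?H (?M x) * (?V (?M x) \<bullet> grad \<psi> (?M x)))"
      using M_borel Q(1) by (subst (asm) integrable_distr_eq) auto
  qed
  also have "\<dots> = (LINT x|lborel. ?H x * (?V x \<bullet> grad \<phi> x)) - (LINT x|lborel. ?H x * (?V x \<bullet> grad \<psi> x))"
    using integral_reflect[OF Q(1)] by simp
  also have "\<dots> = (LINT x|lborel. ?H x * (?V x \<bullet> grad \<zeta> x))"
    using Bochner_Integration.integral_diff[OF P(2) Q(2)] by (simp add: \<zeta> inner_diff_right right_diff_distrib)
  also have "\<dots> = (LINT x|lborel. 2 / r * (indicator (disc r r) x * \<zeta> x))"
  proof -
    let ?R = "a + r"
    let ?f = "\<lambda>x. ?H x * (?V x \<bullet> grad \<zeta> x - 2 / r * indicator (ball ?c r) x * \<zeta> x)"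
    have nc: "norm ?c = r" using r by (simp add: disc_center_def norm_eq_sqrt_inner inner_vec_def sum_2)
    have outR: "\<zeta> x = 0 \<and> grad \<zeta> x = 0" if "x \<notin> ball ?c ?R" for x
    proof -
      have "?R \<le> norm (?c - x)" using that by (simp add: dist_norm)
      also have "\<dots> \<le> norm ?c + norm x" by (rule norm_triangle_ineq4)
      finally have "x \<notin> ball 0 a" using nc by simp
      from out[OF this] show ?thesis by (simp add: \<zeta> \<zeta>_def)
    qed
    have axis: "\<zeta> x = 0" if "x $ 1 = 0" for x
    proof -
      have "?M x = x" using that by (simp add: vec_eq_iff forall_2)
      then show ?thesis by (simp add: \<zeta>_def \<psi>_def)
    qed
    have 0: "(LINT x|lebesgue_on (ball ?c ?R). ?f x) = 0"
      by (rule radial_field_green[OF \<zeta>(1)]) (use axis outR r a in auto)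
    have ind: "indicat_real (ball ?c r) \<in> borel_measurable borel" by (rule borel_measurable_indicator) simp
    have int1: "integrable lborel (\<lambda>x. ?H x * (?V x \<bullet> grad \<zeta> x))" and m1: "(\<lambda>x. ?H x * (?V x \<bullet> grad \<zeta> x)) \<in> borel_measurable borel"
      by (rule flux_int[OF \<zeta>(1)], use out in \<open>simp add: \<zeta>\<close>)+
    have m2: "(\<lambda>x. 2 / r * (indicator (disc r r) x * \<zeta> x)) \<in> borel_measurable borel"
      by (intro borel_measurable_times borel_measurable_const ind cont_borel C1_continuous \<zeta>)
    have int2: "integrable lborel (\<lambda>x. 2 / r * (indicator (disc r r) x * \<zeta> x))"
    proof -
      obtain K where K: "0 < K" "\<And>x. x \<in> ball 0 a \<Longrightarrow> norm (\<zeta> x) \<le> K"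
        using continuous_bounded_on_bounded[OF C1_continuous[OF \<zeta>(1)] bounded_ball] by metis
      have z: "x \<notin> ball 0 a \<Longrightarrow> \<zeta> x = 0" for x using out[of x] by (simp add: \<zeta>_def)
      have "\<bar>\<zeta> x\<bar> \<le> K" for x using K z[of x] by (cases "x \<in> ball 0 a") auto
      then have "\<bar>2 / r * (indicator (disc r r) x * \<zeta> x)\<bar> \<le> 2 / r * K" for x
        using r K(1) by (auto simp: abs_mult indicator_def divide_right_mono)
      then show ?thesis
        by (rule integrable_bounded_support[OF m2]) (use z in auto)
    qed
    have f_eq: "?f x = ?H x * (?V x \<bullet> grad \<zeta> x) - 2 / r * (indicator (disc r r) x * \<zeta> x)" for x
      using disc_subset_half_plane[of x r] by (auto simp: indicator_def right_diff_distrib)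
    have "(LINT x|lborel. ?f x) = (LINT x|lebesgue_on (ball ?c ?R). ?f x)"
      by (rule integral_lebesgue_on_eq_lborel[symmetric])
         (unfold f_eq, use m1 m2 outR in \<open>auto intro: borel_measurable_diff\<close>)
    with 0 have "(LINT x|lborel. ?f x) = 0" by simp
    then show ?thesis
      unfolding f_eq using Bochner_Integration.integral_diff[OF int1 int2] by simp
  qed
  also have "\<dots> = (LINT x|lborel. 2 / r * (indicator (disc r r) x * \<phi> x - indicator (disc r r) x * \<psi> x))"
    by (simp only: \<zeta>_def right_diff_distrib)
  also have "\<dots> = 2 / r * (LINT x|lborel. indicator (disc r r) x * \<phi> x - indicator (disc r r) x * \<psi> x)"
    by (rule integral_mult_right_zero)
  also have "(LINT x|lborel. indicator (disc r r) x * \<phi> x - indicator (disc r r) x * \<psi> x)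
     = (LINT x|lborel. indicator (disc r r) x * \<phi> x) - (LINT x|lborel. indicator (disc r r) x * \<psi> x)"
    by (rule Bochner_Integration.integral_diff; rule integrable_disc[OF \<phi>] integrable_disc[OF \<psi>(1)])
  also have "(LINT x|lborel. indicator (disc r r) x * \<psi> x) = (LINT x|lborel. indicator (disc (- r) r) x * \<phi> x)"
  proof -
    have "(\<lambda>x. indicator (disc (- r) r) x * \<phi> x) \<in> borel_measurable borel"
      by (intro borel_measurable_times cont_borel C1_continuous \<phi> borel_measurable_indicator) simp
    from integral_reflect[OF this] show ?thesis
      using reflect_disc[of _ "- r" r] by (simp only: \<psi>_def indicator_def minus_minus)
  qed
  also have "(LINT x|lborel. indicator (disc r r) x * \<phi> x) - (LINT x|lborel. indicator (disc (- r) r) x * \<phi> x)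
     = (LINT x|lborel. two_disc_data r x * \<phi> x)"
    by (subst Bochner_Integration.integral_diff[symmetric]; (rule integrable_disc[OF \<phi>])?)
       (simp add: two_disc_data_def left_diff_distrib)
  also have "2 / r * \<dots> = 2 / r * (LINT x|lebesgue_on \<Omega>. two_disc_data r x * \<phi> x)"
  proof -
    have "(\<lambda>x. two_disc_data r x * \<phi> x) \<in> borel_measurable borel"
      unfolding two_disc_data_def
      by (intro borel_measurable_times borel_measurable_diff cont_borel C1_continuous \<phi> borel_measurable_indicator) auto
    then show ?thesis
      using off_\<Omega> \<Omega> by (subst integral_lebesgue_on_eq_lborel) auto
  qed
  also have "\<dots> = - (LINT x|lebesgue_on \<Omega>. - (2 / r) * two_disc_data r x * \<phi> x)"
    by (simp add: mult.assoc)
  finally show "(LINT x|lebesgue_on \<Omega>. optimal_field r x \<bullet> grad \<phi> x) =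
      - (LINT x|lebesgue_on \<Omega>. - (2 / r) * two_disc_data r x * \<phi> x)" .
qed

section \<open>The total variation of a minimizer\<close>

lemma total_variation_scale_le:
  assumes "0 < k"
  shows "total_variation \<Omega> (\<lambda>x. k * v x) \<le> ereal k * total_variation \<Omega> v"
  unfolding total_variation_def
proof (rule SUP_least)
  fix \<phi> assume \<phi>: "\<phi> \<in> {\<phi> \<in> test_fields \<Omega>. \<forall>x. norm (\<phi> x) \<le> 1}"
  have "ereal (LINT x|lebesgue_on \<Omega>. k * v x * divergence \<phi> x) = ereal k * ereal (LINT x|lebesgue_on \<Omega>. v x * divergence \<phi> x)"
    by (simp add: mult.assoc)
  also have "\<dots> \<le> ereal k * (SUP \<phi>\<in>{\<phi> \<in> test_fields \<Omega>. \<forall>x. norm (\<phi> x) \<le> 1}. ereal (LINT x|lebesgue_on \<Omega>. v x * divergence \<phi> x))"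
    using assms \<phi> by (intro ereal_mult_left_mono SUP_upper) auto
  finally show "ereal (LINT x|lebesgue_on \<Omega>. k * v x * divergence \<phi> x)
     \<le> ereal k * (SUP \<phi>\<in>{\<phi> \<in> test_fields \<Omega>. \<forall>x. norm (\<phi> x) \<le> 1}. ereal (LINT x|lebesgue_on \<Omega>. v x * divergence \<phi> x))" .
qed

lemma total_variation_nonneg: "0 \<le> total_variation \<Omega> v"
proof -
  have "(\<lambda>x. 0) \<in> {\<phi> \<in> test_fields \<Omega>. \<forall>x. norm (\<phi> x) \<le> 1}"
    by (simp add: test_fields_def C1_const compactly_supported_in_def)
  then have "ereal (LINT x|lebesgue_on \<Omega>. v x * divergence (\<lambda>x. 0) x) \<le> total_variation \<Omega> v"
    unfolding total_variation_def by (rule SUP_upper)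
  then show ?thesis by (simp add: divergence_def C1_const(2) flip: zero_ereal_def)
qed

text \<open>This provides the competitors on the ray through a minimizer.\<close>

lemma primal_admissible_scale:
  assumes v: "v \<in> primal_admissible \<Omega>" and k: "0 < k"
  shows "(\<lambda>x. k * v x) \<in> primal_admissible \<Omega>"
proof -
  have v': "integrable (lebesgue_on \<Omega>) v" "total_variation \<Omega> v < \<infinity>" "v \<in> L2 \<Omega>" "zero_trace \<Omega> v"
    using v by (auto simp: primal_admissible_def BV_def)
  have "total_variation \<Omega> (\<lambda>x. k * v x) < \<infinity>"
    using total_variation_scale_le[OF k, of \<Omega> v] v'(2) k
    by (cases "total_variation \<Omega> v") (auto intro: le_less_trans)
  moreover have "(\<lambda>x. k * v x) \<in> L2 \<Omega>"
    using v'(3) by (auto simp: L2_def abs_mult power_mult_distrib)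
  moreover have "zero_trace \<Omega> (\<lambda>x. k * v x)"
  proof -
    have "has_trace_at \<Omega> (\<lambda>x. k * v x) x 0" if "has_trace_at \<Omega> v x 0" for x
    proof -
      have "((\<lambda>\<rho>. k * ((LINT y|lebesgue_on (\<Omega> \<inter> ball x \<rho>). \<bar>v y - 0\<bar>) / measure lebesgue (\<Omega> \<inter> ball x \<rho>))) \<longlongrightarrow> k * 0) (at_right 0)"
        using that unfolding has_trace_at_def by (rule tendsto_mult_left)
      then show ?thesis using k by (simp add: has_trace_at_def abs_mult)
    qed
    then show ?thesis using v'(4) unfolding zero_trace_def by blast
  qed
  ultimately show ?thesis using v'(1) by (simp add: primal_admissible_def BV_def)
qed

lemma linear_term_zero_if_quadratic_nonneg:
  fixes X Y :: real
  assumes "\<And>h. \<bar>h\<bar> < 1 \<Longrightarrow> 0 \<le> h * X + h\<^sup>2 * Y"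
  shows "X = 0"
proof -
  have ge: "0 \<le> Z" if Z: "\<And>h. 0 < h \<Longrightarrow> h < 1 \<Longrightarrow> 0 \<le> h * Z + h\<^sup>2 * Y" for Z
  proof (rule tendsto_lowerbound)
    show "((\<lambda>h. Z + h * Y) \<longlongrightarrow> Z) (at_right 0)" by (auto intro!: tendsto_eq_intros)
    show "\<forall>\<^sub>F h in at_right 0. 0 \<le> Z + h * Y"
      unfolding eventually_at_right_field
    proof (intro exI[of _ 1] conjI allI impI)
      fix h :: real assume h: "0 < h" "h < 1"
      from Z[OF this] have "0 \<le> h * (Z + h * Y)" by (simp add: algebra_simps power2_eq_square)
      then show "0 \<le> Z + h * Y" using h by (simp add: zero_le_mult_iff)
    qed simp
  qed simp
  have "0 \<le> X" by (rule ge) (rule assms, simp)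
  moreover have "0 \<le> - X"
  proof (rule ge)
    fix h :: real assume "0 < h" "h < 1"
    then show "0 \<le> h * - X + h\<^sup>2 * Y" using assms[of "- h"] by simp
  qed
  ultimately show ?thesis by simp
qed

text \<open>Comparison with the multiples \<open>(1 + h) u\<close> of the minimizer gives a quadratic polynomial in \<open>h\<close> that is
nonnegative near \<open>0\<close> and vanishes at \<open>0\<close>, so its linear term vanishes.\<close>

lemma total_variation_of_minimizer:
  assumes \<Omega>: "open \<Omega>" "bounded \<Omega>" and g: "g \<in> L2 \<Omega>" and k0: "0 < k0"
    and sol: "primal_solution \<Omega> \<alpha> g (\<lambda>x. k0 * g x)"
  shows "total_variation \<Omega> (\<lambda>x. k0 * g x) = ereal (\<alpha> * (1 - k0) * k0 * (L2norm \<Omega> g)\<^sup>2)"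
proof -
  let ?u = "\<lambda>x. k0 * g x"
  have adm: "?u \<in> primal_admissible \<Omega>" using sol by (simp add: primal_solution_def)
  then have "total_variation \<Omega> ?u < \<infinity>" by (simp add: primal_admissible_def BV_def)
  then obtain T where T: "total_variation \<Omega> ?u = ereal T"
    using total_variation_nonneg[of \<Omega> ?u] by (cases "total_variation \<Omega> ?u") auto
  define A where "A = \<alpha> / 2 * (L2norm \<Omega> g)\<^sup>2"
  have fid: "\<alpha> / 2 * (L2norm \<Omega> (\<lambda>x. g x - k * g x))\<^sup>2 = A * (1 - k)\<^sup>2" for k
  proof -
    have "(\<lambda>x. (g x - k * g x) * (g x - k * g x)) = (\<lambda>x. (1 - k)\<^sup>2 * (g x * g x))"
      by (simp add: fun_eq_iff algebra_simps power2_eq_square)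
    then show ?thesis by (simp add: A_def L2norm_square)
  qed
  have "0 \<le> h * (T - 2 * A * (1 - k0) * k0) + h\<^sup>2 * (A * k0\<^sup>2)" if h: "\<bar>h\<bar> < 1" for h
  proof -
    have pos: "0 < 1 + h" using h by simp
    let ?v = "\<lambda>x. (1 + h) * ?u x"
    have "ereal (T + A * (1 - k0)\<^sup>2) = primal_functional \<Omega> \<alpha> g ?u"
      using fid[of k0] by (simp add: primal_functional_def T)
    also have "\<dots> \<le> primal_functional \<Omega> \<alpha> g ?v"
      using sol primal_admissible_scale[OF adm pos] by (simp add: primal_solution_def)
    also have "\<dots> = total_variation \<Omega> ?v + ereal (A * (1 - (1 + h) * k0)\<^sup>2)"
      using fid[of "(1 + h) * k0"] by (simp add: primal_functional_def mult.assoc)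
    also have "\<dots> \<le> ereal ((1 + h) * T) + ereal (A * (1 - (1 + h) * k0)\<^sup>2)"
      using total_variation_scale_le[OF pos, of \<Omega> ?u] T by (intro add_right_mono) simp
    finally have "T + A * (1 - k0)\<^sup>2 \<le> (1 + h) * T + A * (1 - (1 + h) * k0)\<^sup>2" by simp
    then show ?thesis by (simp add: algebra_simps power2_eq_square)
  qed
  then have "T - 2 * A * (1 - k0) * k0 = 0" by (rule linear_term_zero_if_quadratic_nonneg)
  then show ?thesis by (simp add: T A_def)
qed

section \<open>Tangent discs exclude large Hoelder exponents\<close>

lemma hoelder_on_imp_continuous_on:
  assumes "0 < \<theta>" "hoelder_on \<theta> U f" shows "continuous_on U f"
  unfolding continuous_on_def
proof
  fix x assume x: "x \<in> U"
  obtain C where C: "\<And>y. y \<in> U \<Longrightarrow> dist (f y) (f x) \<le> C * dist y x powr \<theta>"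
    using assms(2) x unfolding hoelder_on_def by blast
  have "((\<lambda>y. C * dist y x powr \<theta>) \<longlongrightarrow> C * 0) (at x within U)"
    by (intro tendsto_mult_left tendsto_zero_powrI[where b=\<theta>])
       (use assms(1) in \<open>auto intro!: tendsto_eq_intros\<close>)
  then have "((\<lambda>y. dist (f y) (f x)) \<longlongrightarrow> 0) (at x within U)"
    by (intro Lim_null_comparison[of "\<lambda>y. dist (f y) (f x)" "\<lambda>y. C * dist y x powr \<theta>"])
       (auto simp: eventually_at_filter C)
  then show "(f \<longlongrightarrow> f x) (at x within U)" by (rule tendsto_dist_iff[THEN iffD2])
qed

text \<open>The points \<open>p\<close> and \<open>q\<close> at height \<open>t\<close> on the two circles have abscissas \<open>\<plusminus> d\<close> with
\<open>d = r - \<surd>(r\<^sup>2 - t\<^sup>2) \<le> t\<^sup>2/r\<close>.  The second components of the values are \<open>- t/r\<close> and \<open>t/r\<close>, so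
Hoelder continuity would give \<open>2 t/r \<le> C (2 t\<^sup>2/r) powr \<theta>\<close>.  Divided by \<open>t\<close>, the right side tends to \<open>0\<close>
for \<open>\<theta> > 1/2\<close>.\<close>

lemma not_hoelder_at_tangency:
  fixes z' :: "real^2 \<Rightarrow> real^2"
  assumes r: "0 < r" and \<theta>: "1 / 2 < \<theta>" and U: "open U" "0 \<in> U"
    and right: "\<And>x. x \<in> U \<Longrightarrow> x \<in> sphere (disc_center r) r \<Longrightarrow> z' x = - ((1 / r) *\<^sub>R (x - disc_center r))"
    and left: "\<And>x. x \<in> U \<Longrightarrow> x \<in> sphere (disc_center (- r)) r \<Longrightarrow> z' x = (1 / r) *\<^sub>R (x - disc_center (- r))"
  shows "\<not> hoelder_on \<theta> U z'"
proof
  assume "hoelder_on \<theta> U z'"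
  then obtain C where C: "\<And>x y. x \<in> U \<Longrightarrow> y \<in> U \<Longrightarrow> dist (z' x) (z' y) \<le> C * dist x y powr \<theta>"
    unfolding hoelder_on_def by blast
  obtain \<rho> where \<rho>: "0 < \<rho>" "ball 0 \<rho> \<subseteq> U" using U open_contains_ball by metis
  define K where "K = \<bar>C\<bar> * (2 / r) powr \<theta>"
  have bound: "2 / r \<le> K * t powr (2 * \<theta> - 1)" if t: "0 < t" "t < r" "t * (t / r + 1) < \<rho>" for t
  proof -
    define d where "d = r - sqrt (r\<^sup>2 - t\<^sup>2)"
    have tr: "t\<^sup>2 < r\<^sup>2" using t by (intro power_strict_mono) auto
    have sq: "(r - d)\<^sup>2 = r\<^sup>2 - t\<^sup>2" using tr by (simp add: d_def)
    have d0: "0 \<le> d" using r by (simp add: d_def real_le_lsqrt)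
    have dr: "d \<le> r" using tr by (simp add: d_def)
    have "d * r \<le> t\<^sup>2"
    proof -
      have "d * (2 * r - d) = t\<^sup>2" using sq by (simp add: algebra_simps power2_eq_square)
      moreover have "d * r \<le> d * (2 * r - d)" using d0 dr by (intro mult_left_mono) auto
      ultimately show ?thesis by simp
    qed
    then have d_le: "d \<le> t\<^sup>2 / r" using r by (simp add: field_simps)
    define p q :: "real^2" where "p = vector [d, t]" and "q = vector [- d, t]"
    have n: "norm (vector [a, b] :: real^2) = sqrt (a\<^sup>2 + b\<^sup>2)" for a b :: real
      by (simp add: norm_eq_sqrt_inner inner_vec_def sum_2 power2_eq_square)
    have small: "sqrt (d\<^sup>2 + t\<^sup>2) < \<rho>"
    proof -
      have "sqrt (d\<^sup>2 + t\<^sup>2) \<le> d + t" using d0 t by (intro sqrt_sum_squares_le_sum) auto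
      also have "\<dots> \<le> t * (t / r + 1)" using d_le by (simp add: algebra_simps power2_eq_square)
      finally show ?thesis using t by simp
    qed
    have U: "p \<in> U" "q \<in> U" using small \<rho>(2) by (auto simp: p_def q_def n subset_iff)
    have pc: "p - disc_center r = vector [d - r, t]" "q - disc_center (- r) = vector [r - d, t]"
      by (simp_all add: p_def q_def disc_center_def vec_eq_iff forall_2)
    have sp: "p \<in> sphere (disc_center r) r" "q \<in> sphere (disc_center (- r)) r"
    proof -
      have "(d - r)\<^sup>2 + t\<^sup>2 = r\<^sup>2" "(r - d)\<^sup>2 + t\<^sup>2 = r\<^sup>2" using sq by (simp_all add: power2_commute)
      then have "norm (p - disc_center r) = r" "norm (q - disc_center (- r)) = r"
        unfolding pc n using r by simp_all
      then show "p \<in> sphere (disc_center r) r" "q \<in> sphere (disc_center (- r)) r"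
        by (simp_all add: dist_norm norm_minus_commute)
    qed
    have "2 * t / r = \<bar>(z' p - z' q) $ 2\<bar>"
      unfolding right[OF U(1) sp(1)] left[OF U(2) sp(2)] pc using r t by simp
    also have "\<dots> \<le> dist (z' p) (z' q)" unfolding dist_norm by (rule component_le_norm_cart)
    also have "\<dots> \<le> C * dist p q powr \<theta>" using U by (intro C)
    also have "\<dots> \<le> \<bar>C\<bar> * dist p q powr \<theta>" by (intro mult_right_mono) auto
    also have "dist p q = 2 * d"
    proof -
      have "p - q = vector [2 * d, 0]" by (simp add: p_def q_def vec_eq_iff forall_2)
      then show ?thesis using d0 by (simp add: dist_norm n real_sqrt_mult)
    qed
    also have "\<bar>C\<bar> * (2 * d) powr \<theta> \<le> \<bar>C\<bar> * (2 / r * t\<^sup>2) powr \<theta>"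
      using d_le d0 \<theta> by (intro mult_left_mono powr_mono2) auto
    also have "\<dots> = K * t powr (2 * \<theta>)"
    proof -
      have "(t\<^sup>2) powr \<theta> = t powr (2 * \<theta>)"
        using t powr_powr[of t 2 \<theta>] by (simp add: powr_numeral)
      moreover have "(2 / r * t\<^sup>2) powr \<theta> = (2 / r) powr \<theta> * (t\<^sup>2) powr \<theta>"
        by (rule powr_mult)
      ultimately show ?thesis by (simp only: K_def mult.assoc)
    qed
    also have "\<dots> = K * t powr (2 * \<theta> - 1) * t" using t by (simp add: powr_diff)
    finally show ?thesis using t by (simp add: field_simps)
  qed
  have "((\<lambda>t. K * t powr (2 * \<theta> - 1)) \<longlongrightarrow> K * 0) (at_right 0)"
    by (intro tendsto_mult_left tendsto_zero_powrI[where b="2 * \<theta> - 1"])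
       (use \<theta> in \<open>auto intro!: tendsto_eq_intros simp: eventually_at_filter\<close>)
  moreover have "\<forall>\<^sub>F t in at_right 0. 2 / r \<le> K * t powr (2 * \<theta> - 1)"
  proof -
    have "((\<lambda>t. t * (t / r + 1)) \<longlongrightarrow> 0) (at_right 0)" using r by (auto intro!: tendsto_eq_intros)
    from order_tendstoD(2)[OF this \<rho>(1)] have "\<forall>\<^sub>F t in at_right 0. t * (t / r + 1) < \<rho>" .
    moreover have "\<forall>\<^sub>F t in at_right (0::real). 0 < t \<and> t < r"
      using r by (auto simp: eventually_at_right_field)
    ultimately show ?thesis by eventually_elim (use bound in blast)
  qed
  ultimately have "2 / r \<le> K * 0" by (intro tendsto_lowerbound) auto
  then show False using r by simp
qed

section \<open>The data of two discs\<close>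

lemma two_disc_data_on_discs:
  shows two_disc_data_right: "x \<in> disc r r \<Longrightarrow> two_disc_data r x = 1"
    and two_disc_data_left: "x \<in> disc (- r) r \<Longrightarrow> two_disc_data r x = - 1"
proof -
  have l: "x \<in> disc (- r) r \<Longrightarrow> x $ 1 < 0"
    using disc_subset_half_plane[of "reflect_x2_axis x" r] reflect_disc[of x r r] by simp
  show "x \<in> disc r r \<Longrightarrow> two_disc_data r x = 1" "x \<in> disc (- r) r \<Longrightarrow> two_disc_data r x = - 1"
    using l disc_subset_half_plane[of x r] unfolding two_disc_data_def by (auto simp: indicator_def)
qed

lemma two_disc_data_measurable: "two_disc_data r \<in> borel_measurable borel"
  unfolding two_disc_data_def[abs_def] by (intro borel_measurable_diff borel_measurable_indicator) auto

lemma two_disc_data_bounded: "\<bar>two_disc_data r x\<bar> \<le> 1"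
  by (simp add: two_disc_data_def indicator_def)

lemma integral_two_disc_data:
  assumes f: "integrable (lebesgue_on \<Omega>) f" and \<Omega>: "\<Omega> \<in> sets lebesgue"
    and sub: "disc r r \<subseteq> \<Omega>" "disc (- r) r \<subseteq> \<Omega>"
  shows "(LINT x|lebesgue_on \<Omega>. f x * two_disc_data r x)
    = (LINT x|lebesgue_on (disc r r). f x) - (LINT x|lebesgue_on (disc (- r) r). f x)"
proof -
  have part: "integrable (lebesgue_on \<Omega>) (\<lambda>x. f x * indicator (disc s r) x) \<and>
      (LINT x|lebesgue_on \<Omega>. f x * indicator (disc s r) x) = (LINT x|lebesgue_on (disc s r). f x)"
    if "disc s r \<subseteq> \<Omega>" for s
  proof
    have "disc s r \<in> sets (lebesgue_on \<Omega>)" using that \<Omega> by (simp add: sets_restrict_space_iff)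
    then show "integrable (lebesgue_on \<Omega>) (\<lambda>x. f x * indicator (disc s r) x)"
      using f by (rule integrable_real_mult_indicator)
    have "(LINT x|lebesgue_on \<Omega>. f x * indicator (disc s r) x) = (LINT x|lebesgue_on (disc s r). f x * indicator (disc s r) x)"
      using that \<Omega> by (intro integral_on_subset) auto
    also have "\<dots> = (LINT x|lebesgue_on (disc s r). f x)"
      by (intro Bochner_Integration.integral_cong) auto
    finally show "(LINT x|lebesgue_on \<Omega>. f x * indicator (disc s r) x) = (LINT x|lebesgue_on (disc s r). f x)" .
  qed
  show ?thesis
    using part[OF sub(1)] part[OF sub(2)] by (simp add: two_disc_data_def right_diff_distrib)
qed

section \<open>Dual solutions for two tangent discs\<close>

theorem corollary3p2:
  fixes \<Omega> :: "(real^2) set" and r \<alpha> :: real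
    and g u :: "real^2 \<Rightarrow> real" and z :: "real^2 \<Rightarrow> real^2"
  assumes domain: "bounded_lipschitz_domain \<Omega>"
    and symmetric: "symmetric_x2_axis \<Omega>"
    and r: "r > 0"
    and discs: "closure (disc r r) \<subseteq> \<Omega>" "closure (disc (- r) r) \<subseteq> \<Omega>"
    and g: "g = two_disc_data r"
    and \<alpha>: "\<alpha> > 0" "\<alpha> * r > 2"
    and u: "u = (\<lambda>x. (1 - 2 / (\<alpha> * r)) * g x)"
    and minimizer: "primal_solution \<Omega> \<alpha> g u"
    and z: "dual_solution \<Omega> \<alpha> g z"
  shows
    "(AE x in lebesgue_on \<Omega>. weak_div \<Omega> z x = \<alpha> * (u x - g x)) \<and>
     (AE x in lebesgue_on \<Omega>. weak_div \<Omega> z x = - (2 / r) * g x) \<and>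
     in_TV_subdifferential \<Omega> z u \<and>
     has_normal_trace_on_circle \<Omega> z (disc_center r) r (\<lambda>x. - 1) \<and>
     has_normal_trace_on_circle \<Omega> z (disc_center (- r)) r (\<lambda>x. 1) \<and>
     (\<forall>U z'. open U \<and> U \<subseteq> \<Omega> \<and> continuous_representative_on U z z' \<longrightarrow>
        (\<forall>x \<in> U \<inter> frontier (disc r r). z' x = - outer_normal (disc_center r) r x) \<and>
        (\<forall>x \<in> U \<inter> frontier (disc (- r) r). z' x = outer_normal (disc_center (- r)) r x)) \<and>
     (\<forall>\<theta> > 1/2. \<not> hoelder_at \<Omega> \<theta> z 0)"
proof -
  define w where "w = weak_div \<Omega> z"
  define w0 where "w0 x = - (2 / r) * g x" for x
  define k0 where "k0 = 1 - 2 / (\<alpha> * r)"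
  have \<Omega>: "open \<Omega>" "bounded \<Omega>" "\<Omega> \<in> sets lebesgue"
    using domain by (auto simp: bounded_lipschitz_domain_def)
  have cballs: "cball (disc_center r) r \<subseteq> \<Omega>" "cball (disc_center (- r)) r \<subseteq> \<Omega>"
    using discs r by simp_all
  then have balls: "disc r r \<subseteq> \<Omega>" "disc (- r) r \<subseteq> \<Omega>"
    using ball_subset_cball by blast+
  have g_meas: "g \<in> borel_measurable (lebesgue_on \<Omega>)"
    unfolding g by (intro measurable_restrict_space1 measurable_completion) (simp add: two_disc_data_measurable)
  have gL2: "g \<in> L2 \<Omega>"
    using g_meas \<Omega>(2,3) two_disc_data_bounded[of r] by (intro L2_I_bounded[where K=1]) (auto simp: g)
  have w0L2: "w0 \<in> L2 \<Omega>"
    unfolding w0_def[abs_def]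
    by (intro L2_I_bounded[where K="2 / r"] borel_measurable_times borel_measurable_const g_meas \<Omega>)
       (use r two_disc_data_bounded[of r] in \<open>simp add: g abs_mult divide_right_mono\<close>)
  have zW: "z \<in> W2_div \<Omega>" and z_max: "\<And>y. y \<in> W2_div \<Omega> \<Longrightarrow> dual_functional \<Omega> \<alpha> g y \<le> dual_functional \<Omega> \<alpha> g z"
    using z by (auto simp: dual_solution_def)
  have wL2: "w \<in> L2 \<Omega>" and w_div: "has_weak_divergence \<Omega> z w"
    using weak_div_spec[OF zW] by (simp_all add: w_def)
  note int = L2_integrable[OF _ \<Omega>(2,3)]

  \<comment> \<open>the explicit competitor; its chosen divergence agrees with \<open>w\<^sub>0\<close> only almost everywhere\<close>
  let ?y = "optimal_field r"
  have y_div: "has_weak_divergence \<Omega> ?y w0"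
    using optimal_field_divergence[OF \<Omega>(1) r] by (simp add: w0_def[abs_def] g)
  have y_meas: "?y \<in> borel_measurable (lebesgue_on \<Omega>)"
    by (intro measurable_restrict_space1 measurable_completion) (simp add: optimal_field_measurable r)
  have "?y \<in> L2 \<Omega>"
    using y_meas \<Omega>(2,3) optimal_field_norm[OF r] by (rule L2_I_bounded)
  then have yW: "?y \<in> W2_div \<Omega>" using w0L2 y_div by (auto simp: W2_div_def)
  have y_w0: "AE x in lebesgue_on \<Omega>. weak_div \<Omega> ?y x = w0 x"
    by (rule weak_div_unique[OF \<Omega>(1,2) weak_div_spec[OF yW] w0L2 y_div])

  let ?N = "\<lambda>f. LINT x|lebesgue_on \<Omega>. (f x + \<alpha> * g x) * (f x + \<alpha> * g x)"
  have le: "dual_functional \<Omega> \<alpha> g ?y \<le> dual_functional \<Omega> \<alpha> g z" by (rule z_max[OF yW])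
  have ind_y: "unit_ball_indicator \<Omega> ?y = 0"
    by (simp add: unit_ball_indicator_def optimal_field_norm[OF r])
  \<comment> \<open>otherwise the dual functional would be \<open>-\<infinity>\<close> at \<open>z\<close>, but it is finite at the competitor\<close>
  have z_le_1: "AE x in lebesgue_on \<Omega>. norm (z x) \<le> 1"
  proof (rule ccontr)
    assume "\<not> ?thesis"
    then have "dual_functional \<Omega> \<alpha> g z = - \<infinity>" by (simp add: dual_functional_def unit_ball_indicator_def)
    with le ind_y show False by (simp add: dual_functional_def)
  qed
  then have ind_z: "unit_ball_indicator \<Omega> z = 0" by (simp add: unit_ball_indicator_def)
  have N_y: "?N (weak_div \<Omega> ?y) = ?N w0"
  proof (rule integral_cong_AE)
    show "(\<lambda>x. (weak_div \<Omega> ?y x + \<alpha> * g x) * (weak_div \<Omega> ?y x + \<alpha> * g x)) \<in> borel_measurable (lebesgue_on \<Omega>)"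
      using weak_div_spec(1)[OF yW] g_meas
      by (intro borel_measurable_times borel_measurable_add borel_measurable_const) (auto simp: L2_def)
    show "(\<lambda>x. (w0 x + \<alpha> * g x) * (w0 x + \<alpha> * g x)) \<in> borel_measurable (lebesgue_on \<Omega>)"
      using w0L2 g_meas
      by (intro borel_measurable_times borel_measurable_add borel_measurable_const) (auto simp: L2_def)
    show "AE x in lebesgue_on \<Omega>. (weak_div \<Omega> ?y x + \<alpha> * g x) * (weak_div \<Omega> ?y x + \<alpha> * g x)
        = (w0 x + \<alpha> * g x) * (w0 x + \<alpha> * g x)"
      using y_w0 by eventually_elim simp
  qed
  have "1 / (2 * \<alpha>) * ?N w \<le> 1 / (2 * \<alpha>) * ?N w0"
    using le by (simp add: dual_functional_def ind_y ind_z L2norm_square N_y flip: w_def)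
  then have N_le: "?N w \<le> ?N w0" using \<alpha>(1) by (simp add: field_simps)

  have z_meas: "z \<in> borel_measurable (lebesgue_on \<Omega>)" using zW by (auto simp: W2_div_def L2_def)
  interpret R: disc_field \<Omega> z w "disc_center r" r
    by unfold_locales (fact \<Omega>(3) cballs(1) r z_meas z_le_1 int[OF wL2] w_div)+
  \<comment> \<open>the sign change turns the left disc, which \<open>z\<close> flows out of, into one with inward flow\<close>
  interpret L: disc_field \<Omega> "\<lambda>x. - z x" "\<lambda>x. - w x" "disc_center (- r)" r
    by unfold_locales
       (use \<Omega>(3) cballs(2) r z_meas z_le_1 int[OF wL2] has_weak_divergence_uminus[OF w_div] in auto)

  define G where "G = (LINT x|lebesgue_on \<Omega>. g x * g x)"
  have G: "G = 2 * pi * r\<^sup>2"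
  proof -
    have "(LINT x|lebesgue_on (disc r r). g x) = (LINT x|lebesgue_on (disc r r). 1)"
      by (intro Bochner_Integration.integral_cong) (simp_all add: g two_disc_data_right)
    moreover have "(LINT x|lebesgue_on (disc (- r) r). g x) = (LINT x|lebesgue_on (disc (- r) r). - 1)"
      by (intro Bochner_Integration.integral_cong) (simp_all add: g two_disc_data_left)
    ultimately show ?thesis
      using integral_two_disc_data[OF int[OF gL2] \<Omega>(3) balls] measure_disc[OF r]
      by (simp add: G_def g measure_restrict_space)
  qed
  have wg: "- (2 / r) * G \<le> (LINT x|lebesgue_on \<Omega>. w x * g x)"
  proof -
    have "- (2 * pi * r) - 2 * pi * r \<le> (LINT x|lebesgue_on (disc r r). w x) - (LINT x|lebesgue_on (disc (- r) r). w x)"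
      using R.integral_div_ge L.integral_div_ge by simp
    also have "\<dots> = (LINT x|lebesgue_on \<Omega>. w x * g x)"
      unfolding g by (rule integral_two_disc_data[OF int[OF wL2] \<Omega>(3) balls, symmetric])
    finally show ?thesis using r by (simp add: G power2_eq_square)
  qed
  have int_gg: "integrable (lebesgue_on \<Omega>) (\<lambda>x. g x * g x)" and int_wg: "integrable (lebesgue_on \<Omega>) (\<lambda>x. w x * g x)"
    and int_ww: "integrable (lebesgue_on \<Omega>) (\<lambda>x. w x * w x)"
    by (intro L2_integrable_product gL2 wL2)+
  have int_d: "integrable (lebesgue_on \<Omega>) (\<lambda>x. (w x - w0 x) * (w x - w0 x))"
  proof -
    have "integrable (lebesgue_on \<Omega>) (\<lambda>x. w x * w x + 4 / r * (w x * g x) + 4 / r\<^sup>2 * (g x * g x))"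
      by (intro Bochner_Integration.integrable_add integrable_mult_right int_ww int_wg int_gg)
    then show ?thesis by (simp add: w0_def algebra_simps power2_eq_square add_divide_distrib)
  qed
  \<comment> \<open>expansion of \<open>\<parallel>w + \<alpha> g\<parallel>\<^sup>2\<close> around \<open>w\<^sub>0\<close>, using \<open>w\<^sub>0 + \<alpha> g = (\<alpha> - 2/r) g\<close>\<close>
  have N_expand: "?N w = ?N w0 + 2 * (\<alpha> - 2 / r) * ((LINT x|lebesgue_on \<Omega>. w x * g x) + 2 / r * G)
      + (LINT x|lebesgue_on \<Omega>. (w x - w0 x) * (w x - w0 x))"
  proof -
    have "?N w = (LINT x|lebesgue_on \<Omega>. (\<alpha> - 2 / r)\<^sup>2 * (g x * g x)
        + (2 * (\<alpha> - 2 / r) * (w x * g x) + 2 * (\<alpha> - 2 / r) * (2 / r) * (g x * g x))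
        + (w x - w0 x) * (w x - w0 x))"
      by (intro Bochner_Integration.integral_cong refl) (simp add: w0_def algebra_simps power2_eq_square)
    also have "\<dots> = (\<alpha> - 2 / r)\<^sup>2 * G + (2 * (\<alpha> - 2 / r) * (LINT x|lebesgue_on \<Omega>. w x * g x)
        + 2 * (\<alpha> - 2 / r) * (2 / r) * G) + (LINT x|lebesgue_on \<Omega>. (w x - w0 x) * (w x - w0 x))"
      by (simp add: int_gg int_wg int_d G_def)
    also have "(\<alpha> - 2 / r)\<^sup>2 * G = ?N w0"
    proof -
      have "(w0 x + \<alpha> * g x) * (w0 x + \<alpha> * g x) = (\<alpha> - 2 / r)\<^sup>2 * (g x * g x)" for x
        by (simp add: w0_def algebra_simps power2_eq_square)
      then show ?thesis by (simp add: G_def)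
    qed
    finally show ?thesis by (simp add: algebra_simps)
  qed
  \<comment> \<open>the cross term has a sign because of \<open>\<alpha> r > 2\<close> and the flux bound\<close>
  have "2 / r < \<alpha>" using r \<alpha> by (simp add: field_simps)
  then have "0 \<le> 2 * (\<alpha> - 2 / r) * ((LINT x|lebesgue_on \<Omega>. w x * g x) + 2 / r * G)"
    using wg by (intro mult_nonneg_nonneg) auto
  then have "(LINT x|lebesgue_on \<Omega>. (w x - w0 x) * (w x - w0 x)) \<le> 0"
    using N_le N_expand by linarith
  moreover have "0 \<le> (LINT x|lebesgue_on \<Omega>. (w x - w0 x) * (w x - w0 x))" by simp
  ultimately have "(LINT x|lebesgue_on \<Omega>. (w x - w0 x) * (w x - w0 x)) = 0" by simp
  then have w_w0: "AE x in lebesgue_on \<Omega>. w x = w0 x"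
    using integral_nonneg_eq_0_iff_AE[OF int_d] by simp

  have "AE x in lebesgue_on \<Omega>. weak_div \<Omega> z x = - (2 / r) * g x"
    using w_w0 by (simp add: w_def w0_def)
  moreover have "\<alpha> * (u x - g x) = - (2 / r) * g x" for x
    using \<alpha>(1) r by (simp add: u field_simps)
  ultimately have div: "AE x in lebesgue_on \<Omega>. weak_div \<Omega> z x = \<alpha> * (u x - g x)"
    "AE x in lebesgue_on \<Omega>. weak_div \<Omega> z x = - (2 / r) * g x" by simp_all

  have k0: "0 < k0" using \<alpha> r by (simp add: k0_def)
  have subdiff: "in_TV_subdifferential \<Omega> z u"
  proof -
    have "total_variation \<Omega> u = ereal (\<alpha> * (1 - k0) * k0 * (L2norm \<Omega> g)\<^sup>2)"
      using total_variation_of_minimizer[OF \<Omega>(1,2) gL2 k0] minimizer by (simp add: u k0_def)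
    also have "\<alpha> * (1 - k0) * k0 * (L2norm \<Omega> g)\<^sup>2 = k0 * (2 / r) * G"
      using \<alpha> r by (simp add: k0_def L2norm_square G_def)
    also have "k0 * (2 / r) * G = - (LINT x|lebesgue_on \<Omega>. - (k0 * (2 / r)) * (g x * g x))"
      by (simp add: G_def)
    also have "(LINT x|lebesgue_on \<Omega>. - (k0 * (2 / r)) * (g x * g x)) = (LINT x|lebesgue_on \<Omega>. u x * weak_div \<Omega> z x)"
    proof (rule integral_cong_AE)
      show "AE x in lebesgue_on \<Omega>. - (k0 * (2 / r)) * (g x * g x) = u x * weak_div \<Omega> z x"
        using div(2) by eventually_elim (simp add: u k0_def)
      show "(\<lambda>x. - (k0 * (2 / r)) * (g x * g x)) \<in> borel_measurable (lebesgue_on \<Omega>)"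
        by (intro borel_measurable_times borel_measurable_const g_meas)
      show "(\<lambda>x. u x * weak_div \<Omega> z x) \<in> borel_measurable (lebesgue_on \<Omega>)"
        unfolding u using wL2 by (intro borel_measurable_times borel_measurable_const g_meas) (auto simp: w_def L2_def)
    qed
    finally show ?thesis using z_le_1 by (simp add: in_TV_subdifferential_def)
  qed

  \<comment> \<open>for \<open>a = \<plusminus> 1\<close> these are the extreme values of the flux\<close>
  have w_on: "(LINT x|lebesgue_on (disc s r). w x) = - (2 / r) * a * (pi * r\<^sup>2)"
    if "disc s r \<subseteq> \<Omega>" "\<And>x. x \<in> disc s r \<Longrightarrow> g x = a" for s a
  proof -
    have "(LINT x|lebesgue_on (disc s r). w x) = (LINT x|lebesgue_on (disc s r). - (2 / r) * a)"
    proof (rule integral_cong_AE)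
      show "w \<in> borel_measurable (lebesgue_on (disc s r))"
        by (rule measurable_on_subset[OF _ that(1)]) (use wL2 in \<open>simp add: L2_def\<close>)
      show "AE x in lebesgue_on (disc s r). w x = - (2 / r) * a"
        using AE_on_subset[OF w_w0 that(1) _ \<Omega>(3)] AE_space[of "lebesgue_on (disc s r)"]
        by (auto simp: w0_def that(2) elim!: eventually_elim2)
    qed simp
    then show ?thesis using measure_disc[OF r] by (simp add: measure_restrict_space)
  qed
  interpret R: extremal_disc_field \<Omega> z w "disc_center r" r
    by unfold_locales (use w_on[OF balls(1), of 1] r two_disc_data_right in \<open>simp add: g power2_eq_square\<close>)
  interpret L: extremal_disc_field \<Omega> "\<lambda>x. - z x" "\<lambda>x. - w x" "disc_center (- r)" r
    by unfold_locales (use w_on[OF balls(2), of "- 1"] r two_disc_data_left in \<open>simp add: g power2_eq_square\<close>)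
  have trace_R: "has_normal_trace_on_circle \<Omega> z (disc_center r) r (\<lambda>x. - 1)"
    unfolding has_normal_trace_on_circle_def
    using R.normal_trace by (simp add: w_def circle_integral_def)
  have trace_L: "has_normal_trace_on_circle \<Omega> z (disc_center (- r)) r (\<lambda>x. 1)"
    unfolding has_normal_trace_on_circle_def
  proof (intro allI impI)
    fix \<phi> assume "C1 \<phi>"
    from L.normal_trace[OF this]
    have "- (LINT x|lebesgue_on (disc (- r) r). w x * \<phi> x + z x \<bullet> grad \<phi> x) = - circle_integral (disc_center (- r)) r \<phi>"
      by (subst Bochner_Integration.integral_minus[symmetric]) simp
    then show "(LINT x|lebesgue_on (disc (- r) r). weak_div \<Omega> z x * \<phi> x + z x \<bullet> grad \<phi> x)
        = circle_integral (disc_center (- r)) r (\<lambda>x. 1 * \<phi> x)" by (simp add: w_def)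
  qed

  have pointwise: "(x \<in> sphere (disc_center r) r \<longrightarrow> z' x = - outer_normal (disc_center r) r x) \<and>
      (x \<in> sphere (disc_center (- r)) r \<longrightarrow> z' x = outer_normal (disc_center (- r)) r x)"
    if "open U" "U \<subseteq> \<Omega>" "continuous_on U z'" "AE x in lebesgue_on U. z' x = z x" "x \<in> U" for U z' x
  proof (intro conjI impI)
    assume "x \<in> sphere (disc_center r) r"
    from R.trace_of_continuous_representative[OF that this]
    show "z' x = - outer_normal (disc_center r) r x" by (simp add: outer_normal_def)
  next
    assume x: "x \<in> sphere (disc_center (- r)) r"
    have "continuous_on U (\<lambda>x. - z' x)" using that(3) by (rule continuous_on_minus)
    moreover have "AE x in lebesgue_on U. - z' x = - z x" using that(4) by eventually_elim simp
    ultimately have "- z' x = - ((1 / r) *\<^sub>R (x - disc_center (- r)))"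
      using L.trace_of_continuous_representative[OF that(1,2) _ _ that(5) x] by blast
    then show "z' x = outer_normal (disc_center (- r)) r x" by (simp add: outer_normal_def)
  qed
  have frontier: "frontier (disc s r) = sphere (disc_center s) r" for s using r by simp

  have "\<not> hoelder_at \<Omega> \<theta> z 0" if \<theta>: "1 / 2 < \<theta>" for \<theta>
  proof
    assume "hoelder_at \<Omega> \<theta> z 0"
    then obtain U z' where U: "open U" "0 \<in> U" "U \<subseteq> \<Omega>" "AE x in lebesgue_on U. z' x = z x" "hoelder_on \<theta> U z'"
      unfolding hoelder_at_def by blast
    have "continuous_on U z'" using \<theta> U(5) by (intro hoelder_on_imp_continuous_on[of \<theta>]) auto
    from pointwise[OF U(1,3) this U(4)] not_hoelder_at_tangency[OF r \<theta> U(1,2), of z'] U(5)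
    show False by (simp add: outer_normal_def)
  qed
  with div subdiff trace_R trace_L pointwise show ?thesis
    unfolding frontier continuous_representative_on_def by blast
qed

end
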